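(* Let $m,d\in\mathbb{N}^+$. Then for the prevalent $f\in C([0,1]^m,\mathbb{R}^d)$ there is an open set $U_f\subset\mathbb{R}^d$ such that $\lambda^m(f^{-1}(U_f))=1$ (hence $U_f$ is dense in $f([0,1]^m)$) and for all $y\in U_f$ we have $$\dim_H f^{-1}(y)=m.$$
   Context: Prevalence: for an abelian Polish group $G$, a set $A\subset G$ is shy if there exist a Borel set $B\supset A$ in $G$ and a Borel probability measure $\nu$ on $G$ with $\nu(B+x)=0$ for all $x\in G$; complements of shy sets are prevalent. "For the prevalent $f\in G$ property $P$ holds" means that $\{f\in G: P(f)\}$ is prevalent. For compact metric $K$, $C(K,\mathbb{R}^d)$ is the Banach space of continuous maps $K\to\mathbb{R}^d$ with the maximum norm (an abelian Polish group under addition). $\lambda^m$ is $m$-dimensional Lebesgue measure; $\dim_H$ is Hausdorff dimension, with $\dim_H\emptyset=-1$. "$U_f$ is dense in $f([0,1]^m)$" means that $U_f\cap f([0,1]^m)$ is dense in $f([0,1]^m)$. *)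

theory Defs
  imports "HOL-Probability.Probability"
begin

section \<open>Shy and prevalent sets\<close>

text \<open>
  The notions are meant for abelian Polish groups; only the group operations and the Borel
  structure enter the definition. Translation is a homeomorphism, so the translates of
  \<open>B\<close> below are again Borel sets.
\<close>

definition shy :: "'a::topological_ab_group_add set \<Rightarrow> bool" where
  "shy A \<longleftrightarrow> (\<exists>B\<in>sets borel. A \<subseteq> B \<and>
     (\<exists>\<nu>. prob_space \<nu> \<and> sets \<nu> = sets borel \<and>
        (\<forall>x. emeasure \<nu> ((\<lambda>b. b + x) ` B) = 0)))"

definition prevalent :: "'a::topological_ab_group_add set \<Rightarrow> bool" where
  "prevalent A \<longleftrightarrow> shy (- A)"

section \<open>Hausdorff dimension\<close>

text \<open>
  The convention for \<open>s = 0\<close> is \<open>(diam U)\<^sup>0 = 1\<close> for nonempty \<open>U\<close>; it has to be spelled out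
  because \<open>0 powr 0 = 0\<close>. The library's \<open>diameter\<close> is only meaningful on bounded sets, whence
  the explicit boundedness in the definition of covers.
\<close>

definition diam_pow :: "real \<Rightarrow> 'a::metric_space set \<Rightarrow> ennreal" where
  "diam_pow s U = (if U = {} then 0 else if s = 0 then 1 else ennreal (diameter U powr s))"

definition hausdorff_premeasure :: "real \<Rightarrow> real \<Rightarrow> 'a::metric_space set \<Rightarrow> ennreal" where
  "hausdorff_premeasure s \<delta> A =
     (INF U \<in> {U :: nat \<Rightarrow> 'a set. A \<subseteq> (\<Union>i. U i) \<and> (\<forall>i. bounded (U i) \<and> diameter (U i) \<le> \<delta>)}.
        (\<Sum>i. diam_pow s (U i)))"

definition hausdorff_measure :: "real \<Rightarrow> 'a::metric_space set \<Rightarrow> ennreal" where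
  "hausdorff_measure s A = (SUP \<delta>\<in>{0<..}. hausdorff_premeasure s \<delta> A)"

definition hausdorff_dim :: "'a::metric_space set \<Rightarrow> ereal" where
  "hausdorff_dim A =
     (if A = {} then - 1 else (INF s \<in> {s. 0 \<le> s \<and> hausdorff_measure s A = 0}. ereal s))"

section \<open>The unit cube as a compact metric space\<close>

typedef (overloaded) 'm cube = "cbox 0 1 :: (real ^ 'm::finite) set"
  by (rule exI[of _ 0]) (simp add: mem_box_cart)

instantiation cube :: (finite) metric_space
begin

definition dist_cube :: "'a cube \<Rightarrow> 'a cube \<Rightarrow> real" where
  "dist_cube x y = dist (Rep_cube x) (Rep_cube y)"

definition uniformity_cube :: "('a cube \<times> 'a cube) filter" where
  "uniformity_cube = (INF e\<in>{0<..}. principal {(x, y). dist x y < e})"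

definition open_cube :: "'a cube set \<Rightarrow> bool" where
  "open_cube U \<longleftrightarrow> (\<forall>x\<in>U. eventually (\<lambda>(x', y). x' = x \<longrightarrow> y \<in> U) uniformity)"

instance
proof
  fix x y z :: "'a cube"
  show "dist x y = 0 \<longleftrightarrow> x = y"
    by (simp add: dist_cube_def Rep_cube_inject)
  show "dist x y \<le> dist x z + dist y z"
    unfolding dist_cube_def by (rule dist_triangle2)
qed (simp_all add: uniformity_cube_def open_cube_def)

end

lemma Rep_cube_image_UNIV: "range Rep_cube = cbox 0 (1 :: real ^ 'm::finite)"
  using type_definition.Rep_range[OF type_definition_cube] .

lemma continuous_on_Rep_cube: "continuous_on S Rep_cube"
  by (auto simp: continuous_on_iff dist_cube_def)

lemma compact_UNIV_cube: "compact (UNIV :: 'm::finite cube set)"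
proof -
  have "continuous_on (cbox 0 (1 :: real ^ 'm)) Abs_cube"
    by (auto simp: continuous_on_iff dist_cube_def Abs_cube_inverse)
  then have "compact (Abs_cube ` cbox 0 (1 :: real ^ 'm))"
    by (rule compact_continuous_image) simp
  moreover have "Abs_cube ` cbox 0 (1 :: real ^ 'm) = UNIV"
    using type_definition.Abs_image[OF type_definition_cube] .
  ultimately show ?thesis by simp
qed

text \<open>
  As the cube is compact, every continuous map on it is bounded, and the library's
  bounded continuous functions with the supremum norm are the space \<open>C([0,1]\<^sup>m, \<real>\<^sup>d)\<close>.
\<close>

lemma continuous_on_cube_bcontfun:
  fixes f :: "'m::finite cube \<Rightarrow> 'b::metric_space"
  shows "continuous_on UNIV f \<longleftrightarrow> f \<in> bcontfun"
  using compact_continuous_image[OF _ compact_UNIV_cube, THEN compact_imp_bounded, of f]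
  by (auto simp: bcontfun_def)

text \<open>The preimage \<open>f\<^sup>-\<^sup>1(S)\<close>, as a subset of \<open>[0,1]\<^sup>m \<subseteq> \<real>\<^sup>m\<close>.\<close>

definition cube_preimage :: "('m::finite cube \<Rightarrow>\<^sub>C 'b::metric_space) \<Rightarrow> 'b set \<Rightarrow> (real ^ 'm) set" where
  "cube_preimage f S = Rep_cube ` (apply_bcontfun f -` S)"

end

theory Submission
  imports Defs "HOL-Real_Asymp.Real_Asymp"
begin

text \<open>
  The witness measure is the law of a random map \<open>f = \<Sum>\<^sub>k 2\<^sup>-\<^sup>k f\<^sub>k\<close>, where \<open>f\<^sub>k\<close> is, up to a thin
  margin, constant on the cells of a grid of mesh \<open>2 ^ - 2 ^ k\<close> with independent uniform values in
  \<open>{-10..10}\<^sup>d\<close>. Let \<open>g\<close> be an arbitrary continuous map; its modulus of continuity may be much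
  worse than that of \<open>f\<close>. Pigeonholing the values of \<open>g\<close> into dyadic colours at scale \<open>2\<^sup>-\<^sup>k\<close>
  repairs this: call a cell of level \<open>k\<close> rich for a colour if \<open>g\<close> has that colour on a proportion
  at least \<open>2\<^sup>-\<^sup>(\<^sup>d\<^sup>+\<^sup>1\<^sup>)\<^sup>k\<close> of it. By Borel-Cantelli almost every point lies in rich cells from
  some level on, and a rich cell always has a colour refining its own for which a proportion at
  least \<open>2\<^sup>-\<^sup>(\<^sup>d\<^sup>+\<^sup>1\<^sup>)\<^sup>(\<^sup>k\<^sup>+\<^sup>1\<^sup>)\<close> of its children is rich. The mesh decreases so fast that, by Hoeffding's
  inequality, almost surely from some level on every noise value occurs on a fixed fraction of those
  children. Hence every target \<open>y\<close> close enough to the value at a rich cell can be approximated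
  along a subtree which loses only factors \<open>2\<^sup>O\<^sup>(\<^sup>k\<^sup>)\<close> at level \<open>k\<close>. These are negligible against the
  mesh, so a counting argument bounds the \<open>s\<close>-dimensional content of \<open>(f + g)\<^sup>-\<^sup>1(y)\<close> from below for
  each \<open>s < m\<close>. For almost every \<open>x\<close> the noise vanishes at \<open>x\<close> infinitely often, which places
  \<open>(f + g)(x)\<close> in the interior of such a set of targets.

  The lower bounds on contents do not depend on \<open>g\<close>, and for fixed \<open>y\<close> each of them is a closed
  condition on the map because fibres are compact; this yields a Borel set of good maps.
\<close>

section \<open>Independent uniform noise\<close>

text \<open>
  The bound 10 is chosen so that a tolerance of \<open>8 / 2 ^ k\<close> at level \<open>k\<close> propagates through the
  tree (a residue of at most 18 is brought down to 8) and still contains a neighbourhood of \<open>F x\<close>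
  when the noise vanishes at \<open>x\<close> on level \<open>k + 1\<close>: the later levels contribute at most \<open>5 / 2 ^ k\<close>,
  the colour \<open>1 / 2 ^ k\<close>, and the boxes in \<open>target_box\<close> need \<open>3 / 2 / 2 ^ k\<close>.
\<close>

definition noise_vals :: "(int ^ 'd::finite) set" where
  "noise_vals = {u. \<forall>i. u $ i \<in> {-10..10}}"

lemma finite_vec_bounded:
  assumes "\<And>i. finite (B i)"
  shows "finite {u :: 'a ^ 'd::finite. \<forall>i. u $ i \<in> B i}"
proof -
  have "{u :: 'a ^ 'd. \<forall>i. u $ i \<in> B i} \<subseteq> vec_lambda ` (PiE UNIV B)"
    by (auto simp: PiE_def Pi_def extensional_def image_iff intro!: exI[of _ "vec_nth _"])
  moreover have "finite (vec_lambda ` (PiE UNIV B))"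
    by (intro finite_imageI finite_PiE) (auto simp: assms)
  ultimately show ?thesis by (rule finite_subset)
qed

lemma card_vec_bounded:
  assumes "\<And>i. finite (B i)"
  shows "card {u :: 'a ^ 'd::finite. \<forall>i. u $ i \<in> B i} = (\<Prod>i\<in>UNIV. card (B i))"
proof -
  have "bij_betw vec_nth {u :: 'a ^ 'd. \<forall>i. u $ i \<in> B i} (PiE UNIV B)"
    by (rule bij_betwI[where g = vec_lambda]) (auto simp: PiE_def Pi_def extensional_def)
  then have "card {u :: 'a ^ 'd. \<forall>i. u $ i \<in> B i} = card (PiE UNIV B)"
    by (rule bij_betw_same_card)
  also have "\<dots> = (\<Prod>i\<in>UNIV. card (B i))"
    by (rule card_PiE) simp
  finally show ?thesis .
qed

lemma finite_noise_vals: "finite (noise_vals :: (int ^ 'd::finite) set)"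
  unfolding noise_vals_def by (rule finite_vec_bounded) simp

lemma zero_in_noise_vals: "0 \<in> noise_vals"
  by (simp add: noise_vals_def)

text \<open>The index type stays open here; later an index is a pair of a level and a cell.\<close>

definition noise :: "('k \<Rightarrow> int ^ 'd::finite) measure" where
  "noise = PiM UNIV (\<lambda>_. uniform_count_measure noise_vals)"

abbreviation noise_card :: "'d::finite itself \<Rightarrow> real" where
  "noise_card _ \<equiv> real (card (noise_vals :: (int ^ 'd) set))"

lemma noise_card_ge_1: "noise_card TYPE('d::finite) \<ge> 1"
proof -
  have "card (noise_vals :: (int ^ 'd) set) > 0"
    using finite_noise_vals zero_in_noise_vals by (metis card_gt_0_iff empty_iff)
  then show ?thesis by simp
qed

lemma prob_space_uniform_noise: "prob_space (uniform_count_measure (noise_vals :: (int ^ 'd::finite) set))"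
  by (rule prob_space_uniform_count_measure) (use finite_noise_vals zero_in_noise_vals in auto)

lemma prob_space_noise: "prob_space (noise :: ('k \<Rightarrow> int ^ 'd::finite) measure)"
  unfolding noise_def by (rule prob_space_PiM) (rule prob_space_uniform_noise)

lemma space_noise: "space noise = {\<omega>. \<forall>k. \<omega> k \<in> noise_vals}"
  by (auto simp: noise_def space_PiM PiE_def Pi_def space_uniform_count_measure)

lemma noise_in_vals: "\<omega> \<in> space noise \<Longrightarrow> \<omega> k \<in> noise_vals"
  by (simp add: space_noise)

lemma measurable_noise_component: "(\<lambda>\<omega>. \<omega> k) \<in> measurable noise (uniform_count_measure noise_vals)"
  unfolding noise_def by (rule measurable_component_singleton) simp

text \<open>On \<open>space noise\<close> only values in \<open>noise_vals\<close> occur, so a set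
  and its trace on \<open>noise_vals\<close> have the same preimage.\<close>

lemma measurable_noise_component_UNIV [measurable]:
  "(\<lambda>\<omega>. \<omega> k) \<in> measurable noise (count_space UNIV)"
  unfolding measurable_def
proof safe
  fix A :: "(int ^ 'd) set"
  have "(\<lambda>\<omega>. \<omega> k) -` A \<inter> space noise = (\<lambda>\<omega>. \<omega> k) -` (A \<inter> noise_vals) \<inter> space noise"
    by (auto simp: space_noise)
  also have "\<dots> \<in> sets noise"
    by (rule measurable_sets[OF measurable_noise_component]) (simp add: sets_uniform_count_measure)
  finally show "(\<lambda>\<omega>. \<omega> k) -` A \<inter> space noise \<in> sets noise" .
qed simp

lemma noise_distr: "distr noise (uniform_count_measure noise_vals) (\<lambda>\<omega>. \<omega> k) = uniform_count_measure (noise_vals :: (int ^ 'd::finite) set)"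
  unfolding noise_def by (subst distr_PiM_component[symmetric]) (simp_all add: prob_space_uniform_noise)

lemma noise_indep:
  "prob_space.indep_vars noise (\<lambda>_. uniform_count_measure (noise_vals :: (int ^ 'd::finite) set)) (\<lambda>k \<omega>. \<omega> k) UNIV"
proof -
  interpret prob_space "noise :: ('a \<Rightarrow> int ^ 'd) measure" by (rule prob_space_noise)
  have "distr (noise :: ('a \<Rightarrow> int ^ 'd) measure) (PiM UNIV (\<lambda>_. uniform_count_measure noise_vals)) (\<lambda>\<omega>. \<lambda>i\<in>UNIV. \<omega> i)
      = PiM UNIV (\<lambda>i. distr noise (uniform_count_measure noise_vals) (\<lambda>\<omega>. \<omega> i))"
    by (simp add: noise_distr flip: noise_def) (simp add: distr_id2[unfolded id_def] restrict_def)
  then show ?thesis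
    by (subst indep_vars_iff_distr_eq_PiM') (auto intro: measurable_noise_component)
qed

lemma prob_noise_eq:
  assumes "u \<in> noise_vals"
  shows "measure noise {\<omega> \<in> space noise. \<omega> k = (u :: int ^ 'd::finite)} = 1 / noise_card TYPE('d)"
proof -
  have "measure noise {\<omega> \<in> space noise. \<omega> k = u} = measure (distr noise (uniform_count_measure noise_vals) (\<lambda>\<omega>. \<omega> k)) {u}"
    by (subst measure_distr) (auto intro!: measurable_noise_component arg_cong[where f = "measure noise"]
        simp: sets_uniform_count_measure assms)
  also have "\<dots> = 1 / noise_card TYPE('d)"
    unfolding noise_distr by (subst measure_uniform_count_measure) (use finite_noise_vals assms in auto)
  finally show ?thesis .
qed

text \<open>Hoeffding's inequality for the indicators of \<open>\<omega> k = u\<close>, which are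
  independent with mean \<open>1 / q\<close>, where \<open>q\<close> is the number of noise values.
  Falling short of the mean \<open>n / q\<close> by half of it has exponent
  \<open>- 2 * (n / (2 * q)) ^ 2 / n\<close>.\<close>

lemma noise_count_bound:
  fixes u :: "int ^ 'd::finite" and S :: "'k set"
  assumes u: "u \<in> noise_vals" and S: "finite S"
  shows "measure noise {\<omega> \<in> space noise. real (card {k\<in>S. \<omega> k = u}) \<le> real (card S) / (2 * noise_card TYPE('d))}
    \<le> exp (- (real (card S) / (2 * (noise_card TYPE('d))\<^sup>2)))"
proof (cases "S = {}")
  case True
  interpret prob_space "noise :: ('k \<Rightarrow> int ^ 'd) measure" by (rule prob_space_noise)
  show ?thesis using True by simp
next
  case False
  interpret prob_space "noise :: ('k \<Rightarrow> int ^ 'd) measure" by (rule prob_space_noise)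
  define X where "X = (\<lambda>k \<omega>. indicator {u} ((\<omega> :: 'k \<Rightarrow> int ^ 'd) k) :: real)"
  have ind: "indep_vars (\<lambda>_. borel) X S"
    unfolding X_def
    by (rule indep_vars_compose2[OF indep_vars_subset[OF noise_indep]])
       (auto simp: measurable_def sets_uniform_count_measure space_uniform_count_measure)
  interpret Hoeffding_ineq noise S X "\<lambda>_. 0" "\<lambda>_. 1" "\<Sum>k\<in>S. expectation (X k)"
  proof unfold_locales
    show "AE \<omega> in noise. X k \<omega> \<in> {0..1}" for k
      by (rule AE_I2) (auto simp: X_def indicator_def)
  qed (rule S ind refl)+
  have ex: "expectation (X k) = 1 / noise_card TYPE('d)" for k
  proof -
    have "X k = indicator {\<omega>. \<omega> k = u}"
      by (auto simp: X_def indicator_def)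
    then have "expectation (X k) = measure noise ({\<omega>. \<omega> k = u} \<inter> space noise)"
      by simp
    also have "{\<omega>. \<omega> k = u} \<inter> space noise = {\<omega> \<in> space noise. \<omega> k = u}" by auto
    finally show ?thesis using prob_noise_eq[OF u] by simp
  qed
  have sm: "(\<Sum>k\<in>S. X k \<omega>) = real (card {k\<in>S. \<omega> k = u})" for \<omega>
    using S by (simp add: X_def indicator_def Int_def flip: sum.inter_filter)
  have ce: "real (card S) > 0" using S False by (simp add: card_gt_0_iff)
  define n where "n = real (card S)"
  define q where "q = noise_card TYPE('d)"
  have q: "q \<ge> 1" unfolding q_def by (rule noise_card_ge_1)
  have "prob {\<omega> \<in> space noise. (\<Sum>k\<in>S. X k \<omega>) \<le> (\<Sum>k\<in>S. expectation (X k)) - n / (2 * q)}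
      \<le> exp (- 2 * (n / (2 * q))\<^sup>2 / (\<Sum>k\<in>S. (1 - 0)\<^sup>2))"
    by (rule Hoeffding_ineq_le) (use ce q in \<open>auto simp: n_def\<close>)
  also have "- 2 * (n / (2 * q))\<^sup>2 / (\<Sum>k\<in>S. (1 - 0)\<^sup>2) = - (n / (2 * q\<^sup>2))"
    using ce q by (simp add: n_def[symmetric] power2_eq_square field_simps)
  also have "(\<Sum>k\<in>S. expectation (X k)) - n / (2 * q) = n / (2 * q)"
    using q by (simp add: ex n_def q_def field_simps)
  finally show ?thesis by (simp add: sm n_def q_def)
qed

text \<open>Such a function factors through a finite product of countable discrete spaces, on which
  every function is measurable.\<close>

lemma noise_finite_dependence:
  fixes H :: "('k \<Rightarrow> int ^ 'd::finite) \<Rightarrow> 'b"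
  assumes J: "finite J" and dep: "\<And>\<omega> \<omega>'. (\<And>k. k \<in> J \<Longrightarrow> \<omega> k = \<omega>' k) \<Longrightarrow> H \<omega> = H \<omega>'"
    and sp: "\<And>\<omega>. H \<omega> \<in> space N"
  shows "H \<in> measurable noise N"
proof -
  have "(\<lambda>\<omega>. restrict \<omega> J) \<in> measurable noise (PiM J (\<lambda>_. count_space UNIV))"
    by (rule measurable_restrict) simp
  also have "PiM J (\<lambda>_. count_space UNIV) = count_space (PiE J (\<lambda>_. UNIV :: (int ^ 'd) set))"
    by (rule count_space_PiM_finite[OF J]) simp
  finally have m: "(\<lambda>\<omega>. restrict \<omega> J) \<in> measurable noise (count_space (PiE J (\<lambda>_. UNIV :: (int ^ 'd) set)))" .
  have "(\<lambda>\<omega>. H (restrict \<omega> J)) \<in> measurable noise N"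
    by (rule measurable_compose[OF m]) (simp add: sp)
  moreover have "H (restrict \<omega> J) = H \<omega>" for \<omega>
    by (rule dep) simp
  ultimately show ?thesis by simp
qed

text \<open>Missing \<open>u\<close> on \<open>J\<close> consecutive indices means a count of 0,
  which has probability at most \<open>exp (- J / (2 * q ^ 2))\<close>. Injectivity of
  \<open>i\<close> makes these \<open>J\<close> different coordinates.\<close>

lemma AE_noise_hits:
  fixes u :: "int ^ 'd::finite" and i :: "nat \<Rightarrow> 'k"
  assumes u: "u \<in> noise_vals" and i: "inj i"
  shows "AE \<omega> in noise. \<forall>N. \<exists>n\<ge>N. \<omega> (i n) = u"
proof -
  interpret prob_space "noise :: ('k \<Rightarrow> int ^ 'd) measure" by (rule prob_space_noise)
  have "AE \<omega> in noise. \<exists>n\<ge>N. \<omega> (i n) = u" for N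
  proof -
    define Z where "Z = {\<omega> \<in> space noise. \<forall>n\<ge>N. \<omega> (i n) \<noteq> u}"
    have [measurable]: "Z \<in> sets noise" unfolding Z_def by measurable
    have "prob Z \<le> exp (- (real J / (2 * (noise_card TYPE('d))\<^sup>2)))" for J
    proof -
      let ?S = "i ` {N..<N+J}"
      have c: "card ?S = J" using i by (subst card_image) (auto intro: inj_on_subset)
      have "prob Z \<le> prob {\<omega> \<in> space noise. real (card {k\<in>?S. \<omega> k = u}) \<le> real (card ?S) / (2 * noise_card TYPE('d))}"
      proof (rule finite_measure_mono)
        show "Z \<subseteq> {\<omega> \<in> space noise. real (card {k\<in>?S. \<omega> k = u}) \<le> real (card ?S) / (2 * noise_card TYPE('d))}"
        proof
          fix \<omega> assume "\<omega> \<in> Z"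
          then have "{k\<in>?S. \<omega> k = u} = {}" "\<omega> \<in> space noise" by (auto simp: Z_def)
          then show "\<omega> \<in> {\<omega> \<in> space noise. real (card {k\<in>?S. \<omega> k = u}) \<le> real (card ?S) / (2 * noise_card TYPE('d))}"
            by (simp only: mem_Collect_eq card.empty) simp
        qed
        have "(\<lambda>\<omega>. real (card {k\<in>?S. \<omega> k = u})) \<in> borel_measurable noise"
          by (rule noise_finite_dependence[of ?S]) (auto intro!: arg_cong[where f = card])
        then show "{\<omega> \<in> space noise. real (card {k\<in>?S. \<omega> k = u}) \<le> real (card ?S) / (2 * noise_card TYPE('d))} \<in> sets noise"
          by measurable
      qed
      also have "\<dots> \<le> exp (- (real J / (2 * (noise_card TYPE('d))\<^sup>2)))"
        using noise_count_bound[OF u, of ?S] by (simp add: c)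
      finally show ?thesis .
    qed
    moreover have "(\<lambda>J. exp (- (real J / (2 * (noise_card TYPE('d))\<^sup>2)))) \<longlonglongrightarrow> 0"
      using noise_card_ge_1[where 'd='d]
      by real_asymp
    ultimately have "prob Z \<le> 0"
      by (intro LIMSEQ_le_const) auto
    then have "emeasure noise Z = 0" by (simp add: emeasure_eq_measure measure_le_0_iff)
    then show ?thesis by (intro AE_I[of _ _ Z]) (auto simp: Z_def)
  qed
  then show ?thesis by (simp add: AE_all_countable)
qed

section \<open>Grid cells and colours\<close>

text \<open>Doubly exponential growth makes every factor \<open>2 ^ O(k ^ 2)\<close> negligible
  against \<open>grid k powr \<epsilon>\<close>. A cell of level \<open>k\<close> is split into
  \<open>grid k\<close> parts along each axis.\<close>

definition grid :: "nat \<Rightarrow> nat" where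
  "grid k = 2 ^ (2 ^ k)"

lemma grid_Suc: "grid (Suc k) = grid k * grid k"
  by (simp add: grid_def power_add[symmetric] mult_2)

lemma grid_pos [simp]: "grid k > 0"
  by (simp add: grid_def)

definition cell :: "nat \<Rightarrow> real ^ 'm::finite \<Rightarrow> int ^ 'm" where
  "cell k x = (\<chi> j. \<lfloor>real (grid k) * x $ j\<rfloor>)"

definition cell_parent :: "nat \<Rightarrow> int ^ 'm::finite \<Rightarrow> int ^ 'm" where
  "cell_parent k v = (\<chi> j. v $ j div int (grid k))"

lemma cell_parent_cell [simp]: "cell_parent k (cell (Suc k) x) = cell k x"
proof -
  have "\<lfloor>real (grid (Suc k)) * t\<rfloor> div int (grid k) = \<lfloor>real (grid k) * t\<rfloor>" for t
    using floor_divide_real_eq_div[of "int (grid k)" "real (grid (Suc k)) * t"] grid_pos[of k]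
    by (simp add: grid_Suc del: grid_pos)
  then show ?thesis by (simp add: cell_parent_def cell_def)
qed

lemma div_eq_iff_atLeastLessThan:
  fixes a b n :: int
  assumes "n > 0"
  shows "a div n = b \<longleftrightarrow> a \<in> {b * n..<b * n + n}"
proof
  assume "a div n = b"
  then have "a = b * n + a mod n" by (metis div_mult_mod_eq)
  with pos_mod_sign[OF assms, of a] pos_mod_bound[OF assms, of a]
  show "a \<in> {b * n..<b * n + n}" by simp
next
  assume "a \<in> {b * n..<b * n + n}"
  then have "a = b * n + (a - b * n)" "0 \<le> a - b * n" "a - b * n < n" by auto
  then show "a div n = b"
    by (metis div_mult_self3 div_pos_pos_trivial add.commute add_0 assms less_irrefl)
qed

lemma cell_children:
  "{v'. cell_parent k v' = v} = {v'. \<forall>j. v' $ j \<in> {v $ j * int (grid k)..<v $ j * int (grid k) + int (grid k)}}"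
  by (simp add: cell_parent_def vec_eq_iff div_eq_iff_atLeastLessThan)

lemma finite_cell_children [simp]: "finite {v'. cell_parent k v' = v}"
  unfolding cell_children by (rule finite_vec_bounded) simp

lemma card_cell_children: "card {v' :: int ^ 'm::finite. cell_parent k v' = v} = grid k ^ CARD('m)"
  unfolding cell_children by (subst card_vec_bounded) simp_all

definition cells :: "nat \<Rightarrow> (int ^ 'm::finite) set" where
  "cells k = {v. \<forall>j. v $ j \<in> {0..<int (grid k)}}"

lemma finite_cells: "finite (cells k)"
  unfolding cells_def by (rule finite_vec_bounded) simp

lemma card_cells: "card (cells k :: (int ^ 'm::finite) set) = grid k ^ CARD('m)"
  unfolding cells_def by (subst card_vec_bounded) simp_all

lemma cell_in_cells:
  assumes "\<And>j. 0 \<le> x $ j \<and> x $ j < 1"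
  shows "cell k x \<in> cells k"
  using assms grid_pos[of k] by (auto simp: cells_def cell_def floor_less_iff mult_less_cancel_left2 simp del: grid_pos)

lemma measurable_cell [measurable]: "cell k \<in> measurable (borel :: (real ^ 'a::finite) measure) (count_space UNIV)"
proof (rule measurable_count_space_eq_countable[THEN iffD2])
  show "countable (UNIV :: (int ^ 'a) set)" by simp
  have eq: "cell k -` {v} \<inter> space borel = (\<Inter>j. {x \<in> space borel. \<lfloor>real (grid k) * x $ j\<rfloor> = v $ j})" for v :: "int ^ 'a"
    by (auto simp: cell_def vec_eq_iff)
  show "cell k \<in> space (borel :: (real ^ 'a) measure) \<rightarrow> UNIV \<and> (\<forall>v\<in>UNIV. cell k -` {v} \<inter> space borel \<in> sets (borel :: (real ^ 'a) measure))"
  proof (intro conjI ballI)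
    fix v :: "int ^ 'a"
    show "cell k -` {v} \<inter> space borel \<in> sets (borel :: (real ^ 'a) measure)"
      unfolding eq by measurable
  qed simp
qed

lemma cell_subset_cbox:
  "{x. cell k x = v} \<subseteq> cbox (\<chi> j. of_int (v $ j) / real (grid k)) (\<chi> j. (of_int (v $ j) + 1) / real (grid k))"
proof
  fix x assume "x \<in> {x. cell k x = v}"
  then have "\<lfloor>real (grid k) * x $ j\<rfloor> = v $ j" for j by (auto simp: cell_def vec_eq_iff)
  then have "of_int (v $ j) \<le> real (grid k) * x $ j" "real (grid k) * x $ j \<le> of_int (v $ j) + 1" for j
    by (metis of_int_floor_le, metis floor_correct less_imp_le of_int_1 of_int_add)
  then show "x \<in> cbox (\<chi> j. of_int (v $ j) / real (grid k)) (\<chi> j. (of_int (v $ j) + 1) / real (grid k))"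
    by (simp add: mem_box_cart field_simps)
qed

lemma measure_cell_le:
  fixes v :: "int ^ 'm::finite"
  assumes "A \<subseteq> {x. cell k x = v}"
  shows "emeasure lborel A \<le> ennreal (1 / real (grid k) ^ CARD('m))"
proof -
  let ?B = "cbox (\<chi> j. of_int (v $ j) / real (grid k)) (\<chi> j. (of_int (v $ j) + 1) / real (grid k)) :: (real ^ 'm) set"
  have "emeasure lborel A \<le> emeasure lborel ?B"
    using assms cell_subset_cbox[of k v] by (intro emeasure_mono) auto
  also have "measure lborel ?B = (\<Prod>j\<in>(UNIV :: 'm set). 1 / real (grid k))"
    by (subst content_cbox_cart) (auto simp: box_ne_empty divide_right_mono diff_divide_distrib[symmetric] interval_eq_empty_cart not_less)
  then have "emeasure lborel ?B = ennreal (1 / real (grid k) ^ CARD('m))"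
    by (subst emeasure_eq_ennreal_measure) (auto simp: power_divide less_top[symmetric] emeasure_lborel_cbox_eq)
  finally show ?thesis .
qed

section \<open>Dyadic colours of the values\<close>

definition colour :: "nat \<Rightarrow> real ^ 'd::finite \<Rightarrow> int ^ 'd" where
  "colour k z = (\<chi> i. \<lfloor>2 ^ k * z $ i\<rfloor>)"

definition colour_parent :: "int ^ 'd::finite \<Rightarrow> int ^ 'd" where
  "colour_parent c = (\<chi> i. c $ i div 2)"

lemma colour_parent_colour [simp]: "colour_parent (colour (Suc k) z) = colour k z"
proof -
  have "\<lfloor>2 ^ Suc k * t\<rfloor> div 2 = \<lfloor>2 ^ k * t\<rfloor>" for t :: real
    using floor_divide_real_eq_div[of 2 "2 ^ Suc k * t"] by simp
  then show ?thesis by (simp add: colour_parent_def colour_def)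
qed

lemma colour_children: "{c'. colour_parent c' = c} = {c'. \<forall>i. c' $ i \<in> {c $ i * 2..<c $ i * 2 + 2}}"
  by (simp add: colour_parent_def vec_eq_iff div_eq_iff_atLeastLessThan)

lemma card_colour_children: "card {c' :: int ^ 'd::finite. colour_parent c' = c} = 2 ^ CARD('d)"
  unfolding colour_children by (subst card_vec_bounded) simp_all

lemma finite_colour_children [simp]: "finite {c'. colour_parent c' = c}"
  unfolding colour_children by (rule finite_vec_bounded) simp

lemma measurable_colour [measurable]: "colour k \<in> measurable (borel :: (real ^ 'a::finite) measure) (count_space UNIV)"
proof (rule measurable_count_space_eq_countable[THEN iffD2])
  show "countable (UNIV :: (int ^ 'a) set)" by simp
  have eq: "colour k -` {v} \<inter> space borel = (\<Inter>j. {x \<in> space borel. \<lfloor>2 ^ k * x $ j\<rfloor> = v $ j})" for v :: "int ^ 'a"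
    by (auto simp: colour_def vec_eq_iff)
  show "colour k \<in> space (borel :: (real ^ 'a) measure) \<rightarrow> UNIV \<and> (\<forall>v\<in>UNIV. colour k -` {v} \<inter> space borel \<in> sets (borel :: (real ^ 'a) measure))"
  proof (intro conjI ballI)
    fix v :: "int ^ 'a"
    show "colour k -` {v} \<inter> space borel \<in> sets (borel :: (real ^ 'a) measure)"
      unfolding eq by measurable
  qed simp
qed

text \<open>In the application \<open>h\<close> is the given map plus the first levels of the field
  with their noise values frozen, and \<open>X\<close> is a set of points at which every later level
  is determined by the cell.\<close>

locale rich_cells =
  fixes h :: "real ^ 'm::finite \<Rightarrow> real ^ 'd::finite" and X :: "(real ^ 'm) set" and B :: nat
  assumes h_measurable [measurable]: "h \<in> borel_measurable borel"
    and X_borel [measurable]: "X \<in> sets borel"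
    and X_unit: "\<And>x j. x \<in> X \<Longrightarrow> 0 \<le> x $ j \<and> x $ j < 1"
    and h_bounded: "\<And>x i. x \<in> X \<Longrightarrow> \<bar>h x $ i\<bar> \<le> real B"
begin

definition piece :: "nat \<Rightarrow> int ^ 'm \<Rightarrow> int ^ 'd \<Rightarrow> (real ^ 'm) set" where
  "piece k v c = {x \<in> X. cell k x = v \<and> colour k (h x) = c}"

text \<open>A bounded range meets of the order of \<open>2 ^ (d * k)\<close> colours; the extra
  factor \<open>2 ^ k\<close> in the threshold makes the total measure of the poor pieces summable
  in \<open>k\<close>.\<close>

definition rich :: "nat \<Rightarrow> int ^ 'm \<Rightarrow> int ^ 'd \<Rightarrow> bool" where
  "rich k v c \<longleftrightarrow> measure lborel (piece k v c) \<ge> 1 / 2 ^ ((CARD('d) + 1) * k) / real (grid k) ^ CARD('m)"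

lemma piece_measurable [measurable]: "piece k v c \<in> sets borel"
proof -
  have "piece k v c = {x \<in> space borel. x \<in> X \<and> cell k x = v \<and> colour k (h x) = c}"
    by (auto simp: piece_def)
  also have "\<dots> \<in> sets borel" by measurable
  finally show ?thesis .
qed

lemma emeasure_piece_le: "emeasure lborel (piece k v c) \<le> ennreal (1 / real (grid k) ^ CARD('m))"
  by (rule measure_cell_le[of _ _ v]) (auto simp: piece_def)

lemma emeasure_piece_finite: "emeasure lborel (piece k v c) < \<infinity>"
  using emeasure_piece_le by (rule le_less_trans) simp

lemma piece_fmeasurable: "piece k v c \<in> fmeasurable lborel"
  using emeasure_piece_finite by (intro fmeasurableI) auto

lemma measure_piece_le: "measure lborel (piece k v c) \<le> 1 / real (grid k) ^ CARD('m)"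
  unfolding measure_def by (rule enn2real_leI[OF _ emeasure_piece_le]) simp

lemma rich_nonempty:
  assumes "rich k v c"
  obtains x where "x \<in> X" "cell k x = v" "colour k (h x) = c"
proof -
  have "0 < 1 / 2 ^ ((CARD('d) + 1) * k) / real (grid k) ^ CARD('m)" by simp
  then have "measure lborel (piece k v c) \<noteq> 0" using assms unfolding rich_def by linarith
  then have "piece k v c \<noteq> {}" by auto
  with that show ?thesis by (auto simp: piece_def)
qed

text \<open>Two pigeonholes, with \<open>\<delta> k\<close> the threshold proportion and
  \<open>n\<close> the number of children. Of the \<open>2 ^ d\<close> refining colours one keeps a
  proportion \<open>\<delta> k / 2 ^ d = 2 * \<delta> (Suc k)\<close> of the cell. Poor children
  account for at most \<open>\<delta> (Suc k)\<close> of it, so the rich ones fill the rest, each at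
  most a proportion \<open>1 / n\<close>.\<close>

lemma rich_branching:
  assumes "rich k v c"
  shows "\<exists>c'. colour_parent c' = c \<and>
    real (card {v'. cell_parent k v' = v \<and> rich (Suc k) v' c'}) \<ge> real (grid k) ^ CARD('m) / 2 ^ ((CARD('d) + 1) * Suc k)"
proof -
  define \<delta> where "\<delta> k = (1 :: real) / 2 ^ ((CARD('d) + 1) * k)" for k :: nat
  define P where "P c' = {x \<in> X. cell k x = v \<and> colour (Suc k) (h x) = c'}" for c'
  \<comment> \<open>Both the number of children and the inverse volume of a cell of level
    \<open>k\<close>; by \<open>grid_Suc\<close> a child has volume
    \<open>1 / n ^ 2\<close>.\<close>
  define n where "n = real (grid k) ^ CARD('m)"
  have n: "n > 0" by (simp add: n_def)
  have P_meas [measurable]: "P c' \<in> sets borel" for c'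
  proof -
    have "P c' = {x \<in> space borel. x \<in> X \<and> cell k x = v \<and> colour (Suc k) (h x) = c'}"
      by (auto simp: P_def)
    also have "\<dots> \<in> sets borel" by measurable
    finally show ?thesis .
  qed
  have P_fm: "P c' \<in> fmeasurable lborel" for c'
  proof (rule fmeasurableI)
    have "emeasure lborel (P c') \<le> ennreal (1 / real (grid k) ^ CARD('m))"
      by (rule measure_cell_le[of _ _ v]) (auto simp: P_def)
    then show "emeasure lborel (P c') < \<infinity>" by (rule le_less_trans) simp
  qed simp
  have "\<exists>c'. colour_parent c' = c \<and> measure lborel (P c') \<ge> \<delta> k / 2 ^ CARD('d) / n"
  proof (rule ccontr)
    assume *: "\<not> ?thesis"
    have "piece k v c = (\<Union>c'\<in>{c'. colour_parent c' = c}. P c')"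
      by (auto simp: piece_def P_def)
    then have "measure lborel (piece k v c) \<le> (\<Sum>c'\<in>{c'. colour_parent c' = c}. measure lborel (P c'))"
      using measure_UNION_le[of "{c'. colour_parent c' = c}" P lborel] by auto
    also have "\<dots> < (\<Sum>c'\<in>{c'. colour_parent c' = c}. \<delta> k / 2 ^ CARD('d) / n)"
    proof (rule sum_strict_mono)
      show "{c'. colour_parent c' = c} \<noteq> {}"
        using card_colour_children[of c] by (metis card.empty power_eq_0_iff zero_neq_numeral)
    qed (use * in \<open>auto simp: not_le\<close>)
    also have "\<dots> = \<delta> k / n"
      by (simp add: card_colour_children)
    finally show False using assms by (simp add: rich_def \<delta>_def n_def)
  qed
  then obtain c' where c': "colour_parent c' = c" "measure lborel (P c') \<ge> \<delta> k / 2 ^ CARD('d) / n" by auto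
  define C where "C = {v'. cell_parent k v' = v}"
  define R where "R = {v'. cell_parent k v' = v \<and> rich (Suc k) v' c'}"
  have C: "finite C" "real (card C) = n" by (simp_all add: C_def card_cell_children n_def)
  have R: "R \<subseteq> C" by (auto simp: R_def C_def)
  have "P c' = (\<Union>v'\<in>C. piece (Suc k) v' c')"
    by (auto simp: P_def C_def piece_def)
  then have "measure lborel (P c') \<le> (\<Sum>v'\<in>C. measure lborel (piece (Suc k) v' c'))"
    using measure_UNION_le[of C "\<lambda>v'. piece (Suc k) v' c'" lborel] C by auto
  also have "\<dots> = (\<Sum>v'\<in>R. measure lborel (piece (Suc k) v' c')) + (\<Sum>v'\<in>C - R. measure lborel (piece (Suc k) v' c'))"
    by (rule sum.subset_diff[OF R C(1), THEN trans]) simp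
  also have "\<dots> \<le> (\<Sum>v'\<in>R. 1 / n\<^sup>2) + (\<Sum>v'\<in>C. \<delta> (Suc k) / n\<^sup>2)"
  proof (rule add_mono)
    have n2: "real (grid (Suc k)) ^ CARD('m) = n\<^sup>2"
      by (simp add: n_def grid_Suc power_mult_distrib power2_eq_square)
    show "(\<Sum>v'\<in>R. measure lborel (piece (Suc k) v' c')) \<le> (\<Sum>v'\<in>R. 1 / n\<^sup>2)"
      by (rule sum_mono) (use measure_piece_le[of "Suc k"] n2 in auto)
    have "(\<Sum>v'\<in>C - R. measure lborel (piece (Suc k) v' c')) \<le> (\<Sum>v'\<in>C - R. \<delta> (Suc k) / n\<^sup>2)"
      by (rule sum_mono) (auto simp: R_def C_def rich_def n2 \<delta>_def not_le)
    also have "\<dots> \<le> (\<Sum>v'\<in>C. \<delta> (Suc k) / n\<^sup>2)"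
      by (rule sum_mono2) (use C in \<open>auto simp: \<delta>_def\<close>)
    finally show "(\<Sum>v'\<in>C - R. measure lborel (piece (Suc k) v' c')) \<le> (\<Sum>v'\<in>C. \<delta> (Suc k) / n\<^sup>2)" .
  qed
  also have "\<dots> = real (card R) / n\<^sup>2 + \<delta> (Suc k) / n"
    using n by (simp add: C power2_eq_square)
  finally have "\<delta> k / 2 ^ CARD('d) / n \<le> real (card R) / n\<^sup>2 + \<delta> (Suc k) / n"
    using c'(2) by linarith
  \<comment> \<open>One half of this is used up by the poor children.\<close>
  moreover have "\<delta> k / 2 ^ CARD('d) = 2 * \<delta> (Suc k)"
    by (simp add: \<delta>_def power_add power_Suc field_simps)
  ultimately have "\<delta> (Suc k) / n \<le> real (card R) / n\<^sup>2" by (simp add: field_simps)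
  then have "n * \<delta> (Suc k) \<le> real (card R)"
    using n by (simp add: field_simps power2_eq_square)
  then show ?thesis using c'(1) unfolding R_def n_def \<delta>_def by (auto intro!: exI[of _ c'])
qed

lemma cell_unit: "x \<in> X \<Longrightarrow> cell k x \<in> cells k"
  by (rule cell_in_cells[OF X_unit])

lemma colour_bounded:
  assumes "x \<in> X"
  shows "colour k (h x) $ i \<in> {-(2 ^ k * int B + 1)..2 ^ k * int B + 1}"
proof -
  have "2 ^ k * \<bar>h x $ i\<bar> \<le> 2 ^ k * real B"
    by (rule mult_left_mono[OF h_bounded[OF assms]]) simp
  then have "\<bar>2 ^ k * h x $ i\<bar> \<le> 2 ^ k * real B"
    by (simp only: abs_mult power_abs abs_numeral)
  then have "\<lfloor>2 ^ k * h x $ i\<rfloor> \<le> \<lfloor>2 ^ k * real B\<rfloor>" "\<lfloor>- (2 ^ k * real B)\<rfloor> \<le> \<lfloor>2 ^ k * h x $ i\<rfloor>"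
    by (intro floor_mono; linarith)+
  moreover have "\<lfloor>2 ^ k * real B\<rfloor> = 2 ^ k * int B" "\<lfloor>- (2 ^ k * real B)\<rfloor> = - (2 ^ k * int B)"
    by (rule floor_unique; simp)+
  ultimately show ?thesis by (simp add: colour_def)
qed

definition colours :: "nat \<Rightarrow> (int ^ 'd) set" where
  "colours k = {c. \<forall>i. c $ i \<in> {-(2 ^ k * int B + 1)..2 ^ k * int B + 1}}"

lemma finite_colours: "finite (colours k)" and card_colours: "card (colours k) = (2 ^ Suc k * B + 3) ^ CARD('d)"
proof -
  show "finite (colours k)" unfolding colours_def by (rule finite_vec_bounded) simp
  have "nat (2 * (2 ^ k * int B) + 3) = 2 * (2 ^ k * B) + 3"
    by (simp add: nat_add_distrib nat_mult_distrib nat_power_eq)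
  then show "card (colours k) = (2 ^ Suc k * B + 3) ^ CARD('d)"
    unfolding colours_def by (subst card_vec_bounded) (simp_all add: algebra_simps)
qed

text \<open>Borel-Cantelli: the poor pieces of level \<open>k\<close> are at most as many as pairs
  of a cell and a colour, and each is smaller than the threshold, so that together they measure at
  most a constant times \<open>2 ^ - k\<close>.\<close>

lemma AE_eventually_rich:
  "AE x in lborel. x \<in> X \<longrightarrow> (\<forall>\<^sub>F k in sequentially. rich k (cell k x) (colour k (h x)))"
proof -
  define R where "R k = (\<Union>(v, c)\<in>{(v, c). v \<in> cells k \<and> c \<in> colours k \<and> \<not> rich k v c}. piece k v c)" for k
  have fin: "finite {(v, c). v \<in> cells k \<and> c \<in> colours k \<and> \<not> rich k v c}" for k
    by (rule finite_subset[of _ "cells k \<times> colours k"]) (auto simp: finite_cells finite_colours)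
  have R_fm: "R k \<in> fmeasurable lborel" for k
    unfolding R_def by (intro fmeasurable.finite_UN fin) (auto intro: piece_fmeasurable)
  have R_sets: "R k \<in> sets lborel" for k using R_fm by (rule fmeasurableD)
  have le: "measure lborel (R k) \<le> (2 * real B + 3) ^ CARD('d) * (1 / 2) ^ k" for k
  proof -
    have "measure lborel (R k) \<le> (\<Sum>(v, c)\<in>{(v, c). v \<in> cells k \<and> c \<in> colours k \<and> \<not> rich k v c}. measure lborel (piece k v c))"
      unfolding R_def case_prod_unfold by (rule measure_UNION_le[OF fin[unfolded case_prod_unfold]]) simp
    also have "\<dots> \<le> (\<Sum>(v, c)\<in>{(v, c). v \<in> cells k \<and> c \<in> colours k \<and> \<not> rich k v c}. 1 / 2 ^ ((CARD('d) + 1) * k) / real (grid k) ^ CARD('m))"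
      by (rule sum_mono) (auto simp: rich_def)
    also have "\<dots> \<le> (\<Sum>(v, c)\<in>(cells k :: (int ^ 'm) set) \<times> colours k. 1 / 2 ^ ((CARD('d) + 1) * k) / real (grid k) ^ CARD('m))"
      by (rule sum_mono2) (auto simp: finite_cells finite_colours)
    also have "\<dots> = real (2 ^ Suc k * B + 3) ^ CARD('d) / 2 ^ ((CARD('d) + 1) * k)"
      by (simp add: card_cells card_colours card_cartesian_product)
    also have "\<dots> \<le> (2 ^ k * (2 * real B + 3)) ^ CARD('d) / 2 ^ ((CARD('d) + 1) * k)"
      by (intro divide_right_mono power_mono) (auto simp: algebra_simps)
    also have "\<dots> = (2 * real B + 3) ^ CARD('d) * (1 / 2) ^ k"
      by (simp add: power_mult_distrib power_add power_one_over power_mult[symmetric] mult.commute[of _ k])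
    finally show ?thesis .
  qed
  have "AE x in lborel. eventually (\<lambda>k. x \<in> space lborel - R k) sequentially"
  proof (rule borel_cantelli_AE1)
    show "R k \<in> sets lborel" for k by (rule R_sets)
    show "emeasure lborel (R k) < \<infinity>" for k using R_fm[of k] by (auto simp: fmeasurable_def)
    show "summable (\<lambda>k. measure lborel (R k))"
      by (rule summable_comparison_test'[where N = 0 and g = "\<lambda>k. (2 * real B + 3) ^ CARD('d) * (1 / 2) ^ k"])
         (auto intro!: summable_mult simp: le)
  qed
  then show ?thesis
  proof eventually_elim
    case (elim x)
    show ?case
    proof
      assume x: "x \<in> X"
      from elim show "\<forall>\<^sub>F k in sequentially. rich k (cell k x) (colour k (h x))"
      proof eventually_elim
        case (elim k)
        show ?case
        proof (rule ccontr)
          assume "\<not> ?case"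
          then have "x \<in> R k"
            using x cell_unit[OF x, of k] colour_bounded[OF x, of k]
            by (auto simp: R_def piece_def cells_def colours_def)
          with elim show False by simp
        qed
      qed
    qed
  qed
qed

end

text \<open>Half the expected number of rich children with a prescribed noise value, when as many
  are rich as \<open>rich_branching\<close> guarantees. It depends on \<open>k\<close> and the two
  dimensions only, which is why the content bounds will not depend on the map.\<close>

definition branching :: "'m::finite itself \<Rightarrow> 'd::finite itself \<Rightarrow> nat \<Rightarrow> nat" where
  "branching _ _ k = nat \<lceil>real (grid k) ^ CARD('m) / 2 ^ ((CARD('d) + 1) * Suc k) / (2 * noise_card TYPE('d))\<rceil>"

text \<open>Each term counts the triples of a cell, a colour and a noise value, times the
  probability from \<open>noise_count_bound\<close>. All factors except the number of cells
  \<open>n\<close> are \<open>2 ^ O(k)\<close>, while \<open>n\<close> is at least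
  \<open>2 ^ 2 ^ k\<close>.\<close>

lemma summable_failure_bound:
  fixes q :: real
  assumes m: "m > 0" and q: "q \<ge> 1"
  shows "summable (\<lambda>k. real (grid k) ^ m * real (2 ^ Suc (Suc k) * B + 3) ^ d * q *
    exp (- (real (grid k) ^ m / 2 ^ ((d + 1) * Suc k) / (2 * q\<^sup>2))))" (is "summable ?f")
proof -
  define C where "C = 2 * (4 * real B + 3) ^ d * q * (2 ^ (d + 1) * (2 * q\<^sup>2))\<^sup>2"
  have bound: "?f k \<le> C * (2 powr ((3 * real d + 2) * real k) / 2 ^ 2 ^ k)" for k
  proof -
    define n where "n = real (grid k) ^ m"
    define z where "z = 2 ^ ((d + 1) * Suc k) * (2 * q\<^sup>2)"
    have n: "n \<ge> 2 ^ 2 ^ k"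
      unfolding n_def grid_def using self_le_power[of "2 ^ 2 ^ k :: real" m] m by simp
    then have n0: "n > 0" by (rule less_le_trans[rotated]) simp
    have z: "z > 0" using q by (simp add: z_def)
    \<comment> \<open>The quadratic term suffices: one factor \<open>n\<close> cancels the number of
      cells and the other still gives decay.\<close>
    have "(n / z)\<^sup>2 / 2 \<le> exp (n / z)"
    proof -
      have "0 \<le> n / z" using n0 z by simp
      with exp_lower_Taylor_quadratic[OF this] show ?thesis by linarith
    qed
    then have "exp (- (n / z)) \<le> 2 / (n / z)\<^sup>2"
      using n0 z by (simp add: exp_minus field_simps)
    then have e: "n * exp (- (n / z)) \<le> 2 * z\<^sup>2 / n"
      using n0 z by (simp add: field_simps power2_eq_square)
    have "?f k = (n * exp (- (n / z))) * (real (2 ^ Suc (Suc k) * B + 3) ^ d * q)"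
      by (simp add: n_def z_def mult_ac)
    also have "\<dots> \<le> (2 * z\<^sup>2 / n) * ((2 ^ k * (4 * real B + 3)) ^ d * q)"
      using q z n0 by (intro mult_mono e power_mono) (auto simp: algebra_simps)
    also have "\<dots> \<le> (2 * z\<^sup>2 / 2 ^ 2 ^ k) * ((2 ^ k * (4 * real B + 3)) ^ d * q)"
      using q n n0 by (intro mult_right_mono divide_left_mono) auto
    also have "\<dots> = C * ((2 ^ k) ^ d * (2 ^ ((d + 1) * k))\<^sup>2 / 2 ^ 2 ^ k)"
      by (simp add: C_def z_def power_add power_mult_distrib mult_ac)
    also have "(2 ^ k) ^ d * (2 ^ ((d + 1) * k))\<^sup>2 = (2 :: real) ^ ((3 * d + 2) * k)"
      by (simp add: power_add[symmetric] power_mult[symmetric] algebra_simps)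
    also have "\<dots> = 2 powr ((3 * real d + 2) * real k)"
      by (subst powr_realpow[symmetric]) (simp_all add: algebra_simps)
    finally show ?thesis .
  qed
  have "summable (\<lambda>k. 2 powr ((3 * real d + 2) * real k) / 2 ^ 2 ^ k)"
  proof (rule summable_comparison_test_bigo[where g = "\<lambda>k. (1 / 2 :: real) ^ k"])
    show "(\<lambda>k. 2 powr ((3 * real d + 2) * real k) / 2 ^ 2 ^ k) \<in> O(\<lambda>k. (1 / 2 :: real) ^ k)"
      by real_asymp
  qed simp
  then have "summable (\<lambda>k. C * (2 powr ((3 * real d + 2) * real k) / 2 ^ 2 ^ k))"
    by (rule summable_mult)
  then show ?thesis
    by (rule summable_comparison_test'[where N = 0]) (use bound q in \<open>auto simp: abs_mult\<close>)
qed

section \<open>Levels on which the noise is well distributed among rich children\<close>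

context rich_cells
begin

definition rich_children :: "nat \<Rightarrow> int ^ 'm \<Rightarrow> int ^ 'd \<Rightarrow> (int ^ 'm) set" where
  "rich_children k v c' = {v'. cell_parent k v' = v \<and> rich (Suc k) v' c'}"

text \<open>The implication ranges over all pairs \<open>v\<close>, \<open>c'\<close>, but its premise forces \<open>c'\<close> to be one of the
  finitely many colours of bounded values, so that a union bound applies.\<close>

definition good_level :: "(nat \<times> (int ^ 'm) \<Rightarrow> int ^ 'd) \<Rightarrow> nat \<Rightarrow> bool" where
  "good_level \<omega> k \<longleftrightarrow> (\<forall>v c' u.
     real (card (rich_children k v c')) \<ge> real (grid k) ^ CARD('m) / 2 ^ ((CARD('d) + 1) * Suc k) \<longrightarrow>
     u \<in> noise_vals \<longrightarrow>
     branching TYPE('m) TYPE('d) k \<le> card {v' \<in> rich_children k v c'. \<omega> (Suc k, v') = u})"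

lemma finite_rich_children [simp]: "finite (rich_children k v c')"
  by (rule finite_subset[OF _ finite_cell_children[of k v]]) (auto simp: rich_children_def)

lemma rich_children_nonempty:
  assumes "v' \<in> rich_children k v c'"
  shows "v \<in> cells k" "c' \<in> colours (Suc k)"
proof -
  from assms obtain x where x: "x \<in> X" "cell (Suc k) x = v'" "colour (Suc k) (h x) = c'"
    unfolding rich_children_def by (auto elim: rich_nonempty)
  have "v = cell k x" using assms x(2) by (auto simp: rich_children_def)
  then show "v \<in> cells k" using cell_unit[OF x(1)] by (simp add: cells_def)
  show "c' \<in> colours (Suc k)" using colour_bounded[OF x(1), of "Suc k"] x(3) unfolding colours_def by blast
qed

text \<open>The sets of rich children are deterministic, so \<open>noise_count_bound\<close> applies
  to each of them. A union bound over the finitely many relevant triples and Borel-Cantelli over the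
  levels finish the argument.\<close>

lemma AE_eventually_good_level: "AE \<omega> in noise. \<forall>\<^sub>F k in sequentially. good_level \<omega> k"
proof -
  interpret prob_space "noise :: (nat \<times> (int ^ 'm) \<Rightarrow> int ^ 'd) measure" by (rule prob_space_noise)
  define q where "q = noise_card TYPE('d)"
  have q: "q \<ge> 1" unfolding q_def by (rule noise_card_ge_1)
  define n where "n k = real (grid k) ^ CARD('m) / 2 ^ ((CARD('d) + 1) * Suc k)" for k
  have n: "n k > 0" for k by (simp add: n_def)
  define I where "I k = {(v, c', u). v \<in> cells k \<and> c' \<in> colours (Suc k) \<and> (u :: int ^ 'd) \<in> noise_vals \<and> n k \<le> real (card (rich_children k v c'))}" for k
  \<comment> \<open>The failure event for one triple. \<open>Pair (Suc k)\<close> turns the children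
    into coordinates of the noise.\<close>
  define Ev where "Ev k = (\<lambda>(v, c', u :: int ^ 'd). {\<omega> \<in> space noise. real (card {i \<in> Pair (Suc k) ` rich_children k v c'. \<omega> i = u}) \<le>
      real (card (Pair (Suc k) ` rich_children k v c')) / (2 * q)})" for k
  have I_sub: "I k \<subseteq> (cells k :: (int ^ 'm) set) \<times> colours (Suc k) \<times> noise_vals" for k by (auto simp: I_def)
  have fin': "finite ((cells k :: (int ^ 'm) set) \<times> colours (Suc k) \<times> (noise_vals :: (int ^ 'd) set))" for k
    by (intro finite_cartesian_product finite_cells finite_colours finite_noise_vals)
  have fin: "finite (I k)" for k by (rule finite_subset[OF I_sub fin'])
  have Ev_sets [measurable]: "Ev k i \<in> sets noise" for k i
  proof -
    obtain v c' u where i: "i = (v, c', u)" by (cases i)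
    have "(\<lambda>\<omega>. real (card {i \<in> Pair (Suc k) ` rich_children k v c'. \<omega> i = u})) \<in> borel_measurable noise"
      by (rule noise_finite_dependence[of "Pair (Suc k) ` rich_children k v c'"]) (auto intro!: arg_cong[where f = card])
    then show ?thesis unfolding Ev_def i prod.case by measurable
  qed
  have "prob (\<Union>i\<in>I k. Ev k i) \<le> real (grid k) ^ CARD('m) * real (2 ^ Suc (Suc k) * B + 3) ^ CARD('d) * q *
      exp (- (real (grid k) ^ CARD('m) / 2 ^ ((CARD('d) + 1) * Suc k) / (2 * q\<^sup>2)))" for k
  proof -
    have "prob (\<Union>i\<in>I k. Ev k i) \<le> (\<Sum>i\<in>I k. prob (Ev k i))"
      by (rule measure_UNION_le[OF fin]) simp
    also have "\<dots> \<le> (\<Sum>i\<in>I k. exp (- (n k / (2 * q\<^sup>2))))"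
    proof (rule sum_mono)
      fix i assume i: "i \<in> I k"
      obtain v c' u where eq: "i = (v, c', u)" by (cases i)
      have c: "card (Pair (Suc k) ` rich_children k v c') = card (rich_children k v c')"
        by (rule card_image) (simp add: inj_on_def)
      have "prob (Ev k i) \<le> exp (- (real (card (rich_children k v c')) / (2 * q\<^sup>2)))"
        using noise_count_bound[of u "Pair (Suc k) ` rich_children k v c'"] i
        by (simp add: Ev_def eq q_def I_def c)
      also have "\<dots> \<le> exp (- (n k / (2 * q\<^sup>2)))"
        using i q by (simp add: eq I_def divide_right_mono)
      finally show "prob (Ev k i) \<le> exp (- (n k / (2 * q\<^sup>2)))" .
    qed
    also have "\<dots> \<le> (\<Sum>i\<in>(cells k :: (int ^ 'm) set) \<times> colours (Suc k) \<times> (noise_vals :: (int ^ 'd) set). exp (- (n k / (2 * q\<^sup>2))))"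
      by (rule sum_mono2[OF fin' I_sub]) simp
    also have "\<dots> = real (grid k) ^ CARD('m) * real (2 ^ Suc (Suc k) * B + 3) ^ CARD('d) * q * exp (- (n k / (2 * q\<^sup>2)))"
      by (simp add: card_cartesian_product card_cells card_colours q_def)
    finally show ?thesis by (simp add: n_def)
  qed
  moreover have "summable (\<lambda>k. real (grid k) ^ CARD('m) * real (2 ^ Suc (Suc k) * B + 3) ^ CARD('d) * q *
      exp (- (real (grid k) ^ CARD('m) / 2 ^ ((CARD('d) + 1) * Suc k) / (2 * q\<^sup>2))))"
    by (rule summable_failure_bound) (use q in auto)
  ultimately have "summable (\<lambda>k. prob (\<Union>i\<in>I k. Ev k i))"
    by (intro summable_comparison_test'[where N = 0 and f = "\<lambda>k. prob (\<Union>i\<in>I k. Ev k i)"]) auto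
  then have "AE \<omega> in noise. \<forall>\<^sub>F k in sequentially. \<omega> \<in> space noise - (\<Union>i\<in>I k. Ev k i)"
    by (intro borel_cantelli_AE1 sets.finite_UN fin) (auto simp: emeasure_eq_measure)
  then show ?thesis
  proof eventually_elim
    case (elim \<omega>)
    then show ?case
    proof eventually_elim
      case (elim k)
      show ?case unfolding good_level_def
      proof (intro allI impI)
        fix v c' u
        assume c: "real (card (rich_children k v c')) \<ge> real (grid k) ^ CARD('m) / 2 ^ ((CARD('d) + 1) * Suc k)"
          and u: "(u :: int ^ 'd) \<in> noise_vals"
        have c: "n k \<le> real (card (rich_children k v c'))" using c by (simp add: n_def)
        then have "rich_children k v c' \<noteq> {}" using n[of k] by auto
        then have "(v, c', u) \<in> I k" using u c rich_children_nonempty by (auto simp: I_def)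
        with elim have "\<omega> \<notin> Ev k (v, c', u)" "\<omega> \<in> space noise" by auto
        moreover have "card (Pair (Suc k) ` rich_children k v c') = card (rich_children k v c')"
          by (rule card_image) (simp add: inj_on_def)
        moreover have "card {i \<in> Pair (Suc k) ` rich_children k v c'. \<omega> i = u} = card {v' \<in> rich_children k v c'. \<omega> (Suc k, v') = u}"
          by (rule bij_betw_same_card[OF bij_betwI[where f = snd and g = "Pair (Suc k)"]]) auto
        ultimately have "real (card (rich_children k v c')) / (2 * q) < real (card {v' \<in> rich_children k v c'. \<omega> (Suc k, v') = u})"
          by (auto simp: Ev_def)
        moreover have "n k / (2 * q) \<le> real (card (rich_children k v c')) / (2 * q)"
          using c q by (intro divide_right_mono) auto
        ultimately have "n k / (2 * q) \<le> real (card {v' \<in> rich_children k v c'. \<omega> (Suc k, v') = u})" by linarith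
        then show "branching TYPE('m) TYPE('d) k \<le> card {v' \<in> rich_children k v c'. \<omega> (Suc k, v') = u}"
          unfolding branching_def n_def q_def by (simp add: ceiling_le_iff nat_le_iff)
      qed
    qed
  qed
qed

end

section \<open>Content of fibres that contain large trees\<close>

text \<open>A lower bound for Hausdorff content, without restriction on the radii. Finite covers are
  enough for compact sets, and open balls still cover when the set moves slightly.\<close>

definition ball_content_ge :: "real \<Rightarrow> real \<Rightarrow> 'a::metric_space set \<Rightarrow> bool" where
  "ball_content_ge s c E \<longleftrightarrow> (\<forall>C. finite C \<longrightarrow> (\<forall>(x, r)\<in>C. 0 < r) \<longrightarrow> E \<subseteq> (\<Union>(x, r)\<in>C. ball x r) \<longrightarrow>
     c \<le> (\<Sum>(x, r)\<in>C. r powr s))"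

text \<open>In each coordinate the floors range over at most \<open>2 * r * N + 2\<close> integers
  for \<open>N = grid k\<close>, hence over at most \<open>4 * r * N\<close>, because
  \<open>r * N\<close> is at least 1.\<close>

lemma card_cells_ball_le:
  fixes x :: "real ^ 'm::finite"
  assumes "r * real (grid k) \<ge> 1"
  shows "finite (cell k ` ball x r)" "real (card (cell k ` ball x r)) \<le> (4 * r * real (grid k)) ^ CARD('m)"
proof -
  define N where "N = real (grid k)"
  define J where "J j = {\<lfloor>N * (x $ j - r)\<rfloor>..\<lfloor>N * (x $ j + r)\<rfloor>}" for j
  have N: "N > 0" "r * N \<ge> 1" using assms by (simp_all add: N_def)
  have sub: "cell k ` ball x r \<subseteq> {v. \<forall>j. v $ j \<in> J j}"
  proof clarsimp
    fix y j assume "dist x y < r"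
    then have "\<bar>x $ j - y $ j\<bar> < r"
      using dist_vec_nth_le[of x j y] by (simp add: dist_real_def)
    then have "x $ j - r \<le> y $ j" "y $ j \<le> x $ j + r" by linarith+
    then show "cell k y $ j \<in> J j"
      using N by (auto simp: J_def cell_def N_def[symmetric] intro!: floor_mono mult_left_mono)
  qed
  have fin: "finite {v :: int ^ 'm. \<forall>j. v $ j \<in> J j}"
    by (rule finite_vec_bounded) (simp add: J_def)
  show "finite (cell k ` ball x r)" using sub fin by (rule finite_subset)
  have cJ: "real (card (J j)) \<le> 4 * r * N" for j
  proof -
    have "N * (x $ j - r) \<le> N * (x $ j + r)" using N assms
      by (intro mult_left_mono) (auto simp: N_def zero_less_mult_iff dest: less_le_trans[OF zero_less_one])
    then have "real (card (J j)) \<le> N * (x $ j + r) - N * (x $ j - r) + 2"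
      unfolding J_def by (simp only: card_atLeastAtMost_int) linarith
    also have "\<dots> = 2 * (r * N) + 2" by (simp add: algebra_simps)
    also have "\<dots> \<le> 4 * r * N" using N(2) by linarith
    finally show ?thesis .
  qed
  have "real (card (cell k ` ball x r)) \<le> real (card {v :: int ^ 'm. \<forall>j. v $ j \<in> J j})"
    using sub fin by (simp add: card_mono)
  also have "\<dots> = (\<Prod>j\<in>UNIV. real (card (J j)))"
    by (subst card_vec_bounded) (simp_all add: J_def)
  also have "\<dots> \<le> (\<Prod>j\<in>(UNIV :: 'm set). 4 * r * N)"
    by (rule prod_mono) (simp add: cJ)
  finally show "real (card (cell k ` ball x r)) \<le> (4 * r * real (grid k)) ^ CARD('m)"
    by (simp add: N_def)
qed

section \<open>A counting form of the mass distribution principle\<close>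

lemma grid_ge: "real (grid k) \<ge> real k"
proof -
  have "k < 2 ^ k" by (rule less_exp)
  also have "(2 :: nat) ^ k < 2 ^ 2 ^ k" by (rule power_strict_increasing) simp_all
  finally show ?thesis by (simp add: grid_def)
qed

text \<open>Spread unit mass evenly over each generation of a subtree with exactly
  \<open>b k\<close> children per node. A ball of radius \<open>r\<close> then carries at most
  \<open>M * r powr s\<close> of every late generation. By \<open>approx\<close>, a cover of
  \<open>E\<close> by balls is met by all cells of late generations, so these masses add up to at
  least 1.\<close>

lemma tree_content:
  fixes T :: "nat \<Rightarrow> (int ^ 'm::finite) set" and E :: "(real ^ 'm) set" and b :: "nat \<Rightarrow> nat"
  assumes root: "v0 \<in> T n"
    and step: "\<And>k v. n \<le> k \<Longrightarrow> v \<in> T k \<Longrightarrow>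
      \<exists>S\<subseteq>T (Suc k). finite S \<and> card S = b k \<and> (\<forall>v'\<in>S. cell_parent k v' = v)"
    and approx: "\<And>U. open U \<Longrightarrow> E \<subseteq> U \<Longrightarrow> \<exists>K. \<forall>k\<ge>K. \<forall>v\<in>T k. \<exists>x\<in>U. cell k x = v"
    and b: "\<And>k. b k > 0"
    and growth: "\<And>k. n \<le> k \<Longrightarrow> real (grid (Suc k)) ^ CARD('m) \<le> D * real (grid k) powr \<epsilon> * (\<Prod>i\<in>{n..k}. real (b i))"
    and \<epsilon>: "0 < \<epsilon>" "\<epsilon> < 1" and D: "D > 0"
  shows "ball_content_ge (real CARD('m) - \<epsilon>) (1 / (4 ^ CARD('m) * D + real (grid n) ^ CARD('m))) E"
proof -
  define s where "s = real CARD('m) - \<epsilon>"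
  define M where "M = 4 ^ CARD('m) * D + real (grid n) ^ CARD('m)"
  have "CARD('m) \<ge> 1" by (simp add: Suc_leI)
  then have s: "s > 0" using \<epsilon> unfolding s_def by linarith
  have M: "M > 0" using D by (simp add: M_def add_pos_pos)
  from step obtain ch where ch: "\<And>k v. n \<le> k \<Longrightarrow> v \<in> T k \<Longrightarrow>
      ch k v \<subseteq> T (Suc k) \<and> finite (ch k v) \<and> card (ch k v) = b k \<and> (\<forall>v'\<in>ch k v. cell_parent k v' = v)"
    by metis
  \<comment> \<open>The generations of the chosen subtree below \<open>v0\<close>; equal branching
    keeps the mass uniform.\<close>
  define lev where "lev = rec_nat {v0} (\<lambda>i V. \<Union>v\<in>V. ch (n + i) v)"
  have lev_0: "lev 0 = {v0}" and lev_Suc: "lev (Suc i) = (\<Union>v\<in>lev i. ch (n + i) v)" for i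
    by (simp_all add: lev_def)
  have lev: "lev i \<subseteq> T (n + i) \<and> finite (lev i) \<and> card (lev i) = (\<Prod>t<i. b (n + t))" for i
  proof (induction i)
    case 0
    then show ?case using root by (simp add: lev_0)
  next
    case (Suc i)
    have c: "ch (n + i) v \<subseteq> T (Suc (n + i))" "finite (ch (n + i) v)" "card (ch (n + i) v) = b (n + i)"
      "\<forall>v'\<in>ch (n + i) v. cell_parent (n + i) v' = v" if "v \<in> lev i" for v
      using ch[of "n + i" v] Suc that by auto
    have "card (lev (Suc i)) = (\<Sum>v\<in>lev i. card (ch (n + i) v))"
      unfolding lev_Suc
    proof (rule card_UN_disjoint)
      show "\<forall>v\<in>lev i. \<forall>w\<in>lev i. v \<noteq> w \<longrightarrow> ch (n + i) v \<inter> ch (n + i) w = {}"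
      proof (intro ballI impI equals0I)
        fix v w u assume v: "v \<in> lev i" and w: "w \<in> lev i" and "v \<noteq> w" and u: "u \<in> ch (n + i) v \<inter> ch (n + i) w"
        have "cell_parent (n + i) u = v" "cell_parent (n + i) u = w"
          using c(4)[OF v] c(4)[OF w] u by blast+
        then show False using \<open>v \<noteq> w\<close> by simp
      qed
      show "finite (lev i)" using Suc by simp
      show "\<forall>v\<in>lev i. finite (ch (n + i) v)" using c(2) by simp
    qed
    also have "\<dots> = (\<Prod>t<Suc i. b (n + t))"
      using Suc by (simp add: c(3))
    finally have "card (lev (Suc i)) = (\<Prod>t<Suc i. b (n + t))" .
    moreover have "lev (Suc i) \<subseteq> T (n + Suc i)" using c(1) by (auto simp: lev_Suc)
    moreover have "finite (lev (Suc i))" unfolding lev_Suc using c(2) Suc by simp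
    ultimately show ?case by simp
  qed
  \<comment> \<open>A cell met by \<open>U\<close> has all its ancestors met by \<open>U\<close>, so
    generation \<open>i\<close> is controlled by the cells of generation \<open>j\<close> that
    \<open>U\<close> meets.\<close>
  have desc: "card {v \<in> lev i. \<exists>x\<in>U. cell (n + i) x = v} \<le> card (cell (n + j) ` U) * (\<Prod>t\<in>{j..<i}. b (n + t))"
    if "j \<le> i" "finite (cell (n + j) ` U)" for i j and U :: "(real ^ 'm) set"
    using that(1)
  proof (induction i rule: dec_induct)
    case base
    show ?case by (simp, rule card_mono) (use that(2) in auto)
  next
    case (step i)
    let ?A = "{v \<in> lev i. \<exists>x\<in>U. cell (n + i) x = v}"
    have c: "ch (n + i) v \<subseteq> T (Suc (n + i))" "finite (ch (n + i) v)" "card (ch (n + i) v) = b (n + i)"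
      "\<forall>v'\<in>ch (n + i) v. cell_parent (n + i) v' = v" if "v \<in> lev i" for v
      using ch[of "n + i" v] lev[of i] that by auto
    have "{v \<in> lev (Suc i). \<exists>x\<in>U. cell (n + Suc i) x = v} \<subseteq> (\<Union>v\<in>?A. ch (n + i) v)"
    proof clarsimp
      fix x assume x: "cell (Suc (n + i)) x \<in> lev (Suc i)" "x \<in> U"
      then obtain v where v: "v \<in> lev i" "cell (Suc (n + i)) x \<in> ch (n + i) v" by (auto simp: lev_Suc)
      then have "v = cell (n + i) x" using c(4)[OF v(1)] by force
      then show "\<exists>v. v \<in> lev i \<and> (\<exists>x\<in>U. cell (n + i) x = v) \<and> cell (Suc (n + i)) x \<in> ch (n + i) v"
        using v x by blast
    qed
    then have "card {v \<in> lev (Suc i). \<exists>x\<in>U. cell (n + Suc i) x = v} \<le> card (\<Union>v\<in>?A. ch (n + i) v)"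
      by (rule card_mono[rotated]) (use lev[of i] c(2) in auto)
    also have "\<dots> \<le> (\<Sum>v\<in>?A. card (ch (n + i) v))"
      by (rule card_UN_le) (use lev[of i] in auto)
    also have "\<dots> = card ?A * b (n + i)"
      by (simp add: c(3))
    also have "\<dots> \<le> card (cell (n + j) ` U) * (\<Prod>t\<in>{j..<i}. b (n + t)) * b (n + i)"
      by (rule mult_right_mono[OF step.IH]) simp
    also have "\<dots> = card (cell (n + j) ` U) * (\<Prod>t\<in>{j..<Suc i}. b (n + t))"
      using step.hyps by (simp add: mult_ac)
    finally show ?case .
  qed
  have one_ball: "\<exists>i0. \<forall>i\<ge>i0. real (card {v \<in> lev i. \<exists>y\<in>ball x r. cell (n + i) y = v}) \<le> M * r powr s * real (card (lev i))"
    if r: "r > 0" for r and x :: "real ^ 'm"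
  proof (cases "r * real (grid n) \<ge> 1")
    \<comment> \<open>A ball at least as large as the mesh of level \<open>n\<close>: the summand
      \<open>grid n ^ m\<close> of \<open>M\<close> makes \<open>M * r powr s\<close> at least
      1.\<close>
    case True
    have "1 \<le> (r * real (grid n)) powr s" using True s by (intro ge_one_powr_ge_zero) auto
    also have "\<dots> = r powr s * real (grid n) powr s" using r by (simp add: powr_mult)
    also have "\<dots> \<le> r powr s * real (grid n) ^ CARD('m)"
    proof (rule mult_left_mono)
      have "real (grid n) powr s \<le> real (grid n) powr real CARD('m)"
        using \<epsilon> grid_pos[of n] by (intro powr_mono) (auto simp: s_def simp del: grid_pos)
      then show "real (grid n) powr s \<le> real (grid n) ^ CARD('m)" by (simp add: powr_realpow)
    qed simp
    also have "\<dots> \<le> M * r powr s" using D by (simp add: M_def algebra_simps)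
    finally have 1: "1 \<le> M * r powr s" .
    have "real (card {v \<in> lev i. \<exists>y\<in>ball x r. cell (n + i) y = v}) \<le> real (card (lev i))" for i
      by (intro of_nat_mono card_mono) (use lev[of i] in auto)
    also have "real (card (lev i)) \<le> M * r powr s * real (card (lev i))" for i
      using mult_right_mono[OF 1, of "real (card (lev i))"] by simp
    finally show ?thesis by blast
  next
    case False
    obtain K :: nat where "1 / r \<le> real K" using real_arch_simple by blast
    then have "r * real (grid K) \<ge> 1"
      using grid_ge[of K] r by (auto simp: field_simps intro: order_trans)
    then have ex: "\<exists>k. r * real (grid k) \<ge> 1" by blast
    \<comment> \<open>The first level whose mesh is at most \<open>r\<close>: fine enough for
      \<open>card_cells_ball_le\<close>, while the mesh of level \<open>k - 1\<close> still exceeds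
      \<open>r\<close>.\<close>
    define k where "k = (LEAST k. r * real (grid k) \<ge> 1)"
    have k: "r * real (grid k) \<ge> 1" unfolding k_def using ex by (rule LeastI_ex)
    have grid_mono: "grid a \<le> grid c" if "a \<le> c" for a c
      using that by (simp add: grid_def)
    have "k > n"
    proof (rule ccontr)
      assume "\<not> n < k"
      then have "r * real (grid k) \<le> r * real (grid n)" using r grid_mono by auto
      with k False show False by linarith
    qed
    then obtain k' where k': "k = Suc k'" "n \<le> k'" by (metis less_Suc_eq_le not0_implies_Suc not_less0)
    have small: "r * real (grid k') < 1"
      using not_less_Least[of k' "\<lambda>k. r * real (grid k) \<ge> 1"] k' by (simp add: k_def[symmetric] not_le)
    define j where "j = k - n"
    have nj: "n + j = k" using \<open>k > n\<close> by (simp add: j_def)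
    note cb = card_cells_ball_le[OF k, of x]
    define P where "P = (\<Prod>t<j. real (b (n + t)))"
    have P: "P > 0" using b by (auto simp: P_def intro: prod_pos)
    have "P = (\<Prod>i\<in>{n..k'}. real (b i))"
      unfolding P_def by (rule prod.reindex_bij_witness[of _ "\<lambda>i. i - n" "\<lambda>t. n + t"]) (use nj k' in auto)
    with growth[OF k'(2)] have g: "real (grid k) ^ CARD('m) \<le> D * real (grid k') powr \<epsilon> * P"
      by (simp add: k')
    have "real (card (cell k ` ball x r)) \<le> 4 ^ CARD('m) * r ^ CARD('m) * real (grid k) ^ CARD('m)"
      using cb(2) by (simp add: power_mult_distrib)
    also have "\<dots> \<le> 4 ^ CARD('m) * r ^ CARD('m) * (D * real (grid k') powr \<epsilon> * P)"
      using r by (intro mult_left_mono g) auto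
    \<comment> \<open>The surplus \<open>r powr \<epsilon>\<close> absorbs the loss
      \<open>grid k' powr \<epsilon>\<close> from \<open>growth\<close>, because
      \<open>r * grid k' < 1\<close>.\<close>
    also have "r ^ CARD('m) = r powr s * r powr \<epsilon>"
      using r by (simp add: powr_add[symmetric] s_def powr_realpow)
    also have "4 ^ CARD('m) * (r powr s * r powr \<epsilon>) * (D * real (grid k') powr \<epsilon> * P)
        = 4 ^ CARD('m) * D * r powr s * P * (r * real (grid k')) powr \<epsilon>"
      using r by (simp add: powr_mult mult_ac)
    also have "\<dots> \<le> 4 ^ CARD('m) * D * r powr s * P * 1"
      using D P small r \<epsilon> by (intro mult_left_mono powr_le1) auto
    also have "\<dots> \<le> M * r powr s * P"
      using P by (simp add: M_def algebra_simps)
    finally have cells_le: "real (card (cell (n + j) ` ball x r)) \<le> M * r powr s * P" by (simp add: nj)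
    show ?thesis
    proof (intro exI allI impI)
      fix i assume i: "j \<le> i"
      have "real (card {v \<in> lev i. \<exists>y\<in>ball x r. cell (n + i) y = v})
          \<le> real (card (cell (n + j) ` ball x r) * (\<Prod>t\<in>{j..<i}. b (n + t)))"
        using desc[OF i] cb(1) by (simp add: nj del: of_nat_mult)
      also have "\<dots> \<le> M * r powr s * P * (\<Prod>t\<in>{j..<i}. real (b (n + t)))"
        using mult_right_mono[OF cells_le, of "\<Prod>t\<in>{j..<i}. real (b (n + t))"] by (simp add: prod_nonneg)
      also have "P * (\<Prod>t\<in>{j..<i}. real (b (n + t))) = real (card (lev i))"
        using lev[of i] i unfolding P_def
        by (simp add: prod.union_disjoint[symmetric] ivl_disj_un ivl_disj_int lessThan_atLeast0 prod.atLeastLessThan_concat)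
      then have "M * r powr s * P * (\<Prod>t\<in>{j..<i}. real (b (n + t))) = M * r powr s * real (card (lev i))"
        by (simp add: mult.assoc)
      finally show "real (card {v \<in> lev i. \<exists>y\<in>ball x r. cell (n + i) y = v}) \<le> M * r powr s * real (card (lev i))" .
    qed
  qed
  show ?thesis
    unfolding ball_content_ge_def s_def[symmetric] M_def[symmetric]
  proof (intro allI impI)
    fix C :: "((real ^ 'm) \<times> real) set"
    assume C: "finite C" "\<forall>(x, r)\<in>C. 0 < r" "E \<subseteq> (\<Union>(x, r)\<in>C. ball x r)"
    obtain K where K: "\<And>k v. k \<ge> K \<Longrightarrow> v \<in> T k \<Longrightarrow> \<exists>x\<in>(\<Union>(x, r)\<in>C. ball x r). cell k x = v"
      using approx[OF _ C(3)] by (metis (no_types, lifting) case_prod_unfold open_UN open_ball)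
    have "\<forall>p\<in>C. \<exists>i0. \<forall>i\<ge>i0. real (card {v \<in> lev i. \<exists>y\<in>ball (fst p) (snd p). cell (n + i) y = v}) \<le> M * snd p powr s * real (card (lev i))"
      using C(2) one_ball by (auto simp: case_prod_unfold)
    from bchoice[OF this] obtain i0 where i0: "\<forall>p\<in>C. \<forall>i\<ge>i0 p.
        real (card {v \<in> lev i. \<exists>y\<in>ball (fst p) (snd p). cell (n + i) y = v}) \<le> M * snd p powr s * real (card (lev i))" ..
    \<comment> \<open>The sum lies above every threshold at once.\<close>
    define i where "i = K + (\<Sum>p\<in>C. i0 p)"
    have i_ge: "i \<ge> i0 p" if "p \<in> C" for p
      using member_le_sum[OF that, of i0] C(1) by (simp add: i_def)
    have "lev i \<subseteq> (\<Union>p\<in>C. {v \<in> lev i. \<exists>y\<in>ball (fst p) (snd p). cell (n + i) y = v})"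
    proof
      fix v assume v: "v \<in> lev i"
      then have "v \<in> T (n + i)" using lev[of i] by auto
      then obtain x where "x \<in> (\<Union>(x, r)\<in>C. ball x r)" "cell (n + i) x = v"
        using K[of "n + i" v] by (auto simp: i_def)
      then show "v \<in> (\<Union>p\<in>C. {v \<in> lev i. \<exists>y\<in>ball (fst p) (snd p). cell (n + i) y = v})"
        using v by (fastforce simp: case_prod_unfold)
    qed
    then have "card (lev i) \<le> card (\<Union>p\<in>C. {v \<in> lev i. \<exists>y\<in>ball (fst p) (snd p). cell (n + i) y = v})"
      by (rule card_mono[rotated]) (use C(1) lev[of i] in auto)
    also have "\<dots> \<le> (\<Sum>p\<in>C. card {v \<in> lev i. \<exists>y\<in>ball (fst p) (snd p). cell (n + i) y = v})"
      by (rule card_UN_le[OF C(1)])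
    finally have "real (card (lev i)) \<le> (\<Sum>p\<in>C. real (card {v \<in> lev i. \<exists>y\<in>ball (fst p) (snd p). cell (n + i) y = v}))"
      by (simp flip: of_nat_sum)
    also have "\<dots> \<le> (\<Sum>p\<in>C. M * snd p powr s * real (card (lev i)))"
      by (rule sum_mono) (use i0 i_ge in blast)
    also have "\<dots> = M * (\<Sum>(x, r)\<in>C. r powr s) * real (card (lev i))"
      by (simp add: sum_distrib_left sum_distrib_right case_prod_unfold)
    finally have "1 \<le> M * (\<Sum>(x, r)\<in>C. r powr s)"
      using lev[of i] b by (simp add: prod_pos)
    then show "1 / M \<le> (\<Sum>(x, r)\<in>C. r powr s)" using M by (simp add: field_simps)
  qed
qed

section \<open>Growth of the branching numbers\<close>

lemma branching_pos: "branching TYPE('m::finite) TYPE('d::finite) k > 0"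
proof -
  have "0 < real (grid k) ^ CARD('m) / 2 ^ ((CARD('d) + 1) * Suc k) / (2 * noise_card TYPE('d))"
    using noise_card_ge_1[where 'd='d] by simp
  then show ?thesis unfolding branching_def by linarith
qed

text \<open>\<open>grid (Suc k)\<close> is \<open>grid n\<close> times the product of the
  \<open>grid i\<close> for \<open>i\<close> from \<open>n\<close> to \<open>k\<close>. Each
  \<open>grid i ^ m\<close> is at most \<open>u i\<close> times the branching number, and the
  product of the factors \<open>u i = 2 ^ O(i)\<close> is \<open>2 ^ O(k ^ 2)\<close>.\<close>

lemma branching_growth:
  assumes \<epsilon>: "\<epsilon> > 0"
  shows "\<exists>D>0. \<forall>k\<ge>n. real (grid (Suc k)) ^ CARD('m::finite) \<le>
    D * real (grid k) powr \<epsilon> * (\<Prod>i\<in>{n..k}. real (branching TYPE('m) TYPE('d::finite) i))"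
proof -
  define q where "q = noise_card TYPE('d)"
  have q: "q \<ge> 1" unfolding q_def by (rule noise_card_ge_1)
  define a where "a = 2 * q * 2 ^ (CARD('d) + 1)"
  define u where "u k = 2 ^ ((CARD('d) + 1) * Suc k) * (2 * q)" for k :: nat
  have u: "u k \<ge> 1" for k
  proof -
    have "1 * 1 \<le> u k" unfolding u_def using q by (intro mult_mono one_le_power) simp_all
    then show ?thesis by simp
  qed
  have u_mono: "u i \<le> u k" if "i \<le> k" for i k
    unfolding u_def using q that by (intro mult_right_mono power_increasing) (auto simp: add_mult_distrib intro!: mult_le_mono add_mono)
  \<comment> \<open>A crude bound in which one constant \<open>a\<close> serves as prefactor and as
    exponent.\<close>
  have "(\<lambda>k::nat. (a * 2 powr (a * real k)) ^ (k + 1) / (2 ^ 2 ^ k) powr \<epsilon>) \<longlonglongrightarrow> 0"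
    using \<epsilon> q by (simp only: a_def) real_asymp
  then have "Bseq (\<lambda>k::nat. (a * 2 powr (a * real k)) ^ (k + 1) / (2 ^ 2 ^ k) powr \<epsilon>)"
    by (intro convergent_imp_Bseq convergentI)
  then obtain D0 where D0: "\<And>k. \<bar>(a * 2 powr (a * real k)) ^ (k + 1) / (2 ^ 2 ^ k) powr \<epsilon>\<bar> \<le> D0"
    by (auto simp only: Bseq_def real_norm_def)
  have u_a: "u k \<le> a * 2 powr (a * real k)" for k
  proof -
    have d: "real CARD('d) + 1 \<le> a"
    proof -
      have "CARD('d) + 1 < 2 ^ (CARD('d) + 1)" by (rule less_exp)
      then have "real (CARD('d) + 1) \<le> real (2 ^ (CARD('d) + 1))" by linarith
      also have "\<dots> \<le> 2 * q * 2 ^ (CARD('d) + 1)" using q by simp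
      finally show ?thesis by (simp add: a_def)
    qed
    have "u k = a * 2 ^ ((CARD('d) + 1) * k)" by (simp add: u_def a_def power_add algebra_simps)
    also have "(2 :: real) ^ ((CARD('d) + 1) * k) = 2 powr ((real CARD('d) + 1) * real k)"
      by (subst powr_realpow[symmetric]) (simp_all add: algebra_simps)
    also have "a * \<dots> \<le> a * 2 powr (a * real k)"
      using d q by (intro mult_left_mono powr_mono mult_right_mono) (auto simp: a_def)
    finally show ?thesis .
  qed
  have key: "real (grid (Suc k)) ^ CARD('m) \<le>
      real (grid n) ^ CARD('m) * (\<Prod>i\<in>{n..k}. u i) * (\<Prod>i\<in>{n..k}. real (branching TYPE('m) TYPE('d) i))" if "n \<le> k" for k
    using that
  proof (induction k rule: dec_induct)
    case base
    have "real (grid n) ^ CARD('m) / u n \<le> real (branching TYPE('m) TYPE('d) n)"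
      unfolding branching_def u_def q_def by (simp only: divide_divide_eq_left) linarith
    then have "real (grid n) ^ CARD('m) \<le> u n * real (branching TYPE('m) TYPE('d) n)"
      using u[of n] by (simp add: field_simps)
    from mult_left_mono[OF this, of "real (grid n) ^ CARD('m)"] show ?case
      by (simp add: grid_Suc power_mult_distrib mult_ac)
  next
    case (step k)
    have "real (grid (Suc k)) ^ CARD('m) / u (Suc k) \<le> real (branching TYPE('m) TYPE('d) (Suc k))"
      unfolding branching_def u_def q_def by (simp only: divide_divide_eq_left) linarith
    then have "real (grid (Suc k)) ^ CARD('m) \<le> u (Suc k) * real (branching TYPE('m) TYPE('d) (Suc k))"
      using u[of "Suc k"] by (simp add: field_simps)
    with step.IH have "real (grid (Suc k)) ^ CARD('m) * real (grid (Suc k)) ^ CARD('m) \<le>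
      (real (grid n) ^ CARD('m) * (\<Prod>i\<in>{n..k}. u i) * (\<Prod>i\<in>{n..k}. real (branching TYPE('m) TYPE('d) i))) *
      (u (Suc k) * real (branching TYPE('m) TYPE('d) (Suc k)))"
      by (intro mult_mono) (auto intro!: mult_nonneg_nonneg prod_nonneg order_trans[OF _ u])
    then show ?case
      using step.hyps by (simp add: grid_Suc[of "Suc k"] power_mult_distrib atLeastAtMostSuc_conv mult_ac)
  qed
  define D where "D = real (grid n) ^ CARD('m) * (\<bar>D0\<bar> + 1)"
  show ?thesis
  proof (intro exI[of _ D] conjI allI impI)
    show "D > 0" by (simp add: D_def)
    fix k assume k: "n \<le> k"
    have "(\<Prod>i\<in>{n..k}. u i) \<le> (\<Prod>i\<in>{n..k}. a * 2 powr (a * real k))"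
    proof (rule prod_mono)
      fix i assume "i \<in> {n..k}"
      then have "u i \<le> u k" by (intro u_mono) simp
      with u_a[of k] u[of i] show "0 \<le> u i \<and> u i \<le> a * 2 powr (a * real k)" by linarith
    qed
    also have "\<dots> = (a * 2 powr (a * real k)) ^ (Suc k - n)" by simp
    also have "\<dots> \<le> (a * 2 powr (a * real k)) ^ (k + 1)"
      using order_trans[OF u u_a] by (intro power_increasing) auto
    also have "\<dots> \<le> D0 * real (grid k) powr \<epsilon>"
    proof -
      have "(a * 2 powr (a * real k)) ^ (k + 1) / real (grid k) powr \<epsilon> \<le> D0"
        using abs_le_D1[OF D0[of k]] by (simp add: grid_def)
      moreover have "real (grid k) powr \<epsilon> > 0" by simp
      ultimately show ?thesis by (simp only: pos_divide_le_eq)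
    qed
    also have "\<dots> \<le> (\<bar>D0\<bar> + 1) * real (grid k) powr \<epsilon>"
      by (intro mult_right_mono) auto
    finally have pu: "(\<Prod>i\<in>{n..k}. u i) \<le> (\<bar>D0\<bar> + 1) * real (grid k) powr \<epsilon>" .
    have "real (grid n) ^ CARD('m) * (\<Prod>i\<in>{n..k}. u i) * (\<Prod>i\<in>{n..k}. real (branching TYPE('m) TYPE('d) i))
        \<le> real (grid n) ^ CARD('m) * ((\<bar>D0\<bar> + 1) * real (grid k) powr \<epsilon>) * (\<Prod>i\<in>{n..k}. real (branching TYPE('m) TYPE('d) i))"
      by (intro mult_right_mono mult_left_mono pu prod_nonneg) auto
    from order_trans[OF key[OF k] this] show "real (grid (Suc k)) ^ CARD('m) \<le>
      D * real (grid k) powr \<epsilon> * (\<Prod>i\<in>{n..k}. real (branching TYPE('m) TYPE('d) i))"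
      by (simp only: D_def mult.assoc)
  qed
qed

text \<open>Says that \<open>c\<close> works for all trees and sets at once. This uniformity lets
  the constants be fixed before any map or noise is given.\<close>

definition tree_constant :: "'m::finite itself \<Rightarrow> 'd::finite itself \<Rightarrow> real \<Rightarrow> nat \<Rightarrow> real \<Rightarrow> bool" where
  "tree_constant TM TD \<epsilon> n c \<longleftrightarrow> (\<forall>(T :: nat \<Rightarrow> (int ^ 'm) set) v0 E. v0 \<in> T n \<longrightarrow>
    (\<forall>k\<ge>n. \<forall>v\<in>T k. \<exists>S\<subseteq>T (Suc k). finite S \<and> card S = branching TM TD k \<and>
       (\<forall>v'\<in>S. cell_parent k v' = v)) \<longrightarrow>
    (\<forall>U. open U \<longrightarrow> E \<subseteq> U \<longrightarrow> (\<exists>K. \<forall>k\<ge>K. \<forall>v\<in>T k. \<exists>x\<in>U. cell k x = v)) \<longrightarrow>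
    ball_content_ge (real CARD('m) - \<epsilon>) c E)"

lemma tree_constant_exists:
  assumes "0 < \<epsilon>" "\<epsilon> < 1"
  shows "\<exists>c>0. tree_constant TYPE('m::finite) TYPE('d::finite) \<epsilon> n c"
proof -
  obtain D where D: "D > 0" "\<And>k. k \<ge> n \<Longrightarrow> real (grid (Suc k)) ^ CARD('m) \<le>
    D * real (grid k) powr \<epsilon> * (\<Prod>i\<in>{n..k}. real (branching TYPE('m) TYPE('d) i))"
    using branching_growth[OF assms(1), where 'm='m and 'd='d] by blast
  show ?thesis
    unfolding tree_constant_def
  proof (intro exI conjI allI impI)
    show "0 < 1 / (4 ^ CARD('m) * D + real (grid n) ^ CARD('m))"
      using D(1) by (simp add: add_pos_pos)
  qed (rule tree_content[where b = "branching TYPE('m) TYPE('d)"], use D assms branching_pos in auto)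
qed

section \<open>Trees of cells that approximate a target value\<close>

definition noise_vec :: "int ^ 'd::finite \<Rightarrow> real ^ 'd" where
  "noise_vec u = (\<chi> i. of_int (u $ i))"

text \<open>The levels up to \<open>n0\<close> are left out: there the random field need not be constant on cells, and it is
  absorbed into the deterministic map, which leaves only countably many cases.\<close>

primrec noise_sum :: "(nat \<times> (int ^ 'm::finite) \<Rightarrow> int ^ 'd::finite) \<Rightarrow> nat \<Rightarrow> nat \<Rightarrow> int ^ 'm \<Rightarrow> real ^ 'd" where
  "noise_sum \<omega> n0 0 v = 0"
| "noise_sum \<omega> n0 (Suc k) v = noise_sum \<omega> n0 k (cell_parent k v) +
     (if n0 \<le> k then (1 / 2) ^ Suc k *\<^sub>R noise_vec (\<omega> (Suc k, v)) else 0)"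

text \<open>Beyond 10 in absolute value the extreme noise value removes 10 out of at most 18;
  otherwise the floor leaves less than 1.\<close>

lemma clamp_noise:
  fixes t :: "real ^ 'd::finite"
  assumes "\<And>i. \<bar>t $ i\<bar> \<le> 18"
  obtains u where "u \<in> noise_vals" "\<And>i. \<bar>t $ i - of_int (u $ i)\<bar> \<le> 8"
proof -
  have "\<exists>a::int. a \<in> {-10..10} \<and> \<bar>t $ i - of_int a\<bar> \<le> 8" for i
  proof -
    have t: "t $ i \<le> 18" "- 18 \<le> t $ i" using assms[of i] by linarith+
    consider "t $ i > 10" | "t $ i < - 10" | "\<bar>t $ i\<bar> \<le> 10" by linarith
    then show ?thesis
    proof cases
      case 1
      then show ?thesis using t by (intro exI[of _ 10]) auto
    next
      case 2
      then show ?thesis using t by (intro exI[of _ "-10"]) auto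
    next
      case 3
      then show ?thesis by (intro exI[of _ "\<lfloor>t $ i\<rfloor>"]) (auto; linarith)
    qed
  qed
  then obtain a where a: "\<And>i. a i \<in> {-10..10::int} \<and> \<bar>t $ i - of_int (a i)\<bar> \<le> 8" by metis
  show thesis
    by (rule that[of "\<chi> i. a i"]) (use a in \<open>simp_all add: noise_vals_def\<close>)
qed

text \<open>The distance of \<open>F\<close> to \<open>y\<close> has a positive minimum on the
  compact set \<open>K - U\<close>.\<close>

lemma fibre_neighbourhood:
  fixes F :: "'a::metric_space \<Rightarrow> 'b::metric_space"
  assumes K: "compact K" and cont: "continuous_on K F" and U: "open U" "{x \<in> K. F x = y} \<subseteq> U"
  shows "\<exists>e>0. \<forall>x\<in>K. dist (F x) y < e \<longrightarrow> x \<in> U"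
proof (cases "K - U = {}")
  case True
  then show ?thesis by (intro exI[of _ 1]) auto
next
  case False
  have "compact (K - U)" using K U(1) by (rule compact_diff)
  moreover have "continuous_on (K - U) (\<lambda>x. dist (F x) y)"
    by (intro continuous_intros continuous_on_subset[OF cont]) auto
  ultimately obtain p where p: "p \<in> K - U" "\<And>q. q \<in> K - U \<Longrightarrow> dist (F p) y \<le> dist (F q) y"
    using continuous_attains_inf[OF _ False] by blast
  have "dist (F p) y > 0" using p(1) U(2) by auto
  then show ?thesis using p(2) by (intro exI[of _ "dist (F p) y"]) (auto simp: not_less[symmetric])
qed

context rich_cells
begin

text \<open>The cells from which \<open>y\<close> can still be reached: the noise so far plus some
  rich colour misses it by a tolerance that \<open>targets_step\<close> reproduces at the next
  level.\<close>

definition targets :: "(nat \<times> (int ^ 'm) \<Rightarrow> int ^ 'd) \<Rightarrow> nat \<Rightarrow> real ^ 'd \<Rightarrow> nat \<Rightarrow> (int ^ 'm) set" where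
  "targets \<omega> n0 y k = {v. \<exists>c. rich k v c \<and>
     (\<forall>i. \<bar>y $ i - noise_sum \<omega> n0 k v $ i - of_int (c $ i) / 2 ^ k\<bar> \<le> 8 / 2 ^ k)}"

text \<open>In units of \<open>2 ^ - (k + 1)\<close> the tolerance 8 becomes 16, and refining the
  colour shifts it by at most 1. A suitable noise value brings the residue back to 8, and on a good
  level that value occurs on enough rich children.\<close>

lemma targets_step:
  assumes good: "good_level \<omega> k" and k: "n0 \<le> k" and v: "v \<in> targets \<omega> n0 y k"
  shows "\<exists>S\<subseteq>targets \<omega> n0 y (Suc k). finite S \<and> card S = branching TYPE('m) TYPE('d) k \<and> (\<forall>v'\<in>S. cell_parent k v' = v)"
proof -
  obtain c where c: "rich k v c" "\<And>i. \<bar>y $ i - noise_sum \<omega> n0 k v $ i - of_int (c $ i) / 2 ^ k\<bar> \<le> 8 / 2 ^ k"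
    using v by (auto simp: targets_def)
  obtain c' where c': "colour_parent c' = c"
    "real (card (rich_children k v c')) \<ge> real (grid k) ^ CARD('m) / 2 ^ ((CARD('d) + 1) * Suc k)"
    using rich_branching[OF c(1)] by (auto simp: rich_children_def)
  define t :: "real ^ 'd" where "t = (\<chi> i. 2 ^ Suc k * (y $ i - noise_sum \<omega> n0 k v $ i) - of_int (c' $ i))"
  have "\<bar>t $ i\<bar> \<le> 18" for i
  proof -
    have "c' \<in> {c'. colour_parent c' = c}" using c' by simp
    then have "c' $ i \<in> {c $ i * 2..<c $ i * 2 + 2}" unfolding colour_children by blast
    then have "real_of_int (c $ i * 2) \<le> of_int (c' $ i)" "real_of_int (c' $ i) \<le> of_int (c $ i * 2 + 1)"
      by (simp_all only: of_int_le_iff) auto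
    moreover have "\<bar>2 ^ Suc k * (y $ i - noise_sum \<omega> n0 k v $ i) - of_int (c $ i * 2)\<bar> \<le> 16"
    proof -
      have "2 ^ Suc k * (y $ i - noise_sum \<omega> n0 k v $ i) - of_int (c $ i * 2) =
        2 ^ Suc k * (y $ i - noise_sum \<omega> n0 k v $ i - of_int (c $ i) / 2 ^ k)" by (simp add: field_simps)
      also have "\<bar>\<dots>\<bar> = 2 ^ Suc k * \<bar>y $ i - noise_sum \<omega> n0 k v $ i - of_int (c $ i) / 2 ^ k\<bar>"
        by (simp only: abs_mult power_abs abs_numeral)
      also have "\<dots> \<le> 2 ^ Suc k * (8 / 2 ^ k)"
        by (rule mult_left_mono[OF c(2)]) simp
      finally show ?thesis by simp
    qed
    ultimately show ?thesis unfolding t_def vec_lambda_beta of_int_add of_int_1 by linarith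
  qed
  then obtain u where u: "u \<in> noise_vals" "\<And>i. \<bar>t $ i - of_int (u $ i)\<bar> \<le> 8"
    using clamp_noise by blast
  have "branching TYPE('m) TYPE('d) k \<le> card {v' \<in> rich_children k v c'. \<omega> (Suc k, v') = u}"
    using good c'(2) u(1) unfolding good_level_def by blast
  then obtain S where S: "S \<subseteq> {v' \<in> rich_children k v c'. \<omega> (Suc k, v') = u}" "card S = branching TYPE('m) TYPE('d) k" "finite S"
    by (rule obtain_subset_with_card_n)
  have "S \<subseteq> targets \<omega> n0 y (Suc k)"
  proof
    fix v' assume "v' \<in> S"
    then have v': "rich (Suc k) v' c'" "cell_parent k v' = v" "\<omega> (Suc k, v') = u"
      using S(1) by (auto simp: rich_children_def)
    have "\<bar>y $ i - noise_sum \<omega> n0 (Suc k) v' $ i - of_int (c' $ i) / 2 ^ Suc k\<bar> \<le> 8 / 2 ^ Suc k" for i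
    proof -
      have "y $ i - noise_sum \<omega> n0 (Suc k) v' $ i - of_int (c' $ i) / 2 ^ Suc k = (t $ i - of_int (u $ i)) / 2 ^ Suc k"
        using k by (simp add: v' t_def noise_vec_def field_simps power_one_over)
      also have "\<bar>\<dots>\<bar> = \<bar>t $ i - of_int (u $ i)\<bar> / 2 ^ Suc k"
        by (simp only: abs_divide power_abs abs_numeral)
      also have "\<dots> \<le> 8 / 2 ^ Suc k" by (rule divide_right_mono[OF u(2)]) simp
      finally show ?thesis .
    qed
    with v'(1) show "v' \<in> targets \<omega> n0 y (Suc k)" unfolding targets_def by blast
  qed
  moreover have "\<forall>v'\<in>S. cell_parent k v' = v" using S(1) by (auto simp: rich_children_def)
  ultimately show ?thesis using S by blast
qed

lemma colour_approx: "\<bar>z $ i - of_int (colour k z $ i) / 2 ^ k\<bar> \<le> 1 / 2 ^ k"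
proof -
  have "z $ i - of_int (colour k z $ i) / 2 ^ k = (2 ^ k * z $ i - of_int \<lfloor>2 ^ k * z $ i\<rfloor>) / 2 ^ k"
    by (simp add: colour_def diff_divide_distrib)
  also have "\<bar>\<dots>\<bar> \<le> 1 / 2 ^ k"
    by (simp, rule divide_right_mono) (linarith, simp)
  finally show ?thesis .
qed

text \<open>The tree of \<open>targets\<close>, rooted at the cell of \<open>x\<close>, serves every
  \<open>y\<close> near \<open>F x\<close>. Points in its cells of level \<open>k\<close> have
  values within \<open>O(2 ^ - k)\<close> of \<open>y\<close>, hence lie in any given neighbourhood
  of the fibre from some level on.\<close>

lemma fibre_content:
  fixes F :: "real ^ 'm \<Rightarrow> real ^ 'd"
  assumes cont: "continuous_on (cbox 0 1) F"
    and approx: "\<And>x K i. x \<in> X \<Longrightarrow> n0 \<le> K \<Longrightarrow> \<bar>F x $ i - h x $ i - noise_sum \<omega> n0 K (cell K x) $ i\<bar> \<le> 10 / 2 ^ K"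
    and n: "n0 \<le> n" and good: "\<And>k. n \<le> k \<Longrightarrow> good_level \<omega> k"
    and x: "x \<in> X" "rich n (cell n x) (colour n (h x))" "\<omega> (Suc n, cell (Suc n) x) = 0"
    and y: "\<And>i. \<bar>y $ i - F x $ i\<bar> \<le> 3 / 2 / 2 ^ n"
    and const: "tree_constant TYPE('m) TYPE('d) \<epsilon> n c"
  shows "ball_content_ge (real CARD('m) - \<epsilon>) c {x \<in> cbox 0 1. F x = y}"
proof (rule const[unfolded tree_constant_def, rule_format, where T = "targets \<omega> n0 y" and ?v0.0 = "cell n x"])
  show "cell n x \<in> targets \<omega> n0 y n"
    unfolding targets_def
  proof (clarify, intro exI[of _ "colour n (h x)"] conjI allI)
    fix i
    \<comment> \<open>The vanishing noise allows \<open>approx\<close> to be used one level deeper,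
      with error 5 in place of 10 units; then \<open>3/2 + 5 + 1\<close> fits into the tolerance
      8.\<close>
    have "noise_sum \<omega> n0 (Suc n) (cell (Suc n) x) = noise_sum \<omega> n0 n (cell n x)"
      using x(3) by (simp add: noise_vec_def vec_eq_iff)
    then have "\<bar>F x $ i - h x $ i - noise_sum \<omega> n0 n (cell n x) $ i\<bar> \<le> 5 / 2 ^ n"
      using approx[OF x(1), of "Suc n" i] n by simp
    moreover have "\<bar>h x $ i - of_int (colour n (h x) $ i) / 2 ^ n\<bar> \<le> 1 / 2 ^ n" by (rule colour_approx)
    moreover have "(3 / 2 + 5 + 1) / 2 ^ n \<le> (8 / 2 ^ n :: real)" by (rule divide_right_mono) auto
    then have "3 / 2 / 2 ^ n + 5 / 2 ^ n + 1 / 2 ^ n \<le> (8 / 2 ^ n :: real)" by (simp only: add_divide_distrib)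
    ultimately show "\<bar>y $ i - noise_sum \<omega> n0 n (cell n x) $ i - of_int (colour n (h x) $ i) / 2 ^ n\<bar> \<le> 8 / 2 ^ n"
      using y[of i] by linarith
  qed (fact x(2))
next
  fix k v assume "n \<le> k" "v \<in> targets \<omega> n0 y k"
  then show "\<exists>S\<subseteq>targets \<omega> n0 y (Suc k). finite S \<and> card S = branching TYPE('m) TYPE('d) k \<and> (\<forall>v'\<in>S. cell_parent k v' = v)"
    using n good by (intro targets_step) auto
next
  fix U assume U: "open U" "{x \<in> cbox 0 1. F x = y} \<subseteq> U"
  obtain e where e: "e > 0" "\<And>x. x \<in> cbox 0 1 \<Longrightarrow> dist (F x) y < e \<Longrightarrow> x \<in> U"
    using fibre_neighbourhood[OF compact_cbox cont U] by blast
  have "(\<lambda>k. real CARD('d) * (19 / 2 ^ k)) \<longlonglongrightarrow> 0" by real_asymp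
  then have "\<forall>\<^sub>F k in sequentially. real CARD('d) * (19 / 2 ^ k) < e"
    using e(1) by (rule order_tendstoD)
  then obtain K0 where K0: "\<And>k. k \<ge> K0 \<Longrightarrow> real CARD('d) * (19 / 2 ^ k) < e"
    by (auto simp: eventually_sequentially)
  show "\<exists>K. \<forall>k\<ge>K. \<forall>v\<in>targets \<omega> n0 y k. \<exists>x\<in>U. cell k x = v"
  proof (intro exI[of _ "max K0 n0"] allI impI ballI)
    fix k v assume k: "max K0 n0 \<le> k" and v: "v \<in> targets \<omega> n0 y k"
    obtain c where c: "rich k v c" "\<And>i. \<bar>y $ i - noise_sum \<omega> n0 k v $ i - of_int (c $ i) / 2 ^ k\<bar> \<le> 8 / 2 ^ k"
      using v by (auto simp: targets_def)
    obtain z where z: "z \<in> X" "cell k z = v" "colour k (h z) = c"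
      using rich_nonempty[OF c(1)] by blast
    \<comment> \<open>8 for the target, 10 for the later noise and 1 for the colour.\<close>
    have "norm ((F z - y) $ i) \<le> 19 / 2 ^ k" for i
    proof -
      have "8 / 2 ^ k + 10 / 2 ^ k + 1 / 2 ^ k = (19 / 2 ^ k :: real)" by (simp add: add_divide_distrib[symmetric])
      then show ?thesis
        using approx[OF z(1), of k i] c(2)[of i] colour_approx[of "h z" i k] k z
        by (simp only: vector_minus_component real_norm_def) (simp; linarith)
    qed
    then have "dist (F z) y \<le> real CARD('d) * (19 / 2 ^ k)"
      unfolding dist_norm
      using order_trans[OF norm_le_l1_cart[of "F z - y"] sum_bounded_above[of UNIV "\<lambda>i. \<bar>(F z - y) $ i\<bar>" "19 / 2 ^ k"]] by simp
    also have "\<dots> < e" using K0 k by simp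
    finally have "z \<in> U"
      using X_unit[OF z(1)] by (intro e(2)) (auto simp: mem_box_cart less_imp_le)
    with z show "\<exists>x\<in>U. cell k x = v" by blast
  qed
qed

end

section \<open>The random field\<close>

text \<open>Summable in \<open>k\<close>, so that almost every point lies in only finitely many
  margins.\<close>

definition margin :: "nat \<Rightarrow> real" where
  "margin k = (1 / 2) ^ (k + 2)"

lemma margin_pos: "0 < margin k" and margin_le: "margin k \<le> 1 / 4"
  by (simp_all add: margin_def power_one_over field_simps)

text \<open>A trapezoid supported on the unit interval, with ramps of width \<open>\<eta>\<close> at
  both ends.\<close>

definition tent :: "real \<Rightarrow> real \<Rightarrow> real" where
  "tent \<eta> t = max 0 (min 1 (min t (1 - t) / \<eta>))"

definition bump :: "nat \<Rightarrow> int ^ 'm::finite \<Rightarrow> real ^ 'm \<Rightarrow> real" where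
  "bump k v x = (\<Prod>j\<in>UNIV. tent (margin k) (real (grid k) * x $ j - of_int (v $ j)))"

definition in_core :: "nat \<Rightarrow> real ^ 'm::finite \<Rightarrow> bool" where
  "in_core k x \<longleftrightarrow> (\<forall>j. frac (real (grid k) * x $ j) \<in> {margin k..1 - margin k})"

lemma tent_bounds: "0 \<le> tent \<eta> t" "tent \<eta> t \<le> 1"
  by (auto simp: tent_def)

lemma bump_bounds: "0 \<le> bump k v x" "bump k v x \<le> 1"
  by (auto simp: bump_def intro!: prod_nonneg prod_le_1 tent_bounds)

lemma bump_nonzero_cell:
  assumes "bump k v x \<noteq> 0"
  shows "cell k x = v"
proof -
  have "\<lfloor>real (grid k) * x $ j\<rfloor> = v $ j" for j
  proof -
    define t where "t = real (grid k) * x $ j - of_int (v $ j)"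
    have "tent (margin k) t \<noteq> 0" using assms by (simp add: bump_def t_def)
    then have "min t (1 - t) / margin k > 0"
      by (rule contrapos_np) (simp add: tent_def)
    then have "t > 0" "t < 1" using margin_pos[of k] by (auto simp: zero_less_divide_iff)
    then show ?thesis unfolding t_def by (intro floor_unique) simp_all
  qed
  then show ?thesis by (simp add: cell_def vec_eq_iff)
qed

lemma bump_core:
  assumes "in_core k x"
  shows "bump k (cell k x) x = 1"
proof -
  have "tent (margin k) (frac (real (grid k) * x $ j)) = 1" for j
  proof -
    have "margin k \<le> frac (real (grid k) * x $ j)" "frac (real (grid k) * x $ j) \<le> 1 - margin k"
      using assms by (auto simp: in_core_def)
    then have "1 \<le> min (frac (real (grid k) * x $ j)) (1 - frac (real (grid k) * x $ j)) / margin k"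
      using margin_pos[of k] by (simp add: field_simps)
    then show ?thesis by (simp add: tent_def)
  qed
  then show ?thesis by (simp add: bump_def cell_def frac_def)
qed

lemma continuous_on_bump: "continuous_on S (bump k v)"
  unfolding bump_def tent_def using margin_pos[of k]
  by (intro continuous_intros) auto

definition level_field :: "(nat \<times> (int ^ 'm::finite) \<Rightarrow> int ^ 'd::finite) \<Rightarrow> nat \<Rightarrow> real ^ 'm \<Rightarrow> real ^ 'd" where
  "level_field \<omega> k x = (1 / 2) ^ k *\<^sub>R (\<Sum>v\<in>cells k. bump k v x *\<^sub>R noise_vec (\<omega> (k, v)))"

text \<open>Only the bump of the cell of \<open>x\<close> can be nonzero at \<open>x\<close>. The
  sum form gives continuity, this one gives bounds; outside the half-open unit cube the field is
  0.\<close>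

lemma level_field_eq:
  "level_field \<omega> k x = (if cell k x \<in> cells k then ((1 / 2) ^ k * bump k (cell k x) x) *\<^sub>R noise_vec (\<omega> (k, cell k x)) else 0)"
proof -
  have "(\<Sum>v\<in>cells k. bump k v x *\<^sub>R noise_vec (\<omega> (k, v)))
      = (\<Sum>v\<in>cells k. if v = cell k x then bump k (cell k x) x *\<^sub>R noise_vec (\<omega> (k, cell k x)) else 0)"
    by (rule sum.cong) (use bump_nonzero_cell[of k _ x] in force)+
  then show ?thesis by (simp add: level_field_def finite_cells)
qed

lemma level_field_core:
  assumes "in_core k x" "cell k x \<in> cells k"
  shows "level_field \<omega> k x = (1 / 2) ^ k *\<^sub>R noise_vec (\<omega> (k, cell k x))"
  using assms by (simp add: level_field_eq bump_core)

lemma noise_vals_nth: "u \<in> noise_vals \<Longrightarrow> \<bar>real_of_int (u $ i)\<bar> \<le> 10"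
  by (simp add: noise_vals_def abs_le_iff) (metis of_int_le_iff of_int_numeral of_int_minus minus_le_iff)

lemma level_field_bound:
  assumes "\<omega> \<in> space noise"
  shows "\<bar>level_field \<omega> k x $ i\<bar> \<le> 10 * (1 / 2) ^ k"
proof -
  have "\<bar>noise_vec (\<omega> (k, cell k x)) $ i\<bar> \<le> 10"
    using noise_vals_nth[OF noise_in_vals[OF assms]] by (simp add: noise_vec_def)
  then have "bump k (cell k x) x * \<bar>noise_vec (\<omega> (k, cell k x)) $ i\<bar> \<le> 1 * 10"
    by (intro mult_mono bump_bounds) auto
  then show ?thesis
    by (simp add: level_field_eq abs_mult bump_bounds mult.commute[of "10::real"] mult.assoc)
qed

lemma continuous_on_level_field: "continuous_on S (level_field \<omega> k)"
  unfolding level_field_def by (intro continuous_intros continuous_on_bump)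

text \<open>The series starts at level 1, in step with \<open>noise_sum\<close>, which is 0 at level
  0.\<close>

definition noise_field :: "(nat \<times> (int ^ 'm::finite) \<Rightarrow> int ^ 'd::finite) \<Rightarrow> real ^ 'm \<Rightarrow> real ^ 'd" where
  "noise_field \<omega> x = (\<Sum>k. level_field \<omega> (Suc k) x)"

lemma norm_level_field:
  fixes \<omega> :: "nat \<times> (int ^ 'm::finite) \<Rightarrow> int ^ 'd::finite"
  assumes "\<omega> \<in> space noise"
  shows "norm (level_field \<omega> k x) \<le> real CARD('d) * 10 * (1 / 2) ^ k"
  using order_trans[OF norm_le_l1_cart[of "level_field \<omega> k x"]
      sum_bounded_above[of UNIV "\<lambda>i. \<bar>level_field \<omega> k x $ i\<bar>" "10 * (1 / 2) ^ k"]]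
    level_field_bound[OF assms] by simp

lemma summable_level_bound: "summable (\<lambda>k. real CARD('d::finite) * 10 * (1 / 2) ^ Suc k)"
  by (intro summable_mult summable_Suc_iff[THEN iffD2] summable_geometric) simp

lemma summable_level_field:
  assumes "\<omega> \<in> space noise"
  shows "summable (\<lambda>k. level_field \<omega> (Suc k) x)"
  by (rule summable_comparison_test'[OF summable_level_bound, where N = 0]) (rule norm_level_field[OF assms])

lemma uniform_limit_noise_field:
  assumes "\<omega> \<in> space noise"
  shows "uniform_limit S (\<lambda>n x. \<Sum>k<n. level_field \<omega> (Suc k) x) (noise_field \<omega>) sequentially"
  unfolding noise_field_def
  by (rule Weierstrass_m_test[OF _ summable_level_bound]) (rule norm_level_field[OF assms])

lemma continuous_on_noise_field:
  assumes "\<omega> \<in> space noise"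
  shows "continuous_on S (noise_field \<omega>)"
  by (rule uniform_limit_theorem[OF _ uniform_limit_noise_field[OF assms]])
     (auto intro!: always_eventually continuous_intros continuous_on_level_field)

text \<open>At these points every level after \<open>n0\<close> equals the noise value of the cell,
  undamped by the margin. The half-open cube keeps their cells inside \<open>cells\<close>.\<close>

definition stable_points :: "nat \<Rightarrow> (real ^ 'm::finite) set" where
  "stable_points n0 = {x. (\<forall>j. 0 \<le> x $ j \<and> x $ j < 1) \<and> (\<forall>k\<ge>n0. in_core (Suc k) x)}"

lemma noise_sum_stable:
  assumes "x \<in> stable_points n0"
  shows "noise_sum \<omega> n0 (n0 + K) (cell (n0 + K) x) = (\<Sum>k\<in>{n0..<n0 + K}. level_field \<omega> (Suc k) x)"
proof (induction K)
  case 0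
  have "noise_sum \<omega> n0 k v = 0" if "k \<le> n0" for k v
    using that by (induction k arbitrary: v) auto
  then show ?case by simp
next
  case (Suc K)
  have "level_field \<omega> (Suc (n0 + K)) x = (1 / 2) ^ Suc (n0 + K) *\<^sub>R noise_vec (\<omega> (Suc (n0 + K), cell (Suc (n0 + K)) x))"
    using assms by (intro level_field_core cell_in_cells) (auto simp: stable_points_def)
  then show ?case using Suc.IH by simp
qed

text \<open>What is left is the tail after level \<open>K\<close>, bounded by
  \<open>10 * 2 ^ - k\<close> at level \<open>k\<close>.\<close>

lemma noise_field_approx:
  assumes \<omega>: "\<omega> \<in> space noise" and x: "x \<in> stable_points n0" and K: "n0 \<le> K"
  shows "\<bar>noise_field \<omega> x $ i - (\<Sum>k<n0. level_field \<omega> (Suc k) x) $ i - noise_sum \<omega> n0 K (cell K x) $ i\<bar> \<le> 10 / 2 ^ K"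
proof -
  let ?f = "\<lambda>k. level_field \<omega> (Suc k) x"
  have "noise_sum \<omega> n0 K (cell K x) = (\<Sum>k\<in>{n0..<K}. ?f k)"
    using noise_sum_stable[OF x, of \<omega> "K - n0"] K by simp
  then have "(\<Sum>k<n0. ?f k) + noise_sum \<omega> n0 K (cell K x) = (\<Sum>k<K. ?f k)"
    using K by (simp add: lessThan_atLeast0 sum.atLeastLessThan_concat)
  moreover have "noise_field \<omega> x = (\<Sum>k. ?f (k + K)) + (\<Sum>k<K. ?f k)"
    unfolding noise_field_def by (rule suminf_split_initial_segment[OF summable_level_field[OF \<omega>]])
  ultimately have eq: "noise_field \<omega> x - (\<Sum>k<n0. ?f k) - noise_sum \<omega> n0 K (cell K x) = (\<Sum>k. ?f (k + K))"
    by (simp add: algebra_simps)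
  have sm: "summable (\<lambda>k. ?f (k + K))"
    by (rule summable_ignore_initial_segment[OF summable_level_field[OF \<omega>]])
  then have "(\<Sum>k. ?f (k + K)) $ i = (\<Sum>k. ?f (k + K) $ i)" and sm_i: "summable (\<lambda>k. ?f (k + K) $ i)"
    using bounded_linear.suminf[OF bounded_linear_vec_nth sm] bounded_linear.summable[OF bounded_linear_vec_nth sm] by auto
  moreover have "\<bar>\<Sum>k. ?f (k + K) $ i\<bar> \<le> 10 / 2 ^ K"
  proof -
    have le: "\<bar>?f (k + K) $ i\<bar> \<le> 10 / 2 ^ K * (1 / 2) ^ Suc k" for k
      using level_field_bound[OF \<omega>, of "Suc (k + K)" x i] by (simp add: power_add power_one_over field_simps)
    have sg: "(\<lambda>k. 10 / 2 ^ K * (1 / 2) ^ Suc k :: real) sums (10 / 2 ^ K * 1)"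
      using power_half_series by (intro sums_mult) simp
    have "norm (\<Sum>k. ?f (k + K) $ i) \<le> (\<Sum>k. 10 / 2 ^ K * (1 / 2) ^ Suc k :: real)"
      by (rule norm_suminf_le) (use le sg in \<open>auto simp: sums_iff\<close>)
    also have "\<dots> = 10 / 2 ^ K * 1" by (rule sums_unique[OF sg, symmetric])
    finally show ?thesis by simp
  qed
  ultimately show ?thesis using eq by (metis vector_minus_component)
qed

section \<open>Almost every point is stable and meets the noise value 0 infinitely often\<close>

lemma measurable_in_core [measurable]: "Measurable.pred borel (in_core k :: real ^ 'm::finite \<Rightarrow> bool)"
  unfolding in_core_def frac_def by measurable

lemma stable_points_borel [measurable]: "stable_points n0 \<in> sets (borel :: (real ^ 'm::finite) measure)"
proof -
  have "stable_points n0 = {x \<in> space (borel :: (real ^ 'm) measure). (\<forall>j. 0 \<le> x $ j \<and> x $ j < 1) \<and> (\<forall>k\<ge>n0. in_core (Suc k) x)}"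
    by (auto simp: stable_points_def)
  also have "\<dots> \<in> sets borel" by measurable
  finally show ?thesis .
qed

lemma measure_unit_cube: "measure lborel (cbox 0 1 :: (real ^ 'm::finite) set) = 1"
  by (subst content_cbox_cart) (auto simp: interval_eq_empty_cart)

text \<open>The shrunken cells \<open>Q v\<close> are disjoint, lie in the core and fill
  \<open>(1 - 2 * \<eta>) ^ m\<close> of the cube; Bernoulli's inequality bounds the
  remainder.\<close>

lemma measure_outside_core:
  "measure lborel {x \<in> cbox 0 1. \<not> in_core k (x :: real ^ 'm::finite)} \<le> 2 * real CARD('m) * margin k"
proof -
  define N where "N = real (grid k)"
  define \<eta> where "\<eta> = margin k"
  have N: "N > 0" by (simp add: N_def)
  have \<eta>: "0 < \<eta>" "\<eta> \<le> 1 / 4" using margin_pos margin_le by (simp_all add: \<eta>_def)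
  define Q :: "int ^ 'm \<Rightarrow> (real ^ 'm) set" where
    "Q v = cbox (\<chi> j. (of_int (v $ j) + \<eta>) / N) (\<chi> j. (of_int (v $ j) + 1 - \<eta>) / N)" for v
  have Q: "cell k x = v \<and> in_core k x" if "x \<in> Q v" for x v
  proof -
    have b: "of_int (v $ j) + \<eta> \<le> N * x $ j" "N * x $ j \<le> of_int (v $ j) + 1 - \<eta>" for j
      using that N by (auto simp: Q_def mem_box_cart field_simps)
    have fl: "\<lfloor>N * x $ j\<rfloor> = v $ j" for j
      using b[of j] \<eta> by (intro floor_unique) auto
    then have "cell k x = v" by (simp add: cell_def vec_eq_iff N_def)
    moreover have "in_core k x"
      unfolding in_core_def
    proof
      fix j
      have "frac (real (grid k) * x $ j) = N * x $ j - of_int (v $ j)"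
        by (simp add: frac_def fl[unfolded N_def] N_def)
      then show "frac (real (grid k) * x $ j) \<in> {margin k..1 - margin k}"
        using b[of j] by (simp add: \<eta>_def)
    qed
    ultimately show ?thesis ..
  qed
  have Qm: "measure lborel (Q v) = ((1 - 2 * \<eta>) / N) ^ CARD('m)" for v
  proof -
    have "measure lborel (Q v) = (\<Prod>j\<in>(UNIV :: 'm set). (1 - 2 * \<eta>) / N)"
      unfolding Q_def using N \<eta>
      by (subst content_cbox_cart) (auto simp: interval_eq_empty_cart not_less divide_right_mono diff_divide_distrib[symmetric] algebra_simps)
    then show ?thesis by simp
  qed
  have Qsub: "Q v \<subseteq> cbox 0 1" if "v \<in> cells k" for v
  proof
    fix x assume x: "x \<in> Q v"
    have "0 \<le> x $ j \<and> x $ j \<le> 1" for j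
    proof -
      have "0 \<le> v $ j" "v $ j + 1 \<le> int (grid k)" using that by (simp_all add: cells_def zless_imp_add1_zle)
      then have v: "0 \<le> real_of_int (v $ j)" "real_of_int (v $ j) + 1 \<le> N"
        unfolding N_def by (simp, metis of_int_1 of_int_add of_int_le_iff of_int_of_nat_eq)
      have "of_int (v $ j) + \<eta> \<le> N * x $ j" "N * x $ j \<le> of_int (v $ j) + 1 - \<eta>"
        using x N by (auto simp: Q_def mem_box_cart field_simps)
      then have "0 \<le> N * x $ j" "N * x $ j \<le> N * 1" using v \<eta> by linarith+
      then show ?thesis
        using mult_le_cancel_left_pos[OF N, of "x $ j" 1] mult_le_cancel_left_pos[OF N, of 0 "x $ j"] by (metis mult_zero_right)
    qed
    then show "x \<in> cbox 0 1" by (simp add: mem_box_cart)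
  qed
  have "disjoint_family_on Q (cells k)"
    unfolding disjoint_family_on_def using Q by blast
  then have "measure lborel (\<Union>v\<in>cells k. Q v) = (\<Sum>v\<in>cells k. measure lborel (Q v))"
  proof (rule measure_finite_Union[OF finite_cells, rotated])
    show "Q ` cells k \<subseteq> sets lborel" by (auto simp: Q_def)
    show "emeasure lborel (Q v) \<noteq> \<infinity>" if "v \<in> cells k" for v by (simp add: Q_def emeasure_lborel_cbox_eq)
  qed
  also have "\<dots> = (1 - 2 * \<eta>) ^ CARD('m)"
    using N by (simp add: Qm card_cells power_divide N_def)
  finally have mU: "measure lborel (\<Union>v\<in>cells k. Q v) = (1 - 2 * \<eta>) ^ CARD('m)" .
  have fm: "(\<Union>v\<in>cells k. Q v) \<in> fmeasurable lborel" "cbox 0 1 \<in> fmeasurable (lborel :: (real ^ 'm) measure)"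
  proof -
    have "Q v \<in> fmeasurable lborel" for v
      by (rule fmeasurableI) (simp_all add: Q_def emeasure_lborel_cbox_eq)
    then show "(\<Union>v\<in>cells k. Q v) \<in> fmeasurable lborel" by (intro fmeasurable.finite_UN finite_cells)
    show "cbox 0 1 \<in> fmeasurable (lborel :: (real ^ 'm) measure)"
      by (rule fmeasurableI) (simp_all add: emeasure_lborel_cbox_eq)
  qed
  have "measure lborel {x \<in> cbox 0 1. \<not> in_core k (x :: real ^ 'm)} \<le> measure lborel (cbox 0 1 - (\<Union>v\<in>cells k. Q v))"
  proof (rule measure_mono_fmeasurable)
    show "{x \<in> cbox 0 1. \<not> in_core k (x :: real ^ 'm)} \<subseteq> cbox 0 1 - (\<Union>v\<in>cells k. Q v)"
      using Q by blast
    have "{x \<in> space borel. x \<in> cbox 0 1 \<and> \<not> in_core k (x :: real ^ 'm)} \<in> sets borel" by measurable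
    then show "{x \<in> cbox 0 1. \<not> in_core k (x :: real ^ 'm)} \<in> sets lborel" by simp
    show "cbox 0 1 - (\<Union>v\<in>cells k. Q v) \<in> fmeasurable lborel" using fm by auto
  qed
  also have "\<dots> = measure lborel (cbox 0 1 :: (real ^ 'm) set) - measure lborel (\<Union>v\<in>cells k. Q v)"
    using fm Qsub by (intro measure_Diff) (auto simp: emeasure_lborel_cbox_eq)
  also have "measure lborel (cbox 0 1 :: (real ^ 'm) set) = 1"
    by (rule measure_unit_cube)
  also have "1 - measure lborel (\<Union>v\<in>cells k. Q v) \<le> 2 * real CARD('m) * \<eta>"
    using Bernoulli_inequality[of "- (2 * \<eta>)" "CARD('m)"] \<eta> by (simp add: mU algebra_simps)
  finally show ?thesis by (simp add: \<eta>_def)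
qed

text \<open>Borel-Cantelli, with the boundary of the cube discarded as a null set to obtain
  coordinates below 1.\<close>

lemma AE_stable_points: "AE x in lborel. x \<in> cbox 0 1 \<longrightarrow> (\<exists>n0. (x :: real ^ 'm::finite) \<in> stable_points n0)"
proof -
  have meas: "{x \<in> cbox 0 1. \<not> in_core k (x :: real ^ 'm)} \<in> sets lborel" for k
  proof -
    have "{x \<in> space borel. x \<in> cbox 0 1 \<and> \<not> in_core k (x :: real ^ 'm)} \<in> sets borel" by measurable
    then show ?thesis by simp
  qed
  have fin: "emeasure lborel {x \<in> cbox 0 1. \<not> in_core k (x :: real ^ 'm)} < \<infinity>" for k
    by (rule le_less_trans[OF emeasure_mono[of _ "cbox 0 1"]]) (auto simp: emeasure_lborel_cbox_eq)
  have "AE x in lborel. eventually (\<lambda>k. (x :: real ^ 'm) \<in> space lborel - {x \<in> cbox 0 1. \<not> in_core k x}) sequentially"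
  proof (rule borel_cantelli_AE1[OF meas fin])
    show "summable (\<lambda>k. measure lborel {x \<in> cbox 0 1. \<not> in_core k (x :: real ^ 'm)})"
    proof (rule summable_comparison_test'[where N = 0 and g = "\<lambda>k. 2 * real CARD('m) * margin k"])
      show "summable (\<lambda>k. 2 * real CARD('m) * margin k)"
        unfolding margin_def power_add by (intro summable_mult summable_mult2 summable_geometric) simp
    qed (use measure_outside_core in simp)
  qed
  moreover have "AE x in lborel. (x :: real ^ 'm) \<notin> cbox 0 1 - box 0 1"
  proof (rule AE_not_in)
    show "cbox 0 1 - box 0 1 \<in> null_sets (lborel :: (real ^ 'm) measure)"
      by (subst null_sets_def) (auto simp: emeasure_Diff box_subset_cbox emeasure_lborel_cbox_eq emeasure_lborel_box_eq)
  qed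
  ultimately show ?thesis
  proof eventually_elim
    case (elim x)
    show ?case
    proof
      assume x: "x \<in> cbox 0 1"
      then have "x \<in> box 0 1" using elim by auto
      then have unit: "0 \<le> x $ j \<and> x $ j < 1" for j by (auto simp: mem_box_cart less_imp_le)
      obtain k0 where "\<And>k. k \<ge> k0 \<Longrightarrow> in_core k x"
        using elim(1) x by (auto simp: eventually_sequentially)
      then have "x \<in> stable_points k0" using unit by (auto simp: stable_points_def)
      then show "\<exists>n0. x \<in> stable_points n0" ..
    qed
  qed
qed

text \<open>For fixed \<open>x\<close> the indices differ in their level, so
  \<open>AE_noise_hits\<close> applies; Fubini exchanges the two quantifiers.\<close>

lemma AE_zero_noise:
  "AE \<omega> in noise. AE x in lborel. \<forall>N. \<exists>n\<ge>N. (\<omega> :: nat \<times> (int ^ 'm::finite) \<Rightarrow> int ^ 'd::finite) (Suc n, cell (Suc n) x) = 0"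
proof -
  let ?P = "\<lambda>(x :: real ^ 'm) (\<omega> :: nat \<times> (int ^ 'm) \<Rightarrow> int ^ 'd). \<forall>N. \<exists>n\<ge>N. \<omega> (Suc n, cell (Suc n) x) = 0"
  interpret N: prob_space "noise :: (nat \<times> (int ^ 'm) \<Rightarrow> int ^ 'd) measure" by (rule prob_space_noise)
  interpret pair_sigma_finite "lborel :: (real ^ 'm) measure" "noise :: (nat \<times> (int ^ 'm) \<Rightarrow> int ^ 'd) measure" ..
  \<comment> \<open>The coordinate inspected depends on \<open>x\<close>; splitting over the
    countably many cells makes the joint measurability visible.\<close>
  have eq: "(\<forall>N. \<exists>n\<ge>N. \<omega> (Suc n, cell (Suc n) x) = 0) \<longleftrightarrow> (\<forall>N. \<exists>n\<ge>N. \<exists>v. cell (Suc n) x = v \<and> \<omega> (Suc n, v) = 0)"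
    for x :: "real ^ 'm" and \<omega> :: "nat \<times> (int ^ 'm) \<Rightarrow> int ^ 'd" by simp
  have [measurable]: "cell k \<in> measurable (lborel :: (real ^ 'm) measure) (count_space UNIV)" for k
    using measurable_cell[of k] by simp
  have "(AE x in lborel. AE \<omega> in noise. ?P x \<omega>) \<longleftrightarrow> (AE \<omega> in noise. AE x in lborel. ?P x \<omega>)"
    unfolding eq by (rule AE_commute) measurable
  moreover have "AE \<omega> in noise. ?P x \<omega>" for x
    by (rule AE_noise_hits[OF zero_in_noise_vals]) (auto simp: inj_on_def)
  ultimately show ?thesis by simp
qed

section \<open>Fibres of an arbitrary continuous map plus the random field\<close>

lemma level_field_cong:
  assumes "\<And>v. v \<in> cells k \<Longrightarrow> \<omega> (k, v) = \<omega>' (k, v)"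
  shows "level_field \<omega> k = level_field \<omega>' k"
  by (rule ext) (auto simp: level_field_def assms)

text \<open>The part \<open>h\<close> frozen at stage \<open>n0\<close> depends on the noise,
  whereas good levels are known almost surely only for a fixed \<open>h\<close>. The first levels
  see finitely many coordinates with countably many values, so one null set serves all possible
  \<open>h\<close>.\<close>

lemma AE_fibre_content:
  fixes g :: "real ^ 'm::finite \<Rightarrow> real ^ 'd::finite"
  assumes cont: "continuous_on (cbox 0 1) g"
    and c: "\<And>n j. tree_constant TYPE('m) TYPE('d) (\<epsilon> j) n (c n j)"
  shows "AE \<omega> in noise. AE x in lborel. x \<in> cbox 0 1 \<longrightarrow>
    (\<exists>n. \<forall>y. (\<forall>i. \<bar>y $ i - (g x + noise_field \<omega> x) $ i\<bar> \<le> 3 / 2 / 2 ^ n) \<longrightarrow>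
      (\<forall>j. ball_content_ge (real CARD('m) - \<epsilon> j) (c n j) {z \<in> cbox 0 1. g z + noise_field \<omega> z = y}))"
proof -
  define J :: "nat \<Rightarrow> (nat \<times> (int ^ 'm)) set" where "J n0 = (SIGMA k:{..n0}. cells k)" for n0
  \<comment> \<open>The noise cut down to the finitely many coordinates of the levels up to
    \<open>n0\<close>.\<close>
  define R :: "nat \<Rightarrow> (nat \<times> (int ^ 'm) \<Rightarrow> int ^ 'd) \<Rightarrow> nat \<times> (int ^ 'm) \<Rightarrow> int ^ 'd"
    where "R n0 \<omega> = (\<lambda>i. if i \<in> J n0 then \<omega> i else 0)" for n0 \<omega>
  have "finite (J n0)" for n0 by (simp add: J_def finite_cells)
  then have "countable (R n0 ` (PiE (J n0) (\<lambda>_. UNIV)))" for n0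
    by (intro countable_image countable_PiE) auto
  moreover have "range (R n0) \<subseteq> R n0 ` (PiE (J n0) (\<lambda>_. UNIV))" for n0
  proof
    fix p assume "p \<in> range (R n0)"
    then obtain \<omega> where "p = R n0 \<omega>" by auto
    then have "p = R n0 (restrict \<omega> (J n0))" by (auto simp: R_def)
    then show "p \<in> R n0 ` (PiE (J n0) (\<lambda>_. UNIV))" by auto
  qed
  ultimately have countable_R: "countable (range (R n0))" for n0 by (rule countable_subset[rotated])
  have R_field: "level_field (R n0 \<omega>) (Suc k) = level_field \<omega> (Suc k)" if "k < n0" for n0 \<omega> k
    by (rule level_field_cong) (use that in \<open>auto simp: R_def J_def\<close>)
  \<comment> \<open>The indicator makes \<open>h\<close> Borel on the whole space although
    \<open>g\<close> is continuous on the cube only.\<close>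
  define h where "h n0 p x = indicat_real (cbox 0 1) x *\<^sub>R (g x + (\<Sum>k<n0. level_field p (Suc k) x))" for n0 p x
  have cont_h: "continuous_on (cbox 0 1) (\<lambda>x. g x + (\<Sum>k<n0. level_field p (Suc k) x))" for n0 p
    by (intro continuous_intros cont continuous_on_level_field)
  have "\<exists>B. \<forall>x\<in>cbox 0 1. \<forall>i. \<bar>h n0 p x $ i\<bar> \<le> real B" for n0 p
  proof -
    have "bounded ((\<lambda>x. g x + (\<Sum>k<n0. level_field p (Suc k) x)) ` cbox 0 1)"
      by (intro compact_imp_bounded compact_continuous_image cont_h compact_cbox)
    then obtain b where b: "\<And>x. x \<in> cbox 0 1 \<Longrightarrow> norm (g x + (\<Sum>k<n0. level_field p (Suc k) x)) \<le> b"
      by (auto simp: bounded_iff)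
    have "\<bar>h n0 p x $ i\<bar> \<le> real (nat \<lceil>b\<rceil>)" if "x \<in> cbox 0 1" for x i
    proof -
      have "\<bar>h n0 p x $ i\<bar> \<le> norm (h n0 p x)" by (rule component_le_norm_cart)
      also have "\<dots> \<le> b" using b[OF that] that by (simp add: h_def)
      finally show ?thesis by linarith
    qed
    then show ?thesis by blast
  qed
  then obtain B where B: "\<And>n0 p x i. x \<in> cbox 0 1 \<Longrightarrow> \<bar>h n0 p x $ i\<bar> \<le> real (B n0 p)" by metis
  have stable_unit: "x \<in> cbox 0 1" if "x \<in> stable_points n0" for x :: "real ^ 'm" and n0
    using that by (auto simp: stable_points_def mem_box_cart less_imp_le)
  have rc: "rich_cells (h n0 p) (stable_points n0) (B n0 p)" for n0 p
  proof
    show "h n0 p \<in> borel_measurable borel"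
      unfolding h_def by (rule borel_measurable_continuous_on_indicator[OF _ cont_h]) simp
    show "stable_points n0 \<in> sets (borel :: (real ^ 'm) measure)" by simp
    show "0 \<le> x $ j \<and> x $ j < 1" if "x \<in> stable_points n0" for x :: "real ^ 'm" and j
      using that by (simp add: stable_points_def)
    show "\<bar>h n0 p x $ i\<bar> \<le> real (B n0 p)" if "x \<in> stable_points n0" for x i
      using B stable_unit[OF that] by blast
  qed
  \<comment> \<open>Simultaneously for every candidate \<open>p\<close>; below, \<open>p\<close> is
    the one that belongs to \<open>\<omega>\<close>.\<close>
  have good: "AE \<omega> in noise. \<forall>n0. \<forall>p\<in>range (R n0). \<forall>\<^sub>F k in sequentially.
      rich_cells.good_level (h n0 p) (stable_points n0) \<omega> k"
    unfolding AE_all_countable AE_ball_countable[OF countable_R]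
    by (intro allI ballI rich_cells.AE_eventually_good_level[OF rc])
  have rich: "AE x in lborel. \<forall>n0. \<forall>p\<in>range (R n0). x \<in> stable_points n0 \<longrightarrow> (\<forall>\<^sub>F k in sequentially.
      rich_cells.rich (h n0 p) (stable_points n0) k (cell k x) (colour k (h n0 p x)))"
    unfolding AE_all_countable AE_ball_countable[OF countable_R]
    by (intro allI ballI rich_cells.AE_eventually_rich[OF rc])
  show ?thesis
    using good AE_zero_noise AE_space
  proof eventually_elim
    case (elim \<omega>)
    note \<omega> = elim
    show ?case
      using \<omega>(2) rich AE_stable_points
    proof eventually_elim
      case (elim x)
      show ?case
      proof
        assume "x \<in> cbox 0 1"
        then obtain n0 where x: "x \<in> stable_points n0" using elim(3) by blast
        define p where "p = R n0 \<omega>"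
        interpret rich_cells "h n0 p" "stable_points n0" "B n0 p" by (rule rc)
        have h: "h n0 p z = g z + (\<Sum>k<n0. level_field \<omega> (Suc k) z)" if "z \<in> cbox 0 1" for z
          using that by (simp add: h_def p_def R_field)
        have "\<forall>\<^sub>F k in sequentially. good_level \<omega> k" using \<omega>(1) by (simp add: p_def)
        moreover have "\<forall>\<^sub>F k in sequentially. rich k (cell k x) (colour k (h n0 p x))"
          using elim(2) x by (simp add: p_def)
        ultimately have "\<forall>\<^sub>F k in sequentially. good_level \<omega> k \<and> rich k (cell k x) (colour k (h n0 p x))"
          by (rule eventually_conj)
        then obtain N where N: "\<And>k. N \<le> k \<Longrightarrow> good_level \<omega> k \<and> rich k (cell k x) (colour k (h n0 p x))"
          unfolding eventually_sequentially by blast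
        obtain n where n: "max N n0 \<le> n" "\<omega> (Suc n, cell (Suc n) x) = 0" using elim(1) by blast
        show "\<exists>n. \<forall>y. (\<forall>i. \<bar>y $ i - (g x + noise_field \<omega> x) $ i\<bar> \<le> 3 / 2 / 2 ^ n) \<longrightarrow>
          (\<forall>j. ball_content_ge (real CARD('m) - \<epsilon> j) (c n j) {z \<in> cbox 0 1. g z + noise_field \<omega> z = y})"
        proof (intro exI[of _ n] allI impI)
          fix y :: "real ^ 'd" and j
          assume y: "\<forall>i. \<bar>y $ i - (g x + noise_field \<omega> x) $ i\<bar> \<le> 3 / 2 / 2 ^ n"
          show "ball_content_ge (real CARD('m) - \<epsilon> j) (c n j) {z \<in> cbox 0 1. g z + noise_field \<omega> z = y}"
          proof (rule fibre_content[OF _ _ _ _ x])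
            show "continuous_on (cbox 0 1) (\<lambda>z. g z + noise_field \<omega> z)"
              by (intro continuous_intros cont continuous_on_noise_field \<omega>(3))
            show "\<bar>(g z + noise_field \<omega> z) $ i - h n0 p z $ i - noise_sum \<omega> n0 K (cell K z) $ i\<bar> \<le> 10 / 2 ^ K"
              if "z \<in> stable_points n0" "n0 \<le> K" for z K i
              using noise_field_approx[OF \<omega>(3) that, of i] stable_unit[OF that(1)] by (simp add: h)
          qed (use n N y c in auto)
        qed
      qed
    qed
  qed
qed

section \<open>Hausdorff dimension\<close>

lemma diameter_le_bound:
  assumes "\<And>x y. x \<in> U \<Longrightarrow> y \<in> U \<Longrightarrow> dist x y \<le> e" "0 \<le> e"
  shows "bounded U" "diameter U \<le> e"
proof -
  show "bounded U"
  proof (cases "U = {}")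
    case False
    then obtain a where "a \<in> U" by blast
    with assms(1) show ?thesis unfolding bounded_def by blast
  qed simp
  show "diameter U \<le> e" using assms by (auto simp: diameter_def intro!: cSUP_least)
qed

lemma dist_same_cell:
  fixes x y :: "real ^ 'm::finite"
  assumes "cell k x = cell k y"
  shows "dist x y \<le> real CARD('m) / real (grid k)"
proof -
  have "\<bar>(x - y) $ j\<bar> \<le> 1 / real (grid k)" for j
  proof -
    have "\<lfloor>real (grid k) * x $ j\<rfloor> = \<lfloor>real (grid k) * y $ j\<rfloor>"
      using assms by (simp add: cell_def vec_eq_iff)
    then have "\<bar>real (grid k) * x $ j - real (grid k) * y $ j\<bar> \<le> 1" by linarith
    then have "real (grid k) * \<bar>x $ j - y $ j\<bar> \<le> 1"
      by (simp add: right_diff_distrib[symmetric] abs_mult)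
    then show ?thesis by (simp add: field_simps)
  qed
  then show ?thesis
    unfolding dist_norm
    using order_trans[OF norm_le_l1_cart[of "x - y"] sum_bounded_above[of UNIV "\<lambda>j. \<bar>(x - y) $ j\<bar>" "1 / real (grid k)"]] by simp
qed

text \<open>Covering by the cells of level \<open>k\<close> costs
  \<open>O(grid k powr (m - s))\<close>, which tends to 0.\<close>

lemma hausdorff_measure_unit_zero:
  fixes A :: "(real ^ 'm::finite) set"
  assumes A: "A \<subseteq> cbox 0 1" and s: "s > real CARD('m)"
  shows "hausdorff_measure s A = 0"
proof -
  define M where "M = real CARD('m)"
  have M: "M > 0" by (simp add: M_def)
  define b where "b k = (2 * real (grid k)) ^ CARD('m) * (M / real (grid k)) powr s" for k
  have prem: "hausdorff_premeasure s \<delta> A \<le> ennreal (b k)" if k: "M / real (grid k) \<le> \<delta>" for \<delta> k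
  proof -
    \<comment> \<open>The range is closed above because points with a coordinate 1 have cell index
      \<open>grid k\<close> there.\<close>
    define C :: "(int ^ 'm) set" where "C = {v. \<forall>j. v $ j \<in> {0..int (grid k)}}"
    have C: "finite C" "card C = (grid k + 1) ^ CARD('m)"
      unfolding C_def by (rule finite_vec_bounded, simp) (subst card_vec_bounded, simp_all add: nat_add_distrib)
    obtain f where f: "bij_betw f {..<card C} C"
      using ex_bij_betw_nat_finite[OF C(1)] by (auto simp: lessThan_atLeast0)
    \<comment> \<open>Padding with empty sets, for which \<open>diam_pow\<close> is 0, turns the
      finite cover into a sequence.\<close>
    define U where "U i = (if i < card C then {x \<in> A. cell k x = f i} else {})" for i
    have dU: "dist x y \<le> M / real (grid k)" if "x \<in> U i" "y \<in> U i" for x y i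
      unfolding M_def by (rule dist_same_cell) (use that in \<open>auto simp: U_def split: if_splits\<close>)
    have "0 \<le> M / real (grid k)" using M by simp
    note U = diameter_le_bound[OF dU this]
    have "A \<subseteq> (\<Union>i. U i)"
    proof
      fix x assume x: "x \<in> A"
      have "cell k x \<in> C"
        unfolding C_def mem_Collect_eq
      proof
        fix j
        have "0 \<le> x $ j" "x $ j \<le> 1" using A x by (auto simp: mem_box_cart)
        then have "0 \<le> real (grid k) * x $ j" "real (grid k) * x $ j \<le> real (grid k)"
          by (simp_all add: mult_left_le)
        then show "cell k x $ j \<in> {0..int (grid k)}"
          using floor_mono[of "real (grid k) * x $ j" "real (grid k)"] by (simp add: cell_def)
      qed
      then have "cell k x \<in> f ` {..<card C}" using f by (simp add: bij_betw_def)
      then obtain i where "i < card C" "f i = cell k x" by auto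
      then have "x \<in> U i" using x by (simp add: U_def)
      then show "x \<in> (\<Union>i. U i)" by blast
    qed
    then have "hausdorff_premeasure s \<delta> A \<le> (\<Sum>i. diam_pow s (U i))"
      unfolding hausdorff_premeasure_def using U(1) order_trans[OF U(2) k]
      by (intro INF_lower CollectI conjI allI)
    also have "\<dots> = (\<Sum>i<card C. diam_pow s (U i))"
      by (rule suminf_finite) (auto simp: U_def diam_pow_def)
    also have "\<dots> \<le> (\<Sum>i<card C. ennreal ((M / real (grid k)) powr s))"
    proof (rule sum_mono)
      fix i
      have "diameter (U i) powr s \<le> (M / real (grid k)) powr s"
        using U diameter_ge_0[OF U(1)] s M by (intro powr_mono2) (auto simp: M_def)
      then show "diam_pow s (U i) \<le> ennreal ((M / real (grid k)) powr s)"
        using s M by (auto simp: diam_pow_def M_def)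
    qed
    also have "\<dots> = ennreal (real (card C) * (M / real (grid k)) powr s)"
      by (simp add: ennreal_mult' ennreal_of_nat_eq_real_of_nat)
    also have "\<dots> \<le> ennreal (b k)"
    proof (intro ennreal_leI)
      have "grid k \<ge> 1" by (simp add: Suc_leI)
      then have "real (card C) \<le> (2 * real (grid k)) ^ CARD('m)"
        unfolding C(2) of_nat_power by (intro power_mono) simp_all
      then show "real (card C) * (M / real (grid k)) powr s \<le> b k"
        unfolding b_def by (rule mult_right_mono) simp
    qed
    finally show ?thesis .
  qed
  have gr: "filterlim (\<lambda>k. real (grid k)) at_top sequentially"
    by (rule filterlim_at_top_mono[OF filterlim_real_sequentially]) (rule always_eventually, rule allI, rule grid_ge)
  have "b = (\<lambda>k. 2 ^ CARD('m) * M powr s * real (grid k) powr (M - s))"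
    by (simp add: fun_eq_iff b_def M_def power_mult_distrib powr_divide powr_diff powr_realpow)
  moreover have "(\<lambda>k. 2 ^ CARD('m) * M powr s * real (grid k) powr (M - s)) \<longlonglongrightarrow> 2 ^ CARD('m) * M powr s * 0"
    using s by (intro tendsto_intros tendsto_neg_powr gr) (simp add: M_def)
  ultimately have "b \<longlonglongrightarrow> 0" by simp
  then have b: "(\<lambda>k. ennreal (b k)) \<longlonglongrightarrow> 0" by (metis ennreal_0 tendsto_ennrealI)
  have "hausdorff_premeasure s \<delta> A \<le> 0" if "\<delta> > 0" for \<delta>
  proof (rule tendsto_lowerbound[OF b])
    have "(\<lambda>k. M / real (grid k)) \<longlonglongrightarrow> 0"
      by (rule tendsto_divide_0[OF tendsto_const filterlim_at_top_imp_at_infinity[OF gr]])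
    then have "\<forall>\<^sub>F k in sequentially. M / real (grid k) < \<delta>" using that by (rule order_tendstoD)
    then show "\<forall>\<^sub>F k in sequentially. hausdorff_premeasure s \<delta> A \<le> ennreal (b k)"
      by eventually_elim (rule prem, simp)
  qed simp
  then have "hausdorff_measure s A \<le> 0"
    unfolding hausdorff_measure_def by (intro SUP_least) auto
  then show ?thesis by simp
qed

text \<open>Allows a set of diameter \<open>D\<close>, possibly 0, to be replaced by an open ball of
  larger radius at arbitrarily small cost.\<close>

lemma powr_right_continuous_bound:
  fixes D s e :: real
  assumes "0 \<le> D" "0 < s" "0 < e"
  shows "\<exists>r>D. r powr s \<le> D powr s + e"
proof (cases "D = 0")
  case True
  have "(e powr (1 / s)) powr s = e" using assms by (simp add: powr_powr)
  then show ?thesis using True assms by (intro exI[of _ "e powr (1 / s)"]) simp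
next
  case False
  then have "isCont (\<lambda>r. r powr s) D" by (intro continuous_intros) auto
  then have "((\<lambda>r. r powr s) \<longlongrightarrow> D powr s) (at_right D)"
    by (meson filterlim_at_split isContD)
  then have "\<forall>\<^sub>F r in at_right D. r powr s < D powr s + e"
    using assms by (intro order_tendstoD) auto
  moreover have "\<forall>\<^sub>F r in at_right D. r > D" by (simp add: eventually_at_right_less)
  ultimately have "\<forall>\<^sub>F r in at_right D. r > D \<and> r powr s < D powr s + e"
    by eventually_elim simp
  then obtain r where "r > D" "r powr s < D powr s + e"
    using eventually_happens'[OF trivial_limit_at_right_real] by blast
  then show ?thesis by (intro exI[of _ r]) auto
qed

text \<open>Otherwise some cover with diameters at most 1 has sum below \<open>c / 2\<close>.
  Enlarging its members to open balls costs at most another \<open>c / 2\<close>, and a finite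
  subcover contradicts the content bound.\<close>

lemma hausdorff_measure_nonzero:
  fixes E :: "'a::metric_space set"
  assumes E: "compact E" and content: "ball_content_ge s c E" and c: "c > 0" and s: "0 \<le> s'" "s' \<le> s" "0 < s"
  shows "hausdorff_measure s' E \<noteq> 0"
proof
  assume "hausdorff_measure s' E = 0"
  then have "hausdorff_premeasure s' 1 E \<le> 0"
    unfolding hausdorff_measure_def by (metis SUP_upper greaterThan_iff zero_less_one)
  then have "hausdorff_premeasure s' 1 E < ennreal (c / 2)" using c by simp
  then obtain U where U: "E \<subseteq> (\<Union>i. U i)" "\<And>i. bounded (U i)" "\<And>i::nat. diameter (U i) \<le> 1"
    "(\<Sum>i. diam_pow s' (U i)) < ennreal (c / 2)"
    unfolding hausdorff_premeasure_def INF_less_iff by auto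
  define D where "D i = diameter (U i)" for i
  have D: "0 \<le> D i" "D i \<le> 1" for i using U diameter_ge_0 by (auto simp: D_def)
  \<comment> \<open>For \<open>s' = 0\<close> the right side is 1 on nonempty sets; on the empty set
    both sides vanish.\<close>
  have Dpow: "ennreal (D i powr s) \<le> diam_pow s' (U i)" for i
  proof -
    have "D i powr s \<le> 1" using D s by (intro powr_le1) auto
    moreover have "D i powr s \<le> D i powr s'" using D[of i] s by (intro powr_mono') auto
    ultimately show ?thesis by (auto simp: diam_pow_def D_def ennreal_le_1 intro: ennreal_leI)
  qed
  have "\<exists>r>D i. r powr s \<le> D i powr s + c / 2 * (1 / 2) ^ Suc i" for i
    by (rule powr_right_continuous_bound) (use D s c in auto)
  then obtain r where r: "\<And>i. r i > D i" "\<And>i. r i powr s \<le> D i powr s + c / 2 * (1 / 2) ^ Suc i" by metis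
  \<comment> \<open>An arbitrary point when \<open>U i\<close> is empty, where the inclusion below
    is trivial.\<close>
  define x where "x i = (SOME x. x \<in> U i)" for i
  have sub: "U i \<subseteq> ball (x i) (r i)" for i
  proof
    fix z assume z: "z \<in> U i"
    then have "x i \<in> U i" unfolding x_def by (rule someI)
    then have "dist (x i) z \<le> D i" unfolding D_def using z U(2) by (intro diameter_bounded_bound)
    then show "z \<in> ball (x i) (r i)" using r(1)[of i] by simp
  qed
  have "E \<subseteq> (\<Union>i. ball (x i) (r i))"
    using U(1) by (rule subset_trans) (intro UN_mono sub order_refl)
  then obtain I where I: "finite I" "E \<subseteq> (\<Union>i\<in>I. ball (x i) (r i))"
    using compactE_image[OF E, of UNIV "\<lambda>i. ball (x i) (r i)"] by auto
  define C where "C = (\<lambda>i. (x i, r i)) ` I"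
  have pos: "0 < r i" for i using r(1)[of i] D(1)[of i] by linarith
  have "c \<le> (\<Sum>(x, r)\<in>C. r powr s)"
    using content I pos unfolding ball_content_ge_def by (auto simp: C_def)
  \<comment> \<open>Only an inequality, since different indices may give the same ball.\<close>
  also have "\<dots> \<le> (\<Sum>i\<in>I. case (x i, r i) of (x, r) \<Rightarrow> r powr s)"
    unfolding C_def by (rule sum_image_le[OF I(1), unfolded comp_def]) (auto split: prod.split)
  also have "\<dots> \<le> (\<Sum>i\<in>I. D i powr s) + (\<Sum>i\<in>I. c / 2 * (1 / 2) ^ Suc i)"
    unfolding sum.distrib[symmetric] by (rule sum_mono) (use r(2) in simp)
  also have "(\<Sum>i\<in>I. c / 2 * (1 / 2) ^ Suc i) \<le> c / 2"
  proof -
    have sums: "(\<lambda>i. c / 2 * (1 / 2) ^ Suc i) sums (c / 2 * 1)"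
      by (intro sums_mult power_half_series)
    have "(\<Sum>i\<in>I. c / 2 * (1 / 2) ^ Suc i) \<le> (\<Sum>i. c / 2 * (1 / 2) ^ Suc i)"
      by (rule sum_le_suminf) (use sums I c in \<open>auto simp: sums_iff\<close>)
    also have "\<dots> = c / 2" using sums_unique[OF sums] by simp
    finally show ?thesis .
  qed
  also have "(\<Sum>i\<in>I. D i powr s) < c / 2"
  proof -
    have "ennreal (\<Sum>i\<in>I. D i powr s) = (\<Sum>i\<in>I. ennreal (D i powr s))" by simp
    also have "\<dots> \<le> (\<Sum>i\<in>I. diam_pow s' (U i))" by (rule sum_mono) (rule Dpow)
    also have "\<dots> \<le> (\<Sum>i. diam_pow s' (U i))" using I by (intro sum_le_suminf) auto
    also have "\<dots> < ennreal (c / 2)" by (rule U(4))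
    finally show ?thesis using c by (simp add: ennreal_less_iff sum_nonneg)
  qed
  finally show False by simp
qed

text \<open>The content bounds exclude every exponent below \<open>m\<close>. The offset 2 keeps the
  exponents \<open>m - 1 / (j + 2)\<close> positive even for \<open>m = 1\<close>.\<close>

lemma hausdorff_dim_full:
  fixes E :: "(real ^ 'm::finite) set"
  assumes E: "compact E" "E \<subseteq> cbox 0 1"
    and content: "\<And>j. ball_content_ge (real CARD('m) - 1 / (real j + 2)) (c j) E" and c: "\<And>j. c j > 0"
  shows "hausdorff_dim E = ereal (real CARD('m))"
proof -
  have "E \<noteq> {}"
  proof
    assume "E = {}"
    then have "c 0 \<le> 0" using content[of 0] unfolding ball_content_ge_def by (auto dest: spec[of _ "{}"])
    with c[of 0] show False by simp
  qed
  have ge: "real CARD('m) \<le> s" if s: "0 \<le> s" "hausdorff_measure s E = 0" for s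
  proof (rule ccontr)
    assume "\<not> real CARD('m) \<le> s"
    then obtain j :: nat where "1 / (real CARD('m) - s) < real j"
      using reals_Archimedean2 by blast
    moreover have "real CARD('m) - s > 0" using \<open>\<not> real CARD('m) \<le> s\<close> by simp
    ultimately have "1 < (real CARD('m) - s) * (real j + 2)"
      by (simp add: field_simps)
    then have s_le: "s \<le> real CARD('m) - 1 / (real j + 2)" by (simp add: field_simps)
    have "CARD('m) \<ge> 1" by (simp add: Suc_leI)
    then have "1 \<le> real CARD('m)" by simp
    moreover have "1 / (real j + 2) \<le> 1 / 2" by (simp add: field_simps)
    ultimately have "real CARD('m) - 1 / (real j + 2) > 0" by linarith
    with s_le show False
      using hausdorff_measure_nonzero[OF E(1) content c s(1)] s(2) by blast
  qed
  have "(INF s \<in> {s. 0 \<le> s \<and> hausdorff_measure s E = 0}. ereal s) = ereal (real CARD('m))"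
  proof (rule antisym)
    show "ereal (real CARD('m)) \<le> (INF s \<in> {s. 0 \<le> s \<and> hausdorff_measure s E = 0}. ereal s)"
      using ge by (intro INF_greatest) auto
    have "(INF s \<in> {s. 0 \<le> s \<and> hausdorff_measure s E = 0}. ereal s) \<le> ereal (real CARD('m)) + ereal e" if "e > 0" for e
    proof -
      have "hausdorff_measure (real CARD('m) + e) E = 0"
        using that by (intro hausdorff_measure_unit_zero E) simp
      then show ?thesis using that by (auto intro!: INF_lower2[of "real CARD('m) + e"])
    qed
    then show "(INF s \<in> {s. 0 \<le> s \<and> hausdorff_measure s E = 0}. ereal s) \<le> ereal (real CARD('m))"
      by (rule ereal_le_epsilon2)
  qed
  with \<open>E \<noteq> {}\<close> show ?thesis by (simp add: hausdorff_dim_def)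
qed

section \<open>The good maps form a Borel set\<close>

lemma cube_preimage_eq:
  "cube_preimage f S = {x \<in> cbox 0 1. apply_bcontfun f (Abs_cube x) \<in> S}"
proof safe
  fix x assume "x \<in> cube_preimage f S"
  then obtain z where z: "x = Rep_cube z" "apply_bcontfun f z \<in> S" by (auto simp: cube_preimage_def)
  then show "x \<in> cbox 0 1" "apply_bcontfun f (Abs_cube x) \<in> S"
    using Rep_cube[of z] by (simp_all add: Rep_cube_inverse)
next
  fix x :: "real ^ 'a" assume "x \<in> cbox 0 1" "apply_bcontfun f (Abs_cube x) \<in> S"
  then show "x \<in> cube_preimage f S"
    unfolding cube_preimage_def by (intro image_eqI[of _ _ "Abs_cube x"]) (simp_all add: Abs_cube_inverse)
qed

lemma continuous_on_cube_function:
  "continuous_on (cbox 0 1) (\<lambda>x. apply_bcontfun f (Abs_cube x))"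
proof -
  have "continuous_on (cbox 0 (1 :: real ^ 'a)) Abs_cube"
    by (auto simp: continuous_on_iff dist_cube_def Abs_cube_inverse)
  then show ?thesis
    by (rule continuous_on_compose2[OF continuous_on_apply_bcontfun[of UNIV]]) simp
qed

lemma cube_preimage_borel:
  assumes "S \<in> sets borel"
  shows "cube_preimage f S \<in> sets borel"
proof -
  have "(\<lambda>x. apply_bcontfun f (Abs_cube x)) \<in> borel_measurable (restrict_space borel (cbox 0 1))"
    by (rule borel_measurable_continuous_on_restrict[OF continuous_on_cube_function])
  from measurable_sets[OF this assms]
  have "(\<lambda>x. apply_bcontfun f (Abs_cube x)) -` S \<inter> cbox 0 1 \<in> sets (restrict_space borel (cbox 0 1))"
    by (simp add: space_restrict_space)
  then have "(\<lambda>x. apply_bcontfun f (Abs_cube x)) -` S \<inter> cbox 0 1 \<in> sets borel"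
    by (simp add: sets_restrict_space_iff)
  moreover have "(\<lambda>x. apply_bcontfun f (Abs_cube x)) -` S \<inter> cbox 0 1 = cube_preimage f S"
    by (auto simp: cube_preimage_eq)
  ultimately show ?thesis by simp
qed

lemma compact_cube_fibre: "compact (cube_preimage f {y})"
proof -
  have "closed (apply_bcontfun f -` {y})"
    by (intro closed_vimage continuous_on_apply_bcontfun) simp
  then have "compact (UNIV \<inter> apply_bcontfun f -` {y})"
    by (rule compact_Int_closed[OF compact_UNIV_cube])
  then show ?thesis
    unfolding cube_preimage_def by (intro compact_continuous_image continuous_on_Rep_cube) simp
qed

lemma cube_preimage_subset: "cube_preimage f S \<subseteq> cbox 0 1"
  by (auto simp: cube_preimage_eq)

lemma cube_preimage_mono: "S \<subseteq> S' \<Longrightarrow> cube_preimage f S \<subseteq> cube_preimage f S'"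
  by (auto simp: cube_preimage_def)

lemma cube_preimage_fmeasurable:
  assumes "S \<in> sets borel"
  shows "cube_preimage f S \<in> fmeasurable lborel"
  by (rule fmeasurableI2[OF fmeasurable_cbox cube_preimage_subset])
     (simp add: cube_preimage_borel assms)

text \<open>A finite cover of the fibre by open balls also covers the fibres of all nearby maps, so
  the failure of the bound is an open condition.\<close>

lemma closed_content_set:
  "closed {f :: 'm::finite cube \<Rightarrow>\<^sub>C (real ^ 'd::finite). ball_content_ge s c (cube_preimage f {y})}"
  unfolding closed_def
proof (rule openI)
  fix f :: "'m cube \<Rightarrow>\<^sub>C (real ^ 'd)"
  assume "f \<in> - {f. ball_content_ge s c (cube_preimage f {y})}"
  then obtain C where C: "finite C" "\<forall>(x, r)\<in>C. 0 < r" "cube_preimage f {y} \<subseteq> (\<Union>(x, r)\<in>C. ball x r)"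
    "(\<Sum>(x, r)\<in>C. r powr s) < c"
    by (auto simp: ball_content_ge_def not_le)
  have "open (\<Union>(x, r)\<in>C. ball x r)" by (auto simp: case_prod_unfold)
  moreover have "{x \<in> cbox 0 1. apply_bcontfun f (Abs_cube x) = y} \<subseteq> (\<Union>(x, r)\<in>C. ball x r)"
    using C(3) by (simp add: cube_preimage_eq)
  ultimately have "\<exists>e>0. \<forall>x\<in>cbox 0 1. dist (apply_bcontfun f (Abs_cube x)) y < e \<longrightarrow> x \<in> (\<Union>(x, r)\<in>C. ball x r)"
    by (rule fibre_neighbourhood[OF compact_cbox continuous_on_cube_function])
  then obtain e where e: "e > 0"
    "\<And>x. x \<in> cbox 0 1 \<Longrightarrow> dist (apply_bcontfun f (Abs_cube x)) y < e \<Longrightarrow> x \<in> (\<Union>(x, r)\<in>C. ball x r)" by blast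
  show "\<exists>e>0. ball f e \<subseteq> - {f. ball_content_ge s c (cube_preimage f {y})}"
  proof (intro exI[of _ e] conjI e(1) subsetI)
    fix f' assume f': "f' \<in> ball f e"
    have "cube_preimage f' {y} \<subseteq> (\<Union>(x, r)\<in>C. ball x r)"
    proof
      fix x assume "x \<in> cube_preimage f' {y}"
      then have x: "x \<in> cbox 0 1" "apply_bcontfun f' (Abs_cube x) = y" by (auto simp: cube_preimage_eq)
      have "dist (apply_bcontfun f (Abs_cube x)) (apply_bcontfun f' (Abs_cube x)) \<le> dist f f'"
        by (rule dist_bounded)
      with f' have "dist (apply_bcontfun f (Abs_cube x)) y < e" unfolding x(2) by simp
      then show "x \<in> (\<Union>(x, r)\<in>C. ball x r)" by (rule e(2)[OF x(1)])
    qed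
    then have "\<not> ball_content_ge s c (cube_preimage f' {y})"
      using C unfolding ball_content_ge_def not_all not_imp not_le by blast
    then show "f' \<in> - {f. ball_content_ge s c (cube_preimage f {y})}" by simp
  qed
qed

text \<open>Exhaust \<open>S\<close> by the closed sets \<open>A n\<close> of points at depth
  \<open>1 / (n + 1)\<close>. For some \<open>n\<close> the preimage of \<open>A n\<close> already
  exceeds \<open>t\<close>, and every map closer than that depth sends it into
  \<open>S\<close>.\<close>

lemma open_measure_set:
  assumes S: "open S"
  shows "open {f :: 'm::finite cube \<Rightarrow>\<^sub>C (real ^ 'd::finite). measure lborel (cube_preimage f S) > t}"
proof (rule openI)
  fix f :: "'m cube \<Rightarrow>\<^sub>C (real ^ 'd)"
  assume "f \<in> {f. measure lborel (cube_preimage f S) > t}"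
  then have f: "measure lborel (cube_preimage f S) > t" by simp
  define A where "A n = {z. ball z (1 / real (Suc n)) \<subseteq> S}" for n
  have A_closed: "closed (A n)" for n
  proof -
    have "- A n = (\<Union>w\<in>- S. ball w (1 / real (Suc n)))"
      by (auto simp: A_def dist_commute)
    then have "open (- A n)" by (simp only: open_UN open_ball ball_simps) auto
    then show ?thesis by (simp add: closed_def)
  qed
  have A_inc: "incseq A"
  proof (rule incseq_SucI)
    fix n
    have "1 / real (Suc (Suc n)) \<le> 1 / real (Suc n)" by (intro divide_left_mono) auto
    then show "A n \<subseteq> A (Suc n)" unfolding A_def using subset_ball by blast
  qed
  have A_UN: "(\<Union>n. A n) = S"
  proof safe
    fix z n assume "z \<in> A n"
    then show "z \<in> S" unfolding A_def by auto
  next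
    fix z assume "z \<in> S"
    then obtain e where e: "e > 0" "ball z e \<subseteq> S" using S by (auto simp: open_contains_ball)
    then obtain n where "1 / real (Suc n) < e" using nat_approx_posE by blast
    then have "ball z (1 / real (Suc n)) \<subseteq> S" using e subset_ball[of "1 / real (Suc n)" e z] by auto
    then show "z \<in> (\<Union>n. A n)" by (auto simp: A_def)
  qed
  have "(\<lambda>n. measure lborel (cube_preimage f (A n))) \<longlonglongrightarrow> measure lborel (\<Union>n. cube_preimage f (A n))"
  proof (rule Lim_measure_incseq)
    show "range (\<lambda>n. cube_preimage f (A n)) \<subseteq> sets lborel"
      using A_closed by (auto intro!: cube_preimage_borel)
    show "incseq (\<lambda>n. cube_preimage f (A n))"
      using A_inc by (auto simp: incseq_def intro!: cube_preimage_mono)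
    show "emeasure lborel (\<Union>n. cube_preimage f (A n)) \<noteq> \<infinity>"
    proof -
      have "emeasure lborel (\<Union>n. cube_preimage f (A n)) \<le> emeasure lborel (cbox 0 1 :: (real ^ 'm) set)"
        using cube_preimage_subset[of f] by (intro emeasure_mono) auto
      also have "\<dots> < \<infinity>" by (simp add: emeasure_lborel_cbox_eq)
      finally show ?thesis by simp
    qed
  qed
  moreover have "(\<Union>n. cube_preimage f (A n)) = cube_preimage f S"
    unfolding A_UN[symmetric] by (auto simp: cube_preimage_def)
  ultimately have "\<forall>\<^sub>F n in sequentially. t < measure lborel (cube_preimage f (A n))"
    using f by (auto intro: order_tendstoD)
  then obtain n where n: "t < measure lborel (cube_preimage f (A n))"
    by (auto simp: eventually_sequentially)
  show "\<exists>e>0. ball f e \<subseteq> {f. measure lborel (cube_preimage f S) > t}"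
  proof (intro exI[of _ "1 / real (Suc n)"] conjI subsetI)
    fix f' assume f': "f' \<in> ball f (1 / real (Suc n))"
    have "cube_preimage f (A n) \<subseteq> cube_preimage f' S"
    proof
      fix x assume "x \<in> cube_preimage f (A n)"
      then have x: "x \<in> cbox 0 1" "ball (apply_bcontfun f (Abs_cube x)) (1 / real (Suc n)) \<subseteq> S"
        by (auto simp: cube_preimage_eq A_def)
      have "dist (apply_bcontfun f (Abs_cube x)) (apply_bcontfun f' (Abs_cube x)) \<le> dist f f'"
        by (rule dist_bounded)
      also have "\<dots> < 1 / real (Suc n)" using f' by (simp only: mem_ball)
      finally have "apply_bcontfun f' (Abs_cube x) \<in> S"
        by (intro subsetD[OF x(2)]) (simp only: mem_ball)
      then show "x \<in> cube_preimage f' S" using x(1) by (simp add: cube_preimage_eq)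
    qed
    then have "measure lborel (cube_preimage f (A n)) \<le> measure lborel (cube_preimage f' S)"
      using A_closed S by (intro measure_mono_fmeasurable cube_preimage_fmeasurable) (auto intro!: cube_preimage_borel)
    with n show "f' \<in> {f. measure lborel (cube_preimage f S) > t}" by simp
  qed simp
qed

text \<open>Every neighbourhood of a point of the cube has positive measure within the cube, so it
  meets a preimage of full measure.\<close>

lemma range_subset_closure:
  fixes f :: "'m::finite cube \<Rightarrow>\<^sub>C (real ^ 'd::finite)"
  assumes S: "open S" and full: "measure lborel (cube_preimage f S) = 1"
  shows "range (apply_bcontfun f) \<subseteq> closure (S \<inter> range (apply_bcontfun f))"
proof
  fix y assume "y \<in> range (apply_bcontfun f)"
  then obtain z where z: "y = apply_bcontfun f z" by auto
  show "y \<in> closure (S \<inter> range (apply_bcontfun f))"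
    unfolding closure_approachable
  proof (intro allI impI)
    fix e :: real assume e: "e > 0"
    let ?F = "\<lambda>x. apply_bcontfun f (Abs_cube x)"
    define p where "p = Rep_cube z"
    have p: "p \<in> cbox 0 1" "Abs_cube p = z" using Rep_cube[of z] by (simp_all add: p_def Rep_cube_inverse)
    obtain r where r: "r > 0" "\<And>x. x \<in> cbox 0 1 \<Longrightarrow> dist x p < r \<Longrightarrow> dist (?F x) (?F p) < e"
      using continuous_on_cube_function[of f] p(1) e unfolding continuous_on_iff by blast
    \<comment> \<open>\<open>p\<close> may lie on the boundary; a nearby interior point shows that
      \<open>?O\<close> is nonempty.\<close>
    have "p \<in> closure (box 0 1)" using p(1) by (subst closure_box) (simp_all add: interval_ne_empty_cart)
    then obtain q where q: "q \<in> box 0 1" "dist q p < r" using r(1) unfolding closure_approachable by blast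
    let ?O = "box 0 1 \<inter> ball p r"
    have "q \<in> ?O" using q by (simp add: dist_commute)
    then have ne: "?O \<noteq> {}" "open ?O" by auto
    have "?O \<inter> cube_preimage f S \<noteq> {}"
    proof
      assume disj: "?O \<inter> cube_preimage f S = {}"
      have O_fm: "?O \<in> fmeasurable lborel"
      proof (rule fmeasurableI2[OF fmeasurable_cbox])
        show "?O \<subseteq> cbox 0 1" using box_subset_cbox by blast
      qed simp
      note S_fm = cube_preimage_fmeasurable[OF borel_open[OF S], of f]
      have "?O \<notin> null_sets lborel" 
        using open_not_negligible[OF ne(2,1)] null_sets_completionI negligible_iff_null_sets by blast
      then have "emeasure lborel ?O \<noteq> 0" by (simp add: null_sets_def)
      then have "measure lborel ?O > 0"
        using O_fm by (simp add: emeasure_eq_measure2 zero_less_measure_iff)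
      moreover have "measure lborel (?O \<union> cube_preimage f S) = measure lborel ?O + measure lborel (cube_preimage f S)"
        using disj O_fm S_fm by (intro measure_Union) (auto simp: fmeasurable_def)
      moreover have "measure lborel (?O \<union> cube_preimage f S) \<le> measure lborel (cbox 0 1 :: (real ^ 'm) set)"
      proof (rule measure_mono_fmeasurable[OF _ _ fmeasurable_cbox])
        show "?O \<union> cube_preimage f S \<subseteq> cbox 0 1"
          using cube_preimage_subset[of f S] box_subset_cbox by blast
        show "?O \<union> cube_preimage f S \<in> sets lborel" using O_fm S_fm by auto
      qed
      ultimately show False using full measure_unit_cube[where 'm='m] by simp
    qed
    then obtain x where x: "x \<in> ?O" "x \<in> cube_preimage f S" by blast
    then have "?F x \<in> S" "x \<in> cbox 0 1" by (auto simp: cube_preimage_eq)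
    moreover have "dist (?F x) y < e"
      using r(2)[of x] x \<open>x \<in> cbox 0 1\<close> by (simp add: p z dist_commute)
    ultimately show "\<exists>w\<in>S \<inter> range (apply_bcontfun f). dist w y < e" by blast
  qed
qed

text \<open>A countable family of open cubes. Those of scale \<open>n\<close>, of side
  \<open>2 / 2 ^ n\<close>, overlap so much that every point is within half a unit
  \<open>2 ^ - n\<close> of some centre in each coordinate.\<close>

definition target_box :: "nat \<times> (int ^ 'd::finite) \<Rightarrow> (real ^ 'd) set" where
  "target_box p = {y. \<forall>i. \<bar>2 ^ fst p * y $ i - of_int (snd p $ i)\<bar> < 1}"

lemma open_target_box: "open (target_box p)"
proof -
  have "target_box p = (\<Inter>i\<in>UNIV. {y. \<bar>2 ^ fst p * y $ i - of_int (snd p $ i)\<bar> < 1})"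
    by (auto simp: target_box_def)
  also have "open \<dots>" by (intro open_INT ballI finite open_Collect_less continuous_intros)
  finally show ?thesis .
qed

text \<open>With the constants fixed beforehand, fullness over a whole box is an intersection of
  closed conditions, even over uncountably many \<open>y\<close>.\<close>

definition box_full :: "(nat \<Rightarrow> nat \<Rightarrow> real) \<Rightarrow> nat \<times> (int ^ 'd::finite) \<Rightarrow> ('m::finite cube \<Rightarrow>\<^sub>C (real ^ 'd)) set" where
  "box_full c p = {f. \<forall>y\<in>target_box p. \<forall>j. ball_content_ge (real CARD('m) - 1 / (real j + 2)) (c (fst p) j) (cube_preimage f {y})}"

lemma closed_box_full: "closed (box_full c p :: ('m::finite cube \<Rightarrow>\<^sub>C (real ^ 'd::finite)) set)"
proof -
  have "box_full c p = (\<Inter>y\<in>target_box p. \<Inter>j. {f :: 'm cube \<Rightarrow>\<^sub>C (real ^ 'd). ball_content_ge (real CARD('m) - 1 / (real j + 2)) (c (fst p) j) (cube_preimage f {y})})"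
    by (auto simp: box_full_def)
  also have "closed \<dots>" by (intro closed_INT ballI closed_content_set)
  finally show ?thesis .
qed

text \<open>Only finite families of boxes enter, and there are countably many of them. This makes
  the set Borel, while the families may vary with \<open>t\<close>.\<close>

definition good_maps :: "(nat \<Rightarrow> nat \<Rightarrow> real) \<Rightarrow> ('m::finite cube \<Rightarrow>\<^sub>C (real ^ 'd::finite)) set" where
  "good_maps c = (\<Inter>t::nat. \<Union>I\<in>{I. finite I}. (\<Inter>p\<in>I. box_full c p) \<inter>
     {f. measure lborel (cube_preimage f (\<Union>p\<in>I. target_box p)) > 1 - 1 / real (Suc t)})"

lemma good_maps_borel: "good_maps c \<in> sets borel"
proof -
  have "(\<Inter>p\<in>I. box_full c p) \<inter> {f. measure lborel (cube_preimage f (\<Union>p\<in>I. target_box p)) > 1 - 1 / real (Suc t)} \<in> sets borel"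
    for I and t :: nat
  proof (rule sets.Int)
    show "(\<Inter>p\<in>I. box_full c p) \<in> sets borel" by (intro borel_closed closed_INT ballI closed_box_full)
    show "{f. measure lborel (cube_preimage f (\<Union>p\<in>I. target_box p)) > 1 - 1 / real (Suc t)} \<in> sets borel"
      by (intro borel_open open_measure_set open_UN ballI open_target_box)
  qed
  then show ?thesis
    unfolding good_maps_def
    by (intro sets.countable_INT'' sets.countable_UN'' countable_Collect_finite) auto
qed

lemma measure_cube_preimage_le_1:
  "open S \<Longrightarrow> measure lborel (cube_preimage f S) \<le> 1"
  using measure_mono_fmeasurable[OF cube_preimage_subset _ fmeasurable_cbox, of f S]
  by (simp add: cube_preimage_borel borel_open measure_unit_cube)

text \<open>The open set is the union of all boxes over which \<open>f\<close> is full; it contains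
  each of the finite unions, so its preimage has measure above \<open>1 - 1 / (t + 1)\<close> for
  every \<open>t\<close>.\<close>

lemma good_maps_full:
  fixes f :: "'m::finite cube \<Rightarrow>\<^sub>C (real ^ 'd::finite)"
  assumes f: "f \<in> good_maps c" and c: "\<And>n j. c n j > 0"
  shows "\<exists>U. open U \<and> emeasure lebesgue (cube_preimage f U) = 1 \<and>
       range (apply_bcontfun f) \<subseteq> closure (U \<inter> range (apply_bcontfun f)) \<and>
       (\<forall>y\<in>U. hausdorff_dim (cube_preimage f {y}) = ereal (real CARD('m)))"
proof -
  define U where "U = (\<Union>p\<in>{p. f \<in> box_full c p}. target_box p)"
  have U: "open U" unfolding U_def by (intro open_UN ballI open_target_box)
  have "measure lborel (cube_preimage f U) > 1 - 1 / real (Suc t)" for t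
  proof -
    obtain I where I: "f \<in> (\<Inter>p\<in>I. box_full c p)" "measure lborel (cube_preimage f (\<Union>p\<in>I. target_box p)) > 1 - 1 / real (Suc t)"
      using f unfolding good_maps_def by blast
    have "open (\<Union>p\<in>I. target_box p)" by (intro open_UN ballI open_target_box)
    then have "measure lborel (cube_preimage f (\<Union>p\<in>I. target_box p)) \<le> measure lborel (cube_preimage f U)"
      using I(1) U by (intro measure_mono_fmeasurable cube_preimage_mono cube_preimage_fmeasurable)
        (auto simp: U_def cube_preimage_borel borel_open)
    with I(2) show ?thesis by linarith
  qed
  then have "1 \<le> measure lborel (cube_preimage f U) + e" if "e > 0" for e
    using nat_approx_posE[OF that] by (smt (verit))
  then have "1 \<le> measure lborel (cube_preimage f U)" by (rule field_le_epsilon)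
  with measure_cube_preimage_le_1[OF U, of f] have m: "measure lborel (cube_preimage f U) = 1" by simp
  have "emeasure lborel (cube_preimage f U) = 1"
    using cube_preimage_fmeasurable[OF borel_open[OF U], of f] m by (simp add: emeasure_eq_measure2)
  then have "emeasure lebesgue (cube_preimage f U) = 1"
    using cube_preimage_borel[OF borel_open[OF U], of f] by (simp add: emeasure_completion)
  moreover have "hausdorff_dim (cube_preimage f {y}) = ereal (real CARD('m))" if "y \<in> U" for y
  proof -
    from that obtain p where p: "f \<in> box_full c p" "y \<in> target_box p" by (auto simp: U_def)
    show ?thesis
      by (rule hausdorff_dim_full[where c = "c (fst p)", OF compact_cube_fibre cube_preimage_subset])
         (use p c in \<open>auto simp: box_full_def\<close>)
  qed
  ultimately show ?thesis using U range_subset_closure[OF U m] by blast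
qed

text \<open>Enumerating the boxes gives finite families whose preimages increase to almost all of
  the cube; continuity from below does the rest.\<close>

lemma good_mapsI:
  fixes f :: "'m::finite cube \<Rightarrow>\<^sub>C (real ^ 'd::finite)"
  assumes ae: "AE x in lborel. x \<in> cbox 0 1 \<longrightarrow> (\<exists>p. apply_bcontfun f (Abs_cube x) \<in> target_box p \<and> f \<in> box_full c p)"
  shows "f \<in> good_maps c"
proof -
  define I where "I t = {p. f \<in> box_full c p \<and> to_nat p \<le> t}" for t
  have I_fin: "finite (I t)" for t
  proof (rule finite_subset)
    show "I t \<subseteq> to_nat -` {..t}" by (auto simp: I_def)
    show "finite ((to_nat :: nat \<times> (int ^ 'd) \<Rightarrow> nat) -` {..t})" by (intro finite_vimageI) auto
  qed
  define V where "V t = (\<Union>p\<in>I t. target_box p)" for t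
  have V: "open (V t)" for t unfolding V_def by (intro open_UN ballI open_target_box)
  have "(\<lambda>t. measure lborel (cube_preimage f (V t))) \<longlonglongrightarrow> measure lborel (\<Union>t. cube_preimage f (V t))"
  proof (rule Lim_measure_incseq)
    show "range (\<lambda>t. cube_preimage f (V t)) \<subseteq> sets lborel" using cube_preimage_borel[OF borel_open[OF V]] by auto
    show "incseq (\<lambda>t. cube_preimage f (V t))"
      by (auto simp: incseq_def V_def I_def cube_preimage_def intro: order_trans)
    have "emeasure lborel (\<Union>t. cube_preimage f (V t)) \<le> emeasure lborel (cbox 0 1 :: (real ^ 'm) set)"
      using cube_preimage_subset[of f] by (intro emeasure_mono) auto
    also have "\<dots> < \<infinity>" by (simp add: emeasure_lborel_cbox_eq)
    finally show "emeasure lborel (\<Union>t. cube_preimage f (V t)) \<noteq> \<infinity>" by simp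
  qed
  moreover have "measure lborel (\<Union>t. cube_preimage f (V t)) = measure lborel (cbox 0 1 :: (real ^ 'm) set)"
  proof (rule measure_eq_AE)
    show "AE x in lborel. x \<in> (\<Union>t. cube_preimage f (V t)) \<longleftrightarrow> x \<in> (cbox 0 1 :: (real ^ 'm) set)"
      using ae
    proof eventually_elim
      case (elim x)
      show ?case
      proof
        assume "x \<in> cbox 0 1"
        with elim obtain p where p: "apply_bcontfun f (Abs_cube x) \<in> target_box p" "f \<in> box_full c p" by blast
        then have "p \<in> I (to_nat p)" by (simp add: I_def)
        then have "apply_bcontfun f (Abs_cube x) \<in> V (to_nat p)" using p by (auto simp: V_def)
        then show "x \<in> (\<Union>t. cube_preimage f (V t))" using \<open>x \<in> cbox 0 1\<close> by (auto simp: cube_preimage_eq)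
      qed (use cube_preimage_subset[of f] in auto)
    qed
  qed (use cube_preimage_borel[OF borel_open[OF V]] in auto)
  ultimately have lim: "(\<lambda>t. measure lborel (cube_preimage f (V t))) \<longlonglongrightarrow> 1"
    by (simp add: measure_unit_cube)
  show ?thesis
    unfolding good_maps_def
  proof (rule INT_I)
    fix t :: nat
    have "\<forall>\<^sub>F k in sequentially. measure lborel (cube_preimage f (V k)) > 1 - 1 / real (Suc t)"
      by (rule order_tendstoD(1)[OF lim]) simp
    then obtain k where "measure lborel (cube_preimage f (V k)) > 1 - 1 / real (Suc t)"
      by (auto simp: eventually_sequentially)
    then show "f \<in> (\<Union>I\<in>{I. finite I}. (\<Inter>p\<in>I. box_full c p) \<inter>
       {f. measure lborel (cube_preimage f (\<Union>p\<in>I. target_box p)) > 1 - 1 / real (Suc t)})"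
      using I_fin[of k] by (intro UN_I[of "I k"]) (auto simp: V_def I_def)
  qed
qed

section \<open>The random map as an element of the function space\<close>

definition noise_map :: "(nat \<times> (int ^ 'm::finite) \<Rightarrow> int ^ 'd::finite) \<Rightarrow> 'm cube \<Rightarrow>\<^sub>C (real ^ 'd)" where
  "noise_map \<omega> = Bcontfun (\<lambda>z. noise_field \<omega> (Rep_cube z))"

lemma apply_noise_map:
  assumes "\<omega> \<in> space noise"
  shows "apply_bcontfun (noise_map \<omega>) z = noise_field \<omega> (Rep_cube z)"
proof -
  have "continuous_on UNIV (\<lambda>z. noise_field \<omega> (Rep_cube z))"
    by (rule continuous_on_compose2[OF continuous_on_noise_field[OF assms, of UNIV] continuous_on_Rep_cube]) simp
  then show ?thesis
    unfolding noise_map_def by (subst Bcontfun_inverse) (simp_all add: continuous_on_cube_bcontfun)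
qed

text \<open>A limit in supremum norm of partial sums, each of which depends on finitely many
  coordinates of the noise.\<close>

lemma measurable_noise_map: "noise_map \<in> borel_measurable noise"
proof -
  define u :: "nat \<Rightarrow> (nat \<times> (int ^ 'a) \<Rightarrow> int ^ 'b) \<Rightarrow> 'a cube \<Rightarrow>\<^sub>C (real ^ 'b)"
    where "u n \<omega> = Bcontfun (\<lambda>z. \<Sum>k<n. level_field \<omega> (Suc k) (Rep_cube z))" for n \<omega>
  have u: "apply_bcontfun (u n \<omega>) z = (\<Sum>k<n. level_field \<omega> (Suc k) (Rep_cube z))" for n \<omega> z
  proof -
    have "continuous_on UNIV (\<lambda>z. \<Sum>k<n. level_field \<omega> (Suc k) (Rep_cube z))"
      by (intro continuous_on_sum continuous_on_compose2[OF continuous_on_level_field[of UNIV] continuous_on_Rep_cube]) simp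
    then show ?thesis
      unfolding u_def by (subst Bcontfun_inverse) (simp_all add: continuous_on_cube_bcontfun)
  qed
  show ?thesis
  proof (rule borel_measurable_LIMSEQ_metric)
    show "u n \<in> borel_measurable noise" for n
    proof (rule noise_finite_dependence)
      show "finite ((SIGMA k:{..n}. cells k) :: (nat \<times> (int ^ 'a)) set)" by (simp add: finite_cells)
      fix \<omega> \<omega>' :: "nat \<times> (int ^ 'a) \<Rightarrow> int ^ 'b"
      assume eq: "\<And>i. i \<in> (SIGMA k:{..n}. cells k) \<Longrightarrow> \<omega> i = \<omega>' i"
      have "level_field \<omega> (Suc k) = level_field \<omega>' (Suc k)" if "k < n" for k
        by (rule level_field_cong) (use that in \<open>auto intro!: eq\<close>)
      then show "u n \<omega> = u n \<omega>'" by (simp add: u_def)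
    qed simp
  next
    fix \<omega> :: "nat \<times> (int ^ 'a) \<Rightarrow> int ^ 'b" assume \<omega>: "\<omega> \<in> space noise"
    show "(\<lambda>n. u n \<omega>) \<longlonglongrightarrow> noise_map \<omega>"
    proof (rule tendstoI)
      fix e :: real assume e: "e > 0"
      have "\<forall>\<^sub>F n in sequentially. \<forall>x\<in>UNIV. dist (\<Sum>k<n. level_field \<omega> (Suc k) x) (noise_field \<omega> x) < e / 2"
        using uniform_limit_noise_field[OF \<omega>, of UNIV] e unfolding uniform_limit_iff by (meson half_gt_zero)
      then show "\<forall>\<^sub>F n in sequentially. dist (u n \<omega>) (noise_map \<omega>) < e"
      proof eventually_elim
        case (elim n)
        have "dist (u n \<omega>) (noise_map \<omega>) \<le> e / 2"
          by (rule dist_bound) (use elim in \<open>simp add: u apply_noise_map[OF \<omega>] less_imp_le\<close>)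
        with e show ?case by simp
      qed
    qed
  qed
qed

text \<open>Passes from the neighbourhoods of single values in \<open>AE_fibre_content\<close> to
  the countable family of boxes.\<close>

lemma AE_noise_map_good:
  fixes g :: "'m::finite cube \<Rightarrow>\<^sub>C (real ^ 'd::finite)"
  assumes c: "\<And>n j. tree_constant TYPE('m) TYPE('d) (1 / (real j + 2)) n (c n j)"
  shows "AE \<omega> in noise. g + noise_map \<omega> \<in> good_maps c"
  using AE_fibre_content[where \<epsilon> = "\<lambda>j. 1 / (real j + 2)" and c = c, OF continuous_on_cube_function[of g] c] AE_space
proof eventually_elim
  case (elim \<omega>)
  define f where "f = g + noise_map \<omega>"
  have f: "apply_bcontfun f (Abs_cube z) = apply_bcontfun g (Abs_cube z) + noise_field \<omega> z" if "z \<in> cbox 0 1" for z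
    using that by (simp add: f_def plus_bcontfun.rep_eq apply_noise_map[OF elim(2)] Abs_cube_inverse)
  have fibre: "{z \<in> cbox 0 1. apply_bcontfun g (Abs_cube z) + noise_field \<omega> z = y} = cube_preimage f {y}" for y
    unfolding cube_preimage_eq using f by auto
  have "f \<in> good_maps c"
  proof (rule good_mapsI)
    show "AE x in lborel. x \<in> cbox 0 1 \<longrightarrow> (\<exists>p. apply_bcontfun f (Abs_cube x) \<in> target_box p \<and> f \<in> box_full c p)"
      using elim(1)
    proof eventually_elim
      case (elim x)
      show ?case
      proof
        assume x: "x \<in> cbox 0 1"
        define z where "z = apply_bcontfun f (Abs_cube x)"
        obtain n where n: "\<And>y j. (\<And>i. \<bar>y $ i - z $ i\<bar> \<le> 3 / 2 / 2 ^ n) \<Longrightarrow>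
            ball_content_ge (real CARD('m) - 1 / (real j + 2)) (c n j) (cube_preimage f {y})"
          using elim x by (auto simp: fibre f[OF x] z_def)
        \<comment> \<open>In units of \<open>2 ^ - n\<close>, \<open>z\<close> is within
          \<open>1/2\<close> of the centre and every point of the box within 1, hence within
          \<open>3/2\<close> of \<open>z\<close>.\<close>
        define w :: "int ^ 'd" where "w = (\<chi> i. round (2 ^ n * z $ i))"
        have w: "\<bar>2 ^ n * z $ i - of_int (w $ i)\<bar> \<le> 1 / 2" for i
          using of_int_round_abs_le[of "2 ^ n * z $ i"] by (simp add: w_def abs_minus_commute)
        have "z \<in> target_box (n, w)"
          unfolding target_box_def by (simp, intro allI le_less_trans[OF w]) simp
        moreover have "f \<in> box_full c (n, w)"
          unfolding box_full_def
        proof (clarsimp)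
          fix y j assume y: "y \<in> target_box (n, w)"
          show "ball_content_ge (real CARD('m) - 1 / (real j + 2)) (c n j) (cube_preimage f {y})"
          proof (rule n)
            fix i
            have "\<bar>2 ^ n * y $ i - of_int (w $ i)\<bar> < 1" using y by (simp add: target_box_def)
            with w[of i] have "\<bar>2 ^ n * y $ i - 2 ^ n * z $ i\<bar> \<le> 3 / 2" by linarith
            then have "2 ^ n * \<bar>y $ i - z $ i\<bar> \<le> 3 / 2"
              unfolding right_diff_distrib[symmetric] abs_mult power_abs abs_numeral .
            then show "\<bar>y $ i - z $ i\<bar> \<le> 3 / 2 / 2 ^ n" by (simp add: field_simps)
          qed
        qed
        ultimately show "\<exists>p. apply_bcontfun f (Abs_cube x) \<in> target_box p \<and> f \<in> box_full c p"
          unfolding z_def by blast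
      qed
    qed
  qed
  then show ?case by (simp add: f_def)
qed

section \<open>The law of the random map as a witness of shyness\<close>

theorem corollary4p15:
  "prevalent {f :: 'm::finite cube \<Rightarrow>\<^sub>C (real ^ 'd::finite).
     \<exists>U :: (real ^ 'd) set. open U \<and>
       emeasure lebesgue (cube_preimage f U) = 1 \<and>
       range (apply_bcontfun f) \<subseteq> closure (U \<inter> range (apply_bcontfun f)) \<and>
       (\<forall>y\<in>U. hausdorff_dim (cube_preimage f {y}) = ereal (real CARD('m)))}"
proof -
  \<comment> \<open>The constants are chosen once for all maps, so that \<open>G\<close> is one
    fixed Borel set.\<close>
  have "\<exists>c>0. tree_constant TYPE('m) TYPE('d) (1 / (real j + 2)) n c" for n j :: nat
    by (rule tree_constant_exists) simp_all
  then have "\<forall>n j. \<exists>c. c > 0 \<and> tree_constant TYPE('m) TYPE('d) (1 / (real j + 2)) n c" by blast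
  then obtain c where c: "\<And>n j :: nat. c n j > 0" "\<And>n j. tree_constant TYPE('m) TYPE('d) (1 / (real j + 2)) n (c n j)"
    by (meson choice)
  define G :: "('m cube \<Rightarrow>\<^sub>C (real ^ 'd)) set" where "G = good_maps c"
  interpret N: prob_space "noise :: (nat \<times> (int ^ 'm) \<Rightarrow> int ^ 'd) measure" by (rule prob_space_noise)
  let ?\<nu> = "distr noise borel (noise_map :: (nat \<times> (int ^ 'm) \<Rightarrow> int ^ 'd) \<Rightarrow> _)"
  have null: "emeasure ?\<nu> ((\<lambda>b. b + x) ` (- G)) = 0" for x
  \<comment> \<open>\<open>emeasure\<close> is 0 by default off the sigma-algebra, so the content is
    in the first case.\<close>
  proof (cases "(\<lambda>b. b + x) ` (- G) \<in> sets borel")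
    case True
    \<comment> \<open>The random map lies in the translate of \<open>- G\<close> by \<open>x\<close>
      exactly if its sum with \<open>- x\<close> is not in \<open>G\<close>.\<close>
    have "AE \<omega> in noise. - x + noise_map \<omega> \<in> G"
      unfolding G_def by (rule AE_noise_map_good) (rule c(2))
    then have "AE \<omega> in noise. noise_map \<omega> \<notin> (\<lambda>b. b + x) ` (- G)"
      by eventually_elim (auto simp: add.commute)
    then have "emeasure noise {\<omega> \<in> space noise. noise_map \<omega> \<in> (\<lambda>b. b + x) ` (- G)} = 0"
      by (rule emeasure_eq_0_AE)
    then show ?thesis
      by (subst emeasure_distr[OF measurable_noise_map True]) (simp add: vimage_def Int_def conj_commute)
  next
    case False
    then show ?thesis by (simp add: emeasure_notin_sets)
  qed
  show ?thesis
    unfolding prevalent_def shy_def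
  proof (intro bexI[of _ "- G"] conjI exI[of _ ?\<nu>] allI)
    show "- {f :: 'm cube \<Rightarrow>\<^sub>C (real ^ 'd).
     \<exists>U :: (real ^ 'd) set. open U \<and>
       emeasure lebesgue (cube_preimage f U) = 1 \<and>
       range (apply_bcontfun f) \<subseteq> closure (U \<inter> range (apply_bcontfun f)) \<and>
       (\<forall>y\<in>U. hausdorff_dim (cube_preimage f {y}) = ereal (real CARD('m)))} \<subseteq> - G"
      unfolding G_def by (intro Compl_anti_mono subsetI CollectI good_maps_full[OF _ c(1)])
    show "- G \<in> sets borel" unfolding G_def by (rule borel_comp[OF good_maps_borel])
    show "prob_space ?\<nu>" by (rule N.prob_space_distr[OF measurable_noise_map])
  qed (use null in auto)
qed

end
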